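(* In a tubular neighborhood of the orbit $u_2^*$ (the Hastings–McLeod orbit of the rescaling-chart system), the three-dimensional invariant manifolds $W^{\mathrm{cu}}_1(p^+)$ and $W^{\mathrm{cs}}_3(p^0)$, continued by the flow of the rescaling-chart system, intersect transversely in the four-dimensional phase space, with two-dimensional intersection containing $u_2^*$.
   Context: The extended system $u_\xi=v,\ v_\xi=-\mu u+u^3,\ \mu_\xi=-\epsilon(1-\mu^2),\ \epsilon_\xi=0$ is blown up at the origin by $u=r\bar u,\ v=r^2\bar v,\ \mu=r^2\bar\mu,\ \epsilon=r^3\bar\epsilon$. Three charts are used ($'$ denotes derivative in rescaled time $r_i\xi$): Chart $K_1$ ($\bar\mu=1$; $u=r_1u_1,v=r_1^2v_1,\mu=r_1^2,\epsilon=r_1^3\epsilon_1$): $u_1'=v_1+\frac12\epsilon_1u_1(1-r_1^4)$, $v_1'=-u_1+u_1^3+\epsilon_1v_1(1-r_1^4)$, $\epsilon_1'=\frac32\epsilon_1^2(1-r_1^4)$, $r_1'=-\frac12r_1\epsilon_1(1-r_1^4)$, with equilibrium $p^+:(u_1,v_1,\epsilon_1,r_1)=(1,0,0,0)$. Chart $K_2$ ("rescaling chart", $\bar\epsilon=1$; $u=r_2u_2,v=r_2^2v_2,\mu=r_2^2\mu_2,\epsilon=r_2^3$): $u_2'=v_2$, $v_2'=-\mu_2u_2+u_2^3$, $\mu_2'=-1+r_2^4\mu_2^2$, $r_2'=0$. Chart $K_3$ ($\bar\mu=-1$; $u=r_3u_3,v=r_3^2v_3,\mu=-r_3^2,\epsilon=r_3^3\epsilon_3$):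 $u_3'=v_3-\frac12\epsilon_3u_3(1-r_3^4)$, $v_3'=u_3+u_3^3-\epsilon_3v_3(1-r_3^4)$, $\epsilon_3'=-\frac32\epsilon_3^2(1-r_3^4)$, $r_3'=\frac12r_3\epsilon_3(1-r_3^4)$, with equilibrium $p^0:(u_3,v_3,\epsilon_3,r_3)=(0,0,0,0)$. Coordinate changes: $\kappa_{12}:K_1\to K_2$, $u_2=\epsilon_1^{-1/3}u_1,\ v_2=\epsilon_1^{-2/3}v_1,\ \mu_2=\epsilon_1^{-2/3},\ r_2=\epsilon_1^{1/3}r_1$ ($\epsilon_1>0$); $\kappa_{23}:K_2\to K_3$, $u_3=(-\mu_2)^{-1/2}u_2,\ v_3=(-\mu_2)^{-1}v_2,\ \epsilon_3=(-\mu_2)^{-3/2},\ r_3=r_2(-\mu_2)^{1/2}$ ($\mu_2<0$). The orbit denoted $u_2^*$ is the solution $(u_2,v_2,\mu_2,r_2)=(u_2^*(\xi_2),(u_2^* )'(\xi_2),-\xi_2,0)$ in $K_2$, where $u_2^*=\sqrt2\,w_{HM}$ and $w_{HM}$ is the Hastings–McLeod solution: the unique positive, monotone solution of $w''=\eta w+2w^3$ with $w\sim\mathrm{Ai}(\eta)$ as $\eta\to+\infty$ and $w\sim\sqrt{-\eta/2}$ as $\eta\to-\infty$. In $K_1$ it converges to $p^+$ in backward time and in $K_3$ to $p^0$ in forward time, in each case lying on a center manifold within $\{r_i=0\}$. The linearization at each of $p^+,p^0$ has one-dimensional stable and unstable eigenspaces and a two-dimensional center eigenspace. $W_1^{\mathrm{cu}}(p^+)$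 denotes the three-dimensional local center-unstable manifold of $p^+$ in $K_1$ that contains $\kappa_{12}^{-1}u_2^*$; $W_3^{\mathrm{cs}}(p^0)$ denotes the three-dimensional local center-stable manifold of $p^0$ in $K_3$ that contains $\kappa_{23}u_2^*$. Both are carried into $K_2$ by $\kappa_{12}$, $\kappa_{23}^{-1}$ and extended along $u_2^*$ by the $K_2$-flow. *)

theory Defs
  imports "HOL-Analysis.Analysis" "HOL-Library.Landau_Symbols"
begin

definition solution_on :: "('a::real_normed_vector \<Rightarrow> 'a) \<Rightarrow> (real \<Rightarrow> 'a) \<Rightarrow> real \<Rightarrow> real \<Rightarrow> bool"
  where "solution_on F y a b \<longleftrightarrow>
    (\<forall>t\<in>{a..b}. (y has_vector_derivative F (y t)) (at t within {a..b}))"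

text \<open>Orbits starting in \<open>W\<close> remain in \<open>W\<close>, in both time directions, as long as they stay in \<open>U\<close>.\<close>

definition locally_invariant :: "('a::real_normed_vector \<Rightarrow> 'a) \<Rightarrow> 'a set \<Rightarrow> 'a set \<Rightarrow> bool"
  where "locally_invariant F U W \<longleftrightarrow>
    (\<forall>y a b. solution_on F y a b \<longrightarrow> y ` {a..b} \<subseteq> U \<longrightarrow>
       (\<exists>s\<in>{a..b}. y s \<in> W) \<longrightarrow> y ` {a..b} \<subseteq> W)"

text \<open>The continuation of \<open>S\<close> by the flow of \<open>F\<close> inside \<open>N\<close>: all points that are joined to a point
  of \<open>S\<close> by an orbit segment lying in \<open>N\<close>.\<close>

definition flow_continuation :: "('a::real_normed_vector \<Rightarrow> 'a) \<Rightarrow> 'a set \<Rightarrow> 'a set \<Rightarrow> 'a set"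
  where "flow_continuation F N S =
    {x. \<exists>y a b s t. solution_on F y a b \<and> y ` {a..b} \<subseteq> N \<and>
       s \<in> {a..b} \<and> t \<in> {a..b} \<and> y s \<in> S \<and> y t = x}"

definition C1_on :: "'a::real_normed_vector set \<Rightarrow> ('a \<Rightarrow> 'b::real_normed_vector) \<Rightarrow> bool"
  where "C1_on S f \<longleftrightarrow> (\<exists>f' :: 'a \<Rightarrow> 'a \<Rightarrow>\<^sub>L 'b.
    (\<forall>x\<in>S. (f has_derivative blinfun_apply (f' x)) (at x)) \<and> continuous_on S f')"

text \<open>Embedded \<open>k\<close>-dimensional submanifolds of class \<open>C\<^sup>1\<close>, by local flattening diffeomorphisms.\<close>

definition C1_submanifold :: "nat \<Rightarrow> 'a::euclidean_space set \<Rightarrow> bool"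
  where "C1_submanifold k M \<longleftrightarrow> (\<forall>x\<in>M. \<exists>U V (\<phi> :: 'a \<Rightarrow> 'a) \<psi> S.
    open U \<and> x \<in> U \<and> open V \<and> homeomorphism U V \<phi> \<psi> \<and> C1_on U \<phi> \<and> C1_on V \<psi> \<and>
    subspace S \<and> dim S = k \<and> \<phi> ` (M \<inter> U) = V \<inter> S)"

text \<open>Velocity vectors at \<open>x\<close> of curves in \<open>M\<close>; for a submanifold, this is its tangent space.\<close>

definition tangent_space :: "'a::real_normed_vector set \<Rightarrow> 'a \<Rightarrow> 'a set"
  where "tangent_space M x = {v. \<exists>c :: real \<Rightarrow> 'a.
    c 0 = x \<and> (\<forall>\<^sub>F t in nhds 0. c t \<in> M) \<and> (c has_vector_derivative v) (at 0)}"

definition intersect_transversely :: "'a::real_normed_vector set \<Rightarrow> 'a set \<Rightarrow> bool"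
  where "intersect_transversely M N \<longleftrightarrow>
    (\<forall>x\<in>M \<inter> N. {a + b | a b. a \<in> tangent_space M x \<and> b \<in> tangent_space N x} = UNIV)"

text \<open>The sum of the real generalized eigenspaces of the linear map \<open>A\<close> for the eigenvalues
  \<open>\<lambda> = \<alpha> + i \<beta>\<close> with real part \<open>\<alpha> \<in> R\<close>. The map whose powers are taken is
  \<open>(A - \<lambda> I) (A - \<lambda>' I)\<close>, where \<open>\<lambda>'\<close> is the complex conjugate of \<open>\<lambda>\<close>.\<close>

definition spectral_subspace :: "('a::real_vector \<Rightarrow> 'a) \<Rightarrow> real set \<Rightarrow> 'a set"
  where "spectral_subspace A R = span {x. \<exists>\<alpha>\<in>R. \<exists>\<beta> n.
    ((\<lambda>y. A (A y) - (2 * \<alpha>) *\<^sub>R A y + (\<alpha>\<^sup>2 + \<beta>\<^sup>2) *\<^sub>R y) ^^ n) x = 0}"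

definition local_manifold_tangent_to ::
    "('a::euclidean_space \<Rightarrow> 'a) \<Rightarrow> 'a \<Rightarrow> nat \<Rightarrow> 'a set \<Rightarrow> 'a set \<Rightarrow> bool"
  where "local_manifold_tangent_to F p k E W \<longleftrightarrow>
    p \<in> W \<and> C1_submanifold k W \<and> tangent_space W p = E \<and>
    (\<exists>U. open U \<and> W \<subseteq> U \<and> locally_invariant F U W)"

definition local_center_unstable_manifold ::
    "('a::euclidean_space \<Rightarrow> 'a) \<Rightarrow> 'a \<Rightarrow> nat \<Rightarrow> 'a set \<Rightarrow> bool"
  where "local_center_unstable_manifold F p k W \<longleftrightarrow>
    local_manifold_tangent_to F p k (spectral_subspace (frechet_derivative F (at p)) {0..}) W"

definition local_center_stable_manifold ::
    "('a::euclidean_space \<Rightarrow> 'a) \<Rightarrow> 'a \<Rightarrow> nat \<Rightarrow> 'a set \<Rightarrow> bool"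
  where "local_center_stable_manifold F p k W \<longleftrightarrow>
    local_manifold_tangent_to F p k (spectral_subspace (frechet_derivative F (at p)) {..0}) W"

text \<open>Coordinates are \<open>(u\<^sub>1, v\<^sub>1, \<epsilon>\<^sub>1, r\<^sub>1)\<close>, \<open>(u\<^sub>2, v\<^sub>2, \<mu>\<^sub>2, r\<^sub>2)\<close> and \<open>(u\<^sub>3, v\<^sub>3, \<epsilon>\<^sub>3, r\<^sub>3)\<close>. The chart
  vector fields are polynomial and are considered on the whole four-dimensional space, so that
  \<open>{r = 0}\<close>, which contains the equilibria and the Hastings--McLeod orbit, is not a boundary.\<close>

type_synonym state = "real \<times> real \<times> real \<times> real"

definition K1_field :: "state \<Rightarrow> state"
  where "K1_field = (\<lambda>(u, v, e, r).
    (v + 1/2 * e * u * (1 - r^4),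
     - u + u^3 + e * v * (1 - r^4),
     3/2 * e^2 * (1 - r^4),
     - 1/2 * r * e * (1 - r^4)))"

definition K2_field :: "state \<Rightarrow> state"
  where "K2_field = (\<lambda>(u, v, m, r). (v, - m * u + u^3, - 1 + r^4 * m^2, 0))"

definition K3_field :: "state \<Rightarrow> state"
  where "K3_field = (\<lambda>(u, v, e, r).
    (v - 1/2 * e * u * (1 - r^4),
     u + u^3 - e * v * (1 - r^4),
     - 3/2 * e^2 * (1 - r^4),
     1/2 * r * e * (1 - r^4)))"

definition p_plus :: state where "p_plus = (1, 0, 0, 0)"

definition p_zero :: state where "p_zero = (0, 0, 0, 0)"

definition dom12 :: "state set" where "dom12 = {(u, v, e, r). e > 0}"

definition kappa12 :: "state \<Rightarrow> state"
  where "kappa12 = (\<lambda>(u, v, e, r).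
    (e powr (-1/3) * u, e powr (-2/3) * v, e powr (-2/3), e powr (1/3) * r))"

definition dom23 :: "state set" where "dom23 = {(u, v, m, r). m < 0}"

definition kappa23 :: "state \<Rightarrow> state"
  where "kappa23 = (\<lambda>(u, v, m, r).
    ((- m) powr (-1/2) * u, (- m) powr (-1) * v, (- m) powr (-3/2), r * (- m) powr (1/2)))"

text \<open>The Airy function, as the improper integral
  \<open>Ai(x) = 1/\<pi> \<integral>\<^sub>0\<^sup>\<infinity> cos (t\<^sup>3/3 + x t) dt\<close>.\<close>

definition Airy_Ai :: "real \<Rightarrow> real"
  where "Airy_Ai x = Lim at_top (\<lambda>T. integral {0..T} (\<lambda>t. cos (t^3 / 3 + x * t))) / pi"

definition hastings_mcleod :: "(real \<Rightarrow> real) \<Rightarrow> bool"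
  where "hastings_mcleod w \<longleftrightarrow>
    (\<forall>x. (w has_real_derivative deriv w x) (at x)) \<and>
    (\<forall>x. (deriv w has_real_derivative x * w x + 2 * w x ^ 3) (at x)) \<and>
    (\<forall>x. w x > 0) \<and> (mono w \<or> antimono w) \<and>
    w \<sim>[at_top] Airy_Ai \<and> w \<sim>[at_bot] (\<lambda>x. sqrt (- x / 2))"

definition hm_orbit :: "(real \<Rightarrow> real) \<Rightarrow> real \<Rightarrow> state"
  where "hm_orbit w \<xi> = (sqrt 2 * w \<xi>, sqrt 2 * deriv w \<xi>, - \<xi>, 0)"

text \<open>A tube of variable radius around a curve \<open>\<gamma>\<close>, with cross sections \<open>\<mu>\<^sub>2 = const\<close>. Since
  \<open>hm_orbit w\<close> is a graph over the \<open>\<mu>\<^sub>2\<close>-axis, it is transverse to these sections, and for continuous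
  \<open>\<delta> > 0\<close> the tube around it is a tubular neighborhood.\<close>

definition tube :: "(real \<Rightarrow> state) \<Rightarrow> (real \<Rightarrow> real) \<Rightarrow> state set"
  where "tube \<gamma> \<delta> = {\<gamma> \<xi> + (a, b, 0, c) | \<xi> a b c. norm (a, b, 0::real, c) < \<delta> \<xi>}"

end

theory Submission
  imports Defs
begin

text \<open>
  Near the orbit \<open>r\<^sup>4 \<mu>\<^sup>2 < 1\<close>, so \<open>s = - \<mu>\<close> can serve as time and the flow of the rescaling chart becomes
  a time-dependent flow in \<open>(u, v, r)\<close> with the Hastings--McLeod orbit as the line over \<open>(0, 0, 0)\<close> in
  co-moving coordinates. Flowing from the section \<open>s = 0\<close> gives a \<open>C\<^sup>1\<close> diffeomorphism \<open>Psi\<close> under which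
  orbits are the lines \<open>(s, x)\<close> with \<open>x\<close> fixed, and local invariance turns each continued manifold
  into a relatively open part of a set \<open>{G x = 0}\<close> with a \<open>C\<^sup>1\<close> function \<open>G\<close> of \<open>x\<close> alone.
  So it suffices that the two differentials are independent at \<open>x = 0\<close>. A common null vector with
  vanishing \<open>r\<close>-component is a solution of \<open>y'' = (s + 6 w\<^sup>2) y\<close>. Its logarithmic derivative is close to
  \<open>sqrt (2 \<bar>s\<bar>)\<close> for \<open>s \<rightarrow> -\<infinity>\<close> and to \<open>- sqrt s\<close> for \<open>s \<rightarrow> \<infinity>\<close>, by the spectral data at the two equilibria.
  The function \<open>z = - w' > 0\<close> satisfies \<open>z'' = (s + 6 w\<^sup>2) z - w\<close>, whence the Wronskian \<open>y' z - y z'\<close> increases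
  as long as \<open>y > 0\<close>. It starts out positive at the left end and would have to tend to zero at the
  right end, so \<open>y = 0\<close>.
\<close>

section \<open>C1 maps and level sets\<close>

text \<open>\<open>W1\<close> and \<open>W3\<close> may be any C1 manifolds along the orbit with the
  prescribed tangent space and local invariance, so the eigenvectors at the equilibria carry all
  quantitative information. Nearby, tangent planes are known up to an error only; the tolerance 2/5
  around the slopes sqrt 2 and -1 leaves slopes of at least 1 and at most -1/2. In the rescaling
  chart these get multiplied by sqrt \<bar>s\<bar>. On the left one time is enough, chosen with w''
  > w', where the Wronskian is positive for every logarithmic derivative \<ge> 1. On the right the
  decay estimate needs the slope at all late times, hence the transport of kernels along the flow.
  The r-direction never has to be computed: functionals that are independent on the plane of
  vanishing r-component are independent. Convergence to \<open>p_plus\<close> requires w' =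
  o(\<bar>s\<bar>), which does not follow from the asymptotics of w alone and is extracted from the
  differential equation. The cut-offs make the flow complete, so \<open>Psi\<close> is a
  diffeomorphism of the whole space and only the set \<open>good\<close>, where it is faithful to
  the original field, has to be tracked.\<close>

lemma C1_onI:
  assumes "\<And>x. x \<in> S \<Longrightarrow> (f has_derivative blinfun_apply (f' x)) (at x)" "continuous_on S f'"
  shows "C1_on S f"
  using assms unfolding C1_on_def by blast

lemma C1_onE:
  assumes "C1_on S f"
  obtains f' where "\<And>x. x \<in> S \<Longrightarrow> (f has_derivative blinfun_apply (f' x)) (at x)" "continuous_on S f'"
  using assms unfolding C1_on_def by blast

lemma C1_on_subset: "C1_on S f \<Longrightarrow> T \<subseteq> S \<Longrightarrow> C1_on T f"
  unfolding C1_on_def by (meson continuous_on_subset subsetD)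

lemma C1_on_imp_continuous_on: "C1_on S f \<Longrightarrow> continuous_on S f"
  by (metis C1_onE continuous_at_imp_continuous_on has_derivative_continuous)

lemma C1_on_bounded_linear:
  assumes "bounded_linear f" shows "C1_on S f"
proof (rule C1_onI)
  show "(f has_derivative blinfun_apply (Blinfun f)) (at x)" for x
    by (simp add: assms bounded_linear_Blinfun_apply bounded_linear_imp_has_derivative)
qed simp

lemma C1_on_const: "C1_on S (\<lambda>x. c)"
  by (rule C1_onI[where f' = "\<lambda>_. 0"]) (auto simp: zero_blinfun.rep_eq)

lemma C1_on_compose:
  assumes f: "C1_on S f" and g: "C1_on T g" and ST: "f ` S \<subseteq> T"
  shows "C1_on S (\<lambda>x. g (f x))"
proof -
  obtain f' where f': "\<And>x. x \<in> S \<Longrightarrow> (f has_derivative blinfun_apply (f' x)) (at x)" "continuous_on S f'"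
    using f by (metis C1_onE)
  obtain g' where g': "\<And>x. x \<in> T \<Longrightarrow> (g has_derivative blinfun_apply (g' x)) (at x)" "continuous_on T g'"
    using g by (metis C1_onE)
  show ?thesis
  proof (rule C1_onI[where f' = "\<lambda>x. g' (f x) o\<^sub>L f' x"])
    fix x assume x: "x \<in> S"
    have "((g \<circ> f) has_derivative blinfun_apply (g' (f x)) \<circ> blinfun_apply (f' x)) (at x)"
      by (rule diff_chain_at[OF f'(1)[OF x] g'(1)]) (use x ST in auto)
    then show "((\<lambda>x. g (f x)) has_derivative blinfun_apply (g' (f x) o\<^sub>L f' x)) (at x)"
      by (simp add: o_def blinfun_compose.rep_eq)
  next
    have "continuous_on S (\<lambda>x. g' (f x))"
      by (rule continuous_on_compose2[OF g'(2) C1_on_imp_continuous_on[OF f] ST])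
    then show "continuous_on S (\<lambda>x. g' (f x) o\<^sub>L f' x)"
      by (intro bounded_bilinear.continuous_on[OF bounded_bilinear_blinfun_compose] f'(2))
  qed
qed

lemma C1_on_bounded_linear_compose:
  assumes "bounded_linear L" "C1_on S f" shows "C1_on S (\<lambda>x. L (f x))"
  using C1_on_compose[OF assms(2) C1_on_bounded_linear[OF assms(1), of UNIV]] by simp

lemma C1_on_fst: "C1_on S f \<Longrightarrow> C1_on S (\<lambda>x. fst (f x))"
  and C1_on_snd: "C1_on S f \<Longrightarrow> C1_on S (\<lambda>x. snd (f x))"
  by (auto intro: C1_on_bounded_linear_compose bounded_linear_fst bounded_linear_snd)

lemma C1_on_id: "C1_on S (\<lambda>x. x)"
  by (rule C1_on_bounded_linear) (rule bounded_linear_ident)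

lemma C1_on_add:
  assumes "C1_on S f" "C1_on S g" shows "C1_on S (\<lambda>x. f x + g x)"
proof -
  obtain f' where f': "\<And>x. x \<in> S \<Longrightarrow> (f has_derivative blinfun_apply (f' x)) (at x)" "continuous_on S f'"
    using assms(1) by (metis C1_onE)
  obtain g' where g': "\<And>x. x \<in> S \<Longrightarrow> (g has_derivative blinfun_apply (g' x)) (at x)" "continuous_on S g'"
    using assms(2) by (metis C1_onE)
  show ?thesis
    by (rule C1_onI[where f' = "\<lambda>x. f' x + g' x"])
      (auto simp: plus_blinfun.rep_eq intro!: has_derivative_add f' g' continuous_on_add)
qed

lemma C1_on_bilinear:
  assumes b: "bounded_bilinear b" and "C1_on S f" "C1_on S g" shows "C1_on S (\<lambda>x. b (f x) (g x))"
proof -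
  interpret bounded_bilinear b by fact
  obtain f' where f': "\<And>x. x \<in> S \<Longrightarrow> (f has_derivative blinfun_apply (f' x)) (at x)" "continuous_on S f'"
    using assms(2) by (metis C1_onE)
  obtain g' where g': "\<And>x. x \<in> S \<Longrightarrow> (g has_derivative blinfun_apply (g' x)) (at x)" "continuous_on S g'"
    using assms(3) by (metis C1_onE)
  have c: "continuous_on S f" "continuous_on S g"
    using assms(2,3) by (auto intro: C1_on_imp_continuous_on)
  show ?thesis
  proof (rule C1_onI[where f' = "\<lambda>x. (prod_left (g x) o\<^sub>L f' x) + (prod_right (f x) o\<^sub>L g' x)"])
    fix x assume "x \<in> S"
    then show "((\<lambda>x. b (f x) (g x)) has_derivative
        blinfun_apply ((prod_left (g x) o\<^sub>L f' x) + (prod_right (f x) o\<^sub>L g' x))) (at x)"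
      by (auto simp: plus_blinfun.rep_eq prod_left.rep_eq prod_right.rep_eq add.commute
          intro!: derivative_eq_intros f' g' FDERIV)
  next
    show "continuous_on S (\<lambda>x. (prod_left (g x) o\<^sub>L f' x) + (prod_right (f x) o\<^sub>L g' x))"
      by (intro continuous_intros f' g' c
          bounded_bilinear.continuous_on[OF bounded_bilinear_blinfun_compose]
          bounded_linear.continuous_on[OF bounded_linear_prod_left]
          bounded_linear.continuous_on[OF bounded_linear_prod_right])
  qed
qed

lemma C1_on_mult:
  fixes f g :: "_ \<Rightarrow> real"
  shows "C1_on S f \<Longrightarrow> C1_on S g \<Longrightarrow> C1_on S (\<lambda>x. f x * g x)"
  by (rule C1_on_bilinear[OF bounded_bilinear_mult])

lemma C1_on_scaleR: "C1_on S f \<Longrightarrow> C1_on S g \<Longrightarrow> C1_on S (\<lambda>x. f x *\<^sub>R g x)"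
  by (rule C1_on_bilinear[OF bounded_bilinear_scaleR])

lemma C1_on_minus: "C1_on S f \<Longrightarrow> C1_on S (\<lambda>x. - f x)"
  by (rule C1_on_bounded_linear_compose[OF bounded_linear_minus[OF bounded_linear_ident]])

lemma C1_on_diff: "C1_on S f \<Longrightarrow> C1_on S g \<Longrightarrow> C1_on S (\<lambda>x. f x - g x)"
  using C1_on_add[OF _ C1_on_minus, of S f g] by simp

lemma C1_on_power:
  fixes f :: "_ \<Rightarrow> real"
  shows "C1_on S f \<Longrightarrow> C1_on S (\<lambda>x. f x ^ n)"
  by (induction n) (auto intro: C1_on_const C1_on_mult)

lemma C1_on_Pair:
  assumes "C1_on S f" "C1_on S g" shows "C1_on S (\<lambda>x. (f x, g x))"
proof -
  have 1: "bounded_linear (\<lambda>a. (a, 0))" "bounded_linear (\<lambda>a. (0, a))"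
    by (auto intro: bounded_linear_Pair bounded_linear_ident bounded_linear_zero)
  have "C1_on S (\<lambda>x. (f x, 0) + (0, g x))"
    by (intro C1_on_add C1_on_bounded_linear_compose[OF 1(1) assms(1)]
        C1_on_bounded_linear_compose[OF 1(2) assms(2)])
  then show ?thesis by simp
qed

lemma C1_on_real_compose:
  fixes h :: "real \<Rightarrow> 'b::real_normed_vector"
  assumes f: "C1_on S f" and h: "\<And>x. x \<in> T \<Longrightarrow> (h has_vector_derivative h' x) (at x)"
    and c: "continuous_on T h'" and ST: "f ` S \<subseteq> T"
  shows "C1_on S (\<lambda>x. h (f x))"
proof (rule C1_on_compose[OF f _ ST])
  show "C1_on T h"
  proof (rule C1_onI[where f' = "\<lambda>x. blinfun_scaleR_left (h' x)"])
    show "(h has_derivative blinfun_apply (blinfun_scaleR_left (h' x))) (at x)" if "x \<in> T" for x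
      using h[OF that] by (simp add: has_vector_derivative_def)
    show "continuous_on T (\<lambda>x. blinfun_scaleR_left (h' x))"
      by (intro bounded_linear.continuous_on[OF bounded_linear_blinfun_scaleR_left] c)
  qed
qed

lemma C1_on_inverse:
  fixes f :: "_ \<Rightarrow> real"
  assumes f: "C1_on S f" and "\<And>x. x \<in> S \<Longrightarrow> f x \<noteq> 0" shows "C1_on S (\<lambda>x. inverse (f x))"
proof (rule C1_on_real_compose[OF f, where T = "- {0}" and h' = "\<lambda>x. - (inverse x * inverse x)"])
  show "(inverse has_vector_derivative - (inverse x * inverse x)) (at x)" if "x \<in> - {0}" for x :: real
    using that DERIV_inverse'[OF DERIV_ident, of x] by (auto simp: has_real_derivative_iff_has_vector_derivative)
qed (use assms in \<open>auto intro!: continuous_intros\<close>)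

lemma C1_on_sqrt:
  assumes f: "C1_on S f" and "\<And>x. x \<in> S \<Longrightarrow> f x > 0" shows "C1_on S (\<lambda>x. sqrt (f x))"
proof (rule C1_on_real_compose[OF f, where T = "{0<..}" and h' = "\<lambda>x. inverse (sqrt x) / 2"])
  show "(sqrt has_vector_derivative inverse (sqrt x) / 2) (at x)" if "x \<in> {0<..}" for x :: real
    using that DERIV_real_sqrt[of x] by (auto simp: has_real_derivative_iff_has_vector_derivative)
qed (use assms in \<open>auto intro!: continuous_intros\<close>)

lemmas C1_intros = C1_on_const C1_on_id C1_on_fst C1_on_snd C1_on_add C1_on_diff C1_on_minus
  C1_on_mult C1_on_scaleR C1_on_power C1_on_Pair

text \<open>The identity \<open>B x - B y = - B x (A x - A y) B y\<close> does the work. Once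
  \<open>A x - A y\<close> is small against \<open>norm (B y)\<close>, the factor \<open>B x\<close>
  can be absorbed, so \<open>norm (B x)\<close> is at most \<open>2 * norm (B y)\<close>; using the
  identity again gives convergence.\<close>

lemma blinfun_inverse_continuous:
  fixes A B :: "'t::topological_space \<Rightarrow> ('a::real_normed_vector \<Rightarrow>\<^sub>L 'a)"
  assumes cA: "continuous_on V A"
    and l: "\<And>y. y \<in> V \<Longrightarrow> A y o\<^sub>L B y = id_blinfun" and r: "\<And>y. y \<in> V \<Longrightarrow> B y o\<^sub>L A y = id_blinfun"
  shows "continuous_on V B"
  unfolding continuous_on_def
proof
  fix y assume y: "y \<in> V"
  let ?b = "norm (B y)"
  have AV: "(A \<longlongrightarrow> A y) (at y within V)" using cA y by (auto simp: continuous_on_def)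
  have ev: "\<forall>\<^sub>F x in at y within V. norm (B x - B y) \<le> 2 * ?b * ?b * norm (A x - A y)"
  proof -
    have "((\<lambda>x. norm (A x - A y) * ?b) \<longlongrightarrow> 0 * ?b) (at y within V)"
      by (intro tendsto_intros) (use AV in \<open>simp add: Lim_null[symmetric] tendsto_norm_zero_iff LIM_zero\<close>)
    then have "\<forall>\<^sub>F x in at y within V. norm (A x - A y) * ?b < 1/2"
      by (auto dest!: order_tendstoD(2)[where a="1/2"])
    moreover have "\<forall>\<^sub>F x in at y within V. x \<in> V" by (simp add: eventually_at_topological) (metis UNIV_I open_UNIV)
    ultimately show ?thesis
    proof eventually_elim
      case (elim x)
      have eq: "B x - B y = - (B x o\<^sub>L ((A x - A y) o\<^sub>L B y))"
      proof (rule blinfun_eqI)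
        fix v
        have "blinfun_apply (A y) (blinfun_apply (B y) v) = v"
          using l[OF y] by (metis blinfun_apply_blinfun_compose blinfun_apply_id_blinfun)
        moreover have "blinfun_apply (B x) (blinfun_apply (A x) (blinfun_apply (B y) v)) = blinfun_apply (B y) v"
          using r[OF elim(2)] by (metis blinfun_apply_blinfun_compose blinfun_apply_id_blinfun)
        ultimately show "blinfun_apply (B x - B y) v = blinfun_apply (- (B x o\<^sub>L ((A x - A y) o\<^sub>L B y))) v"
          by (simp add: blinfun.bilinear_simps)
      qed
      have n: "norm (B x - B y) \<le> norm (B x) * (norm (A x - A y) * ?b)"
        unfolding eq norm_minus_cancel
        by (meson norm_blinfun_compose order_trans mult_left_mono norm_ge_zero)
      also have "\<dots> \<le> norm (B x) * (1/2)" using elim by (intro mult_left_mono) auto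
      finally have "norm (B x) \<le> 2 * ?b"
        using norm_triangle_ineq2[of "B x" "B y"] by simp
      then have "norm (B x) * (norm (A x - A y) * ?b) \<le> 2 * ?b * (norm (A x - A y) * ?b)"
        by (intro mult_right_mono) auto
      then show ?case using n by (simp add: algebra_simps)
    qed
  qed
  have "((\<lambda>x. 2 * ?b * ?b * norm (A x - A y)) \<longlongrightarrow> 2 * ?b * ?b * 0) (at y within V)"
    by (intro tendsto_intros) (use AV in \<open>simp add: tendsto_norm_zero_iff LIM_zero\<close>)
  then have "((\<lambda>x. B x - B y) \<longlongrightarrow> 0) (at y within V)"
    by (intro Lim_null_comparison[OF ev]) simp
  then show "(B \<longlongrightarrow> B y) (at y within V)" by (simp add: LIM_zero_cancel)
qed

text \<open>Openness of the image and continuity of the inverse come from invariance of domain. A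
  trivial kernel makes the derivative bijective, since both dimensions agree, and inversion of
  operators preserves continuity, so the inverse is C1.\<close>

lemma C1_inverse_function:
  fixes f :: "'a::euclidean_space \<Rightarrow> 'a"
  assumes "open S" and inj: "inj_on f S"
    and df: "\<And>x. x \<in> S \<Longrightarrow> (f has_derivative blinfun_apply (f' x)) (at x)" and cf: "continuous_on S f'"
    and ker: "\<And>x v. x \<in> S \<Longrightarrow> blinfun_apply (f' x) v = 0 \<Longrightarrow> v = 0"
  shows "open (f ` S)" "homeomorphism S (f ` S) f (the_inv_into S f)" "C1_on (f ` S) (the_inv_into S f)"
proof -
  let ?g = "the_inv_into S f"
  define h where "h x = Blinfun (inv (blinfun_apply (f' x)))" for x
  have inv: "bij (blinfun_apply (f' x))" "blinfun_apply (h x) = inv (blinfun_apply (f' x))" if "x \<in> S" for x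
  proof -
    have lin: "linear (blinfun_apply (f' x))" by (simp add: blinfun.bounded_linear_right bounded_linear.linear)
    have "inj (blinfun_apply (f' x))"
      using ker[OF that] by (simp add: linear_injective_0[OF lin])
    then show b: "bij (blinfun_apply (f' x))"
      using linear_injective_imp_surjective[OF lin _ refl] by (simp add: bij_def)
    then have "linear (inv (blinfun_apply (f' x)))"
      by (intro inj_linear_imp_inv_linear lin bij_is_inj)
    then show "blinfun_apply (h x) = inv (blinfun_apply (f' x))"
      unfolding h_def by (simp add: linear_conv_bounded_linear bounded_linear_Blinfun_apply)
  qed
  have hl: "f' x o\<^sub>L h x = id_blinfun" "h x o\<^sub>L f' x = id_blinfun" if "x \<in> S" for x
    using inv[OF that] by (auto intro!: blinfun_eqI simp: bij_is_surj surj_f_inv_f bij_is_inj)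
  have c: "continuous_on S f" by (meson df has_derivative_continuous continuous_at_imp_continuous_on)
  show op: "open (f ` S)" by (rule invariance_of_domain[OF c \<open>open S\<close> inj])
  obtain g where g: "homeomorphism S (f ` S) f g"
    using invariance_of_domain_homeomorphism[OF \<open>open S\<close> c _ inj] by auto
  have gg: "g y = ?g y" if y: "y \<in> f ` S" for y
  proof -
    obtain x where x: "x \<in> S" "y = f x" using y by blast
    then show ?thesis using g inj by (simp add: homeomorphism_def the_inv_into_f_f)
  qed
  show hom: "homeomorphism S (f ` S) f ?g"
    by (rule homeomorphism_cong[OF g]) (simp_all add: gg)
  then have cg: "continuous_on (f ` S) ?g" by (simp add: homeomorphism_def)
  have gS: "?g y \<in> S" if "y \<in> f ` S" for y using that hom by (auto simp: homeomorphism_def)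
  show "C1_on (f ` S) ?g"
  proof (rule C1_onI[where f' = "\<lambda>y. h (?g y)"])
    fix y assume y: "y \<in> f ` S"
    show "(?g has_derivative blinfun_apply (h (?g y))) (at y)"
    proof (rule has_derivative_inverse_strong_x[where f = f and g = ?g and y = y and S = S, OF \<open>open S\<close> gS[OF y] c])
      show "?g (f x) = x" if "x \<in> S" for x using that inj by (simp add: the_inv_into_f_f)
      show "(f has_derivative blinfun_apply (f' (?g y))) (at (?g y))" by (rule df[OF gS[OF y]])
      show "blinfun_apply (f' (?g y)) \<circ> blinfun_apply (h (?g y)) = id"
        using hl(1)[OF gS[OF y]] by (auto simp: fun_eq_iff dest: arg_cong[where f = blinfun_apply])
      show "f (?g y) = y" by (rule f_the_inv_into_f[OF inj y])
    qed
  next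
    have "continuous_on S h" by (rule blinfun_inverse_continuous[OF cf hl])
    then show "continuous_on (f ` S) (\<lambda>y. h (?g y))"
      by (rule continuous_on_compose2[OF _ cg]) (use gS in auto)
  qed
qed

section \<open>Level sets of submersions and their tangent spaces\<close>

lemma linear_subspace_kernel:
  assumes "linear A" shows "subspace {x. A x = 0}"
  using linear_0[OF assms] by (simp add: subspace_def linear_add[OF assms] linear_scale[OF assms])

text \<open>The range of a right inverse of \<open>A\<close> is a complement of the kernel, of the
  dimension of the target.\<close>

lemma dim_kernel_surj:
  fixes A :: "'a::euclidean_space \<Rightarrow> 'b::euclidean_space"
  assumes A: "linear A" "surj A"
  shows "dim {x. A x = 0} = DIM('a) - DIM('b)"
proof -
  obtain R where R: "linear R" "A \<circ> R = id" using linear_surjective_right_inverse[OF A] by auto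
  then have AR: "A (R y) = y" for y by (metis comp_apply id_apply)
  then have "inj R" by (metis injI)
  then have d: "dim (range R) = DIM('b)"
    using dim_image_eq[OF R(1), of UNIV] by (simp add: inj_on_subset)
  have s: "subspace {x. A x = 0}" "subspace (range R)"
    using A R by (auto simp: linear_subspace_kernel linear_subspace_image)
  have "x \<in> {a + b |a b. a \<in> {x. A x = 0} \<and> b \<in> range R}" for x
    by (rule CollectI, rule exI[of _ "x - R (A x)"], rule exI[of _ "R (A x)"])
      (simp add: linear_diff[OF A(1)] AR)
  then have "{a + b |a b. a \<in> {x. A x = 0} \<and> b \<in> range R} = UNIV" by auto
  moreover have "{x. A x = 0} \<inter> range R = {0}"
  proof
    show "{x. A x = 0} \<inter> range R \<subseteq> {0}" using AR linear_0[OF R(1)] by auto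
    show "{0} \<subseteq> {x. A x = 0} \<inter> range R"
      using linear_0[OF A(1)] linear_0[OF R(1)] by (auto intro: range_eqI[of _ _ 0])
  qed
  ultimately show ?thesis using dim_sums_Int[OF s] d by simp
qed

text \<open>With \<open>A = g' x\<close> and a right inverse \<open>R\<close> of \<open>A\<close>, the chart \<open>\<phi> y = y - R (A y) + R (g y)\<close> satisfies
  \<open>A (\<phi> y) = g y\<close>, so it maps the level set into the kernel of \<open>A\<close>, and its derivative at \<open>x\<close> is the identity.\<close>

lemma level_set_straightening:
  fixes g :: "'a::euclidean_space \<Rightarrow> 'b::euclidean_space"
  assumes "open Y" "x \<in> Y" and g: "\<And>x. x \<in> Y \<Longrightarrow> (g has_derivative blinfun_apply (g' x)) (at x)" "continuous_on Y g'"
    and surj: "surj (blinfun_apply (g' x))" and "g x = 0"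
  obtains U V \<phi> \<psi> where "open U" "x \<in> U" "U \<subseteq> Y" "open V" "homeomorphism U V \<phi> \<psi>" "C1_on U \<phi>" "C1_on V \<psi>"
    "\<And>y. y \<in> U \<Longrightarrow> blinfun_apply (g' x) (\<phi> y) = g y" "(\<psi> has_derivative id) (at (\<phi> x))"
proof -
  let ?A = "g' x"
  have A: "linear (blinfun_apply ?A)" by (simp add: blinfun.bounded_linear_right bounded_linear.linear)
  obtain R where R: "linear R" "blinfun_apply ?A \<circ> R = id"
    using linear_surjective_right_inverse[OF A surj] by auto
  then have AR: "blinfun_apply ?A (R y) = y" for y by (metis comp_apply id_apply)
  define R' where "R' = Blinfun R"
  have R': "blinfun_apply R' = R" unfolding R'_def
    using R(1) by (simp add: linear_conv_bounded_linear bounded_linear_Blinfun_apply)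
  define \<phi> where "\<phi> y = y - R (blinfun_apply ?A y) + R (g y)" for y
  define d\<phi> where "d\<phi> y = id_blinfun - (R' o\<^sub>L ?A) + (R' o\<^sub>L g' y)" for y
  have d: "(\<phi> has_derivative blinfun_apply (d\<phi> y)) (at y)" if "y \<in> Y" for y
  proof -
    have b: "bounded_linear R" "bounded_linear (blinfun_apply ?A)"
      using R(1) by (auto simp: linear_conv_bounded_linear blinfun.bounded_linear_right)
    have "(\<phi> has_derivative (\<lambda>v. v - R (blinfun_apply ?A v) + R (blinfun_apply (g' y) v))) (at y)"
      unfolding \<phi>_def
      by (intro has_derivative_add has_derivative_diff has_derivative_ident
          bounded_linear.has_derivative[OF b(1)] bounded_linear.has_derivative[OF b(2)] g(1)[OF that])
    then show ?thesis by (simp add: d\<phi>_def R' plus_blinfun.rep_eq minus_blinfun.rep_eq)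
  qed
  have c: "continuous_on Y d\<phi>" unfolding d\<phi>_def
    by (intro continuous_intros bounded_bilinear.continuous_on[OF bounded_bilinear_blinfun_compose] g(2))
  have x1: "d\<phi> x = id_blinfun" by (simp add: d\<phi>_def)
  obtain U V \<psi> \<psi>' where U: "open U" "U \<subseteq> Y" "x \<in> U" "open V" "\<phi> x \<in> V" "homeomorphism U V \<phi> \<psi>"
    "\<And>y. y \<in> V \<Longrightarrow> (\<psi> has_derivative (\<psi>' y)) (at y)"
    "\<And>y. y \<in> V \<Longrightarrow> \<psi>' y = inv (blinfun_apply (d\<phi> (\<psi> y)))"
    "\<And>y. y \<in> V \<Longrightarrow> bij (blinfun_apply (d\<phi> (\<psi> y)))"
  proof (rule inverse_function_theorem[OF \<open>open Y\<close> d c \<open>x \<in> Y\<close>, of id_blinfun])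
    show "id_blinfun o\<^sub>L d\<phi> x = id_blinfun" unfolding x1 by (rule blinfun_eqI) simp
  qed auto
  have inj: "inj_on \<phi> U" and VU: "V = \<phi> ` U" using U(6)
    by (metis homeomorphism_apply1 inj_onI) (use U(6) in \<open>simp add: homeomorphism_def\<close>)
  have bij: "bij (blinfun_apply (d\<phi> y))" if "y \<in> U" for y
    using U(6,9) that by (metis VU homeomorphism_apply1 image_eqI)
  \<comment> \<open>The inverse function theorem supplies a differentiable inverse; its C1 property
    comes from the global version above, whose inverse agrees with \<open>\<psi>\<close> on
    \<open>V\<close>.\<close>
  have *: "homeomorphism U V \<phi> (the_inv_into U \<phi>)" "C1_on V (the_inv_into U \<phi>)"
  proof -
    have k: "v = 0" if "y \<in> U" "blinfun_apply (d\<phi> y) v = 0" for y v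
      using bij[OF that(1)] that(2) by (metis bij_is_inj blinfun.zero_right inj_eq)
    have d': "(\<phi> has_derivative blinfun_apply (d\<phi> y)) (at y)" if "y \<in> U" for y
      using d U(2) that by blast
    note * = C1_inverse_function[OF U(1) inj d' continuous_on_subset[OF c U(2)] k]
    show "homeomorphism U V \<phi> (the_inv_into U \<phi>)" unfolding VU by (rule *(2))
    show "C1_on V (the_inv_into U \<phi>)" unfolding VU by (rule *(3))
  qed
  have eq: "the_inv_into U \<phi> y = \<psi> y" if "y \<in> V" for y
    using that *(1) U(6) inj by (metis homeomorphism_def the_inv_into_f_f imageI)
  have d1: "(\<psi> has_derivative id) (at (\<phi> x))"
  proof -
    have "inv (blinfun_apply (id_blinfun :: 'a \<Rightarrow>\<^sub>L 'a)) = id" by (simp add: id_blinfun.rep_eq id_def[symmetric])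
    then show ?thesis using U(7)[OF U(5)] U(8)[OF U(5)] homeomorphism_apply1[OF U(6,3)] x1 by simp
  qed
  have d1': "(the_inv_into U \<phi> has_derivative id) (at (\<phi> x))"
    by (rule has_derivative_transform_within_open[OF d1 U(4,5)]) (simp add: eq)
  show thesis
  proof (rule that[OF U(1,3,2,4) *(1) _ *(2) _ d1'])
    show "C1_on U \<phi>" by (rule C1_onI[where f' = d\<phi>]) (use U(2) d c continuous_on_subset in blast)+
    show "blinfun_apply (g' x) (\<phi> y) = g y" for y
      by (simp add: \<phi>_def blinfun.bilinear_simps AR)
  qed
qed

text \<open>\<open>rel\<close> asks \<open>M\<close> to be only relatively open in the zero set of
  \<open>g\<close>, because a continued manifold is in general just a piece of it. Shrinking the
  straightening neighbourhood accordingly makes \<open>M\<close> correspond to the full kernel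
  there. For the tangent space, differentiating \<open>g\<close> along curves in \<open>M\<close>
  gives one inclusion and the curves \<open>\<psi> (\<phi> x + t v)\<close> give the other, as the
  derivative of \<open>\<psi>\<close> at \<open>\<phi> x\<close> is the identity.\<close>

lemma level_set_submanifold:
  fixes g :: "'a::euclidean_space \<Rightarrow> 'b::euclidean_space"
  assumes Y: "open Y" "M \<subseteq> Y" and g: "\<And>x. x \<in> Y \<Longrightarrow> (g has_derivative blinfun_apply (g' x)) (at x)" "continuous_on Y g'"
    and surj: "\<And>x. x \<in> M \<Longrightarrow> surj (blinfun_apply (g' x))"
    and zero: "\<And>x. x \<in> M \<Longrightarrow> g x = 0"
    and rel: "\<And>x. x \<in> M \<Longrightarrow> \<exists>V. open V \<and> x \<in> V \<and> (\<forall>y\<in>V \<inter> Y. g y = 0 \<longrightarrow> y \<in> M)"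
  shows "C1_submanifold (DIM('a) - DIM('b)) M"
    and "x \<in> M \<Longrightarrow> tangent_space M x = {v. blinfun_apply (g' x) v = 0}"
proof -
  have lin: "linear (blinfun_apply (g' x))" for x by (simp add: blinfun.bounded_linear_right bounded_linear.linear)
  have main: "\<exists>U V \<phi> \<psi>. open U \<and> x \<in> U \<and> U \<subseteq> Y \<and> open V \<and> homeomorphism U V \<phi> \<psi> \<and> C1_on U \<phi> \<and> C1_on V \<psi>
      \<and> \<phi> ` (M \<inter> U) = V \<inter> {v. blinfun_apply (g' x) v = 0} \<and> (\<psi> has_derivative id) (at (\<phi> x))" if x: "x \<in> M" for x
  proof -
    obtain N where N: "open N" "x \<in> N" "\<forall>y\<in>N \<inter> Y. g y = 0 \<longrightarrow> y \<in> M" using rel[OF x] by auto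
    have sub: "N \<inter> Y \<subseteq> Y" by auto
    obtain U V \<phi> \<psi> where U: "open U" "x \<in> U" "U \<subseteq> N \<inter> Y" "open V" "homeomorphism U V \<phi> \<psi>" "C1_on U \<phi>" "C1_on V \<psi>"
      "\<And>y. y \<in> U \<Longrightarrow> blinfun_apply (g' x) (\<phi> y) = g y" "(\<psi> has_derivative id) (at (\<phi> x))"
      by (rule level_set_straightening[of "N \<inter> Y" x g g'])
        (use N Y x g zero surj continuous_on_subset[OF g(2) sub] in auto)
    have "\<phi> ` (M \<inter> U) = V \<inter> {v. blinfun_apply (g' x) v = 0}"
    proof
      show "\<phi> ` (M \<inter> U) \<subseteq> V \<inter> {v. blinfun_apply (g' x) v = 0}"
        using U(5) U(8) zero by (auto simp: homeomorphism_def)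
      show "V \<inter> {v. blinfun_apply (g' x) v = 0} \<subseteq> \<phi> ` (M \<inter> U)"
      proof
        fix v assume v: "v \<in> V \<inter> {v. blinfun_apply (g' x) v = 0}"
        then have *: "\<psi> v \<in> U" "\<phi> (\<psi> v) = v" using U(5) by (auto simp: homeomorphism_def)
        then have "g (\<psi> v) = 0" using U(8)[of "\<psi> v"] v by simp
        then have "\<psi> v \<in> M" using N(3) U(3) * by auto
        then show "v \<in> \<phi> ` (M \<inter> U)" using * by (metis IntI imageI)
      qed
    qed
    then show ?thesis using U by blast
  qed
  show "C1_submanifold (DIM('a) - DIM('b)) M"
    unfolding C1_submanifold_def
  proof
    fix x assume x: "x \<in> M"
    obtain U V \<phi> \<psi> where "open U" "x \<in> U" "open V" "homeomorphism U V \<phi> \<psi>" "C1_on U \<phi>" "C1_on V \<psi>"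
      "\<phi> ` (M \<inter> U) = V \<inter> {v. blinfun_apply (g' x) v = 0}" using main[OF x] by blast
    moreover have "subspace {v. blinfun_apply (g' x) v = 0}" by (rule linear_subspace_kernel[OF lin])
    moreover have "dim {v. blinfun_apply (g' x) v = 0} = DIM('a) - DIM('b)"
      by (rule dim_kernel_surj[OF lin surj[OF x]])
    ultimately show "\<exists>U V (\<phi> :: 'a \<Rightarrow> 'a) \<psi> S. open U \<and> x \<in> U \<and> open V \<and> homeomorphism U V \<phi> \<psi> \<and> C1_on U \<phi> \<and> C1_on V \<psi> \<and>
      subspace S \<and> dim S = DIM('a) - DIM('b) \<and> \<phi> ` (M \<inter> U) = V \<inter> S" by blast
  qed
  show "tangent_space M x = {v. blinfun_apply (g' x) v = 0}" if x: "x \<in> M"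
  proof safe
    fix v assume "v \<in> tangent_space M x"
    then obtain c where c: "c 0 = x" "\<forall>\<^sub>F t in nhds 0. c t \<in> M" "(c has_vector_derivative v) (at 0)"
      unfolding tangent_space_def by auto
    have "((g \<circ> c) has_vector_derivative blinfun_apply (g' x) v) (at 0)"
      by (rule vector_derivative_diff_chain_within[OF c(3), of g "blinfun_apply (g' x)"])
        (use g(1)[of x] c(1) x Y in \<open>auto intro: has_derivative_at_withinI\<close>)
    moreover have "((g \<circ> c) has_vector_derivative 0) (at 0)"
    proof -
      have "\<forall>\<^sub>F t in nhds 0. t \<in> UNIV \<longrightarrow> (g \<circ> c) t = 0"
        using c(2) by eventually_elim (simp add: zero)
      moreover have "(g \<circ> c) 0 = 0" using c(1) zero[OF x] by simp
      ultimately show ?thesis by (simp add: has_vector_derivative_cong_ev[where g = "\<lambda>_. 0"])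
    qed
    ultimately show "blinfun_apply (g' x) v = 0" by (rule vector_derivative_unique_at)
  next
    fix v assume v: "blinfun_apply (g' x) v = 0"
    obtain U V \<phi> \<psi> where U: "open U" "x \<in> U" "U \<subseteq> Y" "open V" "homeomorphism U V \<phi> \<psi>"
      "\<phi> ` (M \<inter> U) = V \<inter> {v. blinfun_apply (g' x) v = 0}" "(\<psi> has_derivative id) (at (\<phi> x))"
      using main[OF x] by blast
    let ?c = "\<lambda>t::real. \<psi> (\<phi> x + t *\<^sub>R v)"
    have px: "\<phi> x \<in> V" "\<psi> (\<phi> x) = x" "blinfun_apply (g' x) (\<phi> x) = 0"
      using U x by (auto simp: homeomorphism_def)
    have "((\<lambda>t. \<phi> x + t *\<^sub>R v) \<longlongrightarrow> \<phi> x + 0 *\<^sub>R v) (nhds 0)"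
      by (intro tendsto_intros filterlim_ident)
    then have "\<forall>\<^sub>F t in nhds 0. \<phi> x + t *\<^sub>R v \<in> V"
      using U(4) px(1) by (auto simp: tendsto_def)
    then have "\<forall>\<^sub>F t in nhds 0. ?c t \<in> M"
    proof eventually_elim
      case (elim t)
      then have "\<phi> x + t *\<^sub>R v \<in> \<phi> ` (M \<inter> U)" using v px(3) U(6) by (simp add: blinfun.bilinear_simps)
      then show ?case using U(5) by (auto simp: homeomorphism_def)
    qed
    moreover have "(?c has_vector_derivative v) (at 0)"
    proof -
      have "((\<lambda>t. \<phi> x + t *\<^sub>R v) has_vector_derivative v) (at 0)" by (auto intro!: derivative_eq_intros)
      then have "((\<psi> \<circ> (\<lambda>t. \<phi> x + t *\<^sub>R v)) has_vector_derivative id v) (at 0)"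
        by (rule vector_derivative_diff_chain_within) (use U(7) in \<open>auto simp: id_def intro: has_derivative_at_withinI\<close>)
      then show ?thesis by (simp add: o_def)
    qed
    ultimately show "v \<in> tangent_space M x" unfolding tangent_space_def using px
      by (intro CollectI exI[of _ ?c]) auto
  qed
qed

text \<open>In codimension one the flat model is a hyperplane with normal \<open>n\<close>, so
  \<open>n \<bullet> \<phi> x\<close> is a defining function. Its differential is nonzero because,
  by the chain rule for \<open>\<phi> \<circ> \<psi>\<close>, the derivative of
  \<open>\<phi>\<close> has \<open>n\<close> in its range.\<close>

lemma C1_submanifold_hyperplane_chart:
  fixes W :: "'a::euclidean_space set"
  assumes "C1_submanifold k W" "Suc k = DIM('a)" "p \<in> W"
  obtains U and g :: "'a \<Rightarrow> real" and g' where "open U" "p \<in> U"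
    "\<And>x. x \<in> U \<Longrightarrow> (g has_derivative blinfun_apply (g' x)) (at x)" "continuous_on U g'"
    "\<And>x. x \<in> U \<Longrightarrow> x \<in> W \<longleftrightarrow> g x = 0" "\<And>x. x \<in> U \<Longrightarrow> g' x \<noteq> 0"
proof -
  obtain U V and \<phi> :: "'a \<Rightarrow> 'a" and \<psi> S where U: "open U" "p \<in> U" "open V" "homeomorphism U V \<phi> \<psi>" "C1_on U \<phi>" "C1_on V \<psi>"
    "subspace S" "dim S = k" "\<phi> ` (W \<inter> U) = V \<inter> S"
    using bspec[OF assms(1)[unfolded C1_submanifold_def] assms(3)] by (elim exE conjE) (rule that)
  obtain n where n: "n \<noteq> 0" "span S = {x. n \<bullet> x = 0}"
  proof -
    have "dim S = DIM('a) - 1" using U(8) assms(2) by linarith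
    then show thesis using that dim_eq_hyperplane[of S] by blast
  qed
  have S: "S = {x. n \<bullet> x = 0}" using span_eq_iff[THEN iffD2, OF U(7)] n(2) by simp
  obtain \<phi>' where \<phi>': "\<And>x. x \<in> U \<Longrightarrow> (\<phi> has_derivative blinfun_apply (\<phi>' x)) (at x)" "continuous_on U \<phi>'"
    using U(5) by (metis C1_onE)
  obtain \<psi>' where \<psi>': "\<And>x. x \<in> V \<Longrightarrow> (\<psi> has_derivative blinfun_apply (\<psi>' x)) (at x)"
    using U(6) by (metis C1_onE)
  show thesis
  proof (rule that[OF U(1,2), of "\<lambda>x. n \<bullet> \<phi> x" "\<lambda>x. blinfun_inner_right n o\<^sub>L \<phi>' x"])
    fix x assume x: "x \<in> U"
    show "((\<lambda>x. n \<bullet> \<phi> x) has_derivative blinfun_apply (blinfun_inner_right n o\<^sub>L \<phi>' x)) (at x)"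
      by (auto intro!: derivative_eq_intros \<phi>'(1)[OF x])
    show "x \<in> W \<longleftrightarrow> n \<bullet> \<phi> x = 0"
    proof
      assume "x \<in> W"
      then have "\<phi> x \<in> V \<inter> S" unfolding U(9)[symmetric] using x by (intro imageI) simp
      then show "n \<bullet> \<phi> x = 0" by (simp add: S)
    next
      assume "n \<bullet> \<phi> x = 0"
      moreover have "\<phi> x \<in> V" using x U(4) by (auto simp: homeomorphism_def)
      ultimately have "\<phi> x \<in> V \<inter> S" by (simp add: S)
      then have "\<phi> x \<in> \<phi> ` (W \<inter> U)" using U(9) by simp
      then obtain y where y: "y \<in> W" "y \<in> U" "\<phi> x = \<phi> y" by (elim imageE) blast
      then have "x = y" using homeomorphism_apply1[OF U(4) x] homeomorphism_apply1[OF U(4) y(2)] by argo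
      then show "x \<in> W" using y(1) by simp
    qed
    show "blinfun_inner_right n o\<^sub>L \<phi>' x \<noteq> 0"
    proof
      assume 0: "blinfun_inner_right n o\<^sub>L \<phi>' x = 0"
      have fx: "\<phi> x \<in> V" "\<psi> (\<phi> x) = x" using U(4) x by (auto simp: homeomorphism_def)
      have "((\<phi> \<circ> \<psi>) has_derivative blinfun_apply (\<phi>' x) \<circ> blinfun_apply (\<psi>' (\<phi> x))) (at (\<phi> x))"
        by (rule diff_chain_at[OF \<psi>'[OF fx(1)]]) (use \<phi>'(1)[OF x] fx in simp)
      moreover have "((\<phi> \<circ> \<psi>) has_derivative id) (at (\<phi> x))"
        by (rule has_derivative_transform_within_open[OF has_derivative_id U(3) fx(1)])
          (use U(4) in \<open>auto simp: homeomorphism_def\<close>)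
      ultimately have "blinfun_apply (\<phi>' x) \<circ> blinfun_apply (\<psi>' (\<phi> x)) = id"
        by (rule has_derivative_unique)
      then have "blinfun_apply (blinfun_inner_right n o\<^sub>L \<phi>' x) (blinfun_apply (\<psi>' (\<phi> x)) n) = n \<bullet> n"
        by (simp add: fun_eq_iff)
      then have "n \<bullet> n = 0" unfolding 0 by (simp add: zero_blinfun.rep_eq)
      then show False using n(1) by simp
    qed
  next
    show "continuous_on U (\<lambda>x. blinfun_inner_right n o\<^sub>L \<phi>' x)"
      by (intro bounded_bilinear.continuous_on[OF bounded_bilinear_blinfun_compose] continuous_intros \<phi>'(2))
  qed
qed

section \<open>Flows of compactly supported fields\<close>

text \<open>Squaring keeps the norm differentiable at zeros of \<open>e\<close>. The inequality
  \<open>2 * a * c \<le> a^2 + c^2\<close> absorbs the inhomogeneity \<open>c\<close> and costs the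
  extra 1 in the exponent.\<close>

lemma gronwall_forward:
  fixes e :: "real \<Rightarrow> 'a::real_inner"
  assumes T: "0 \<le> T" and L: "0 \<le> L"
    and d: "\<And>t. 0 \<le> t \<Longrightarrow> t \<le> T \<Longrightarrow> (e has_vector_derivative e' t) (at t)"
    and b: "\<And>t. 0 \<le> t \<Longrightarrow> t \<le> T \<Longrightarrow> norm (e' t) \<le> L * norm (e t) + c"
  shows "(norm (e T))\<^sup>2 + c\<^sup>2 \<le> ((norm (e 0))\<^sup>2 + c\<^sup>2) * exp ((2 * L + 1) * T)"
proof -
  define \<phi> where "\<phi> t = (e t \<bullet> e t + c\<^sup>2) * exp (- ((2 * L + 1) * t))" for t
  have "\<phi> T \<le> \<phi> 0"
  proof (rule DERIV_nonpos_imp_nonincreasing[OF T])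
    fix t assume t: "0 \<le> t" "t \<le> T"
    have 1: "((\<lambda>t. e t \<bullet> e t) has_real_derivative 2 * (e t \<bullet> e' t)) (at t)"
      using d[OF t] by (auto simp: has_real_derivative_iff_has_vector_derivative has_vector_derivative_def
          inner_commute algebra_simps intro!: derivative_eq_intros)
    let ?y = "(2 * (e t \<bullet> e' t) - (2 * L + 1) * (e t \<bullet> e t + c\<^sup>2)) * exp (- ((2 * L + 1) * t))"
    have "(\<phi> has_real_derivative ?y) (at t)"
      unfolding \<phi>_def by (auto intro!: derivative_eq_intros 1 simp: algebra_simps)
    moreover have "?y \<le> 0"
    proof (rule mult_nonpos_nonneg)
      have "e t \<bullet> e' t \<le> norm (e t) * (L * norm (e t) + c)"
        using norm_cauchy_schwarz[of "e t" "e' t"] mult_left_mono[OF b[OF t], of "norm (e t)"] by simp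
      then have "2 * (e t \<bullet> e' t) \<le> 2 * L * (norm (e t))\<^sup>2 + 2 * norm (e t) * c"
        by (simp add: power2_eq_square algebra_simps)
      also have "\<dots> \<le> 2 * L * (norm (e t))\<^sup>2 + ((norm (e t))\<^sup>2 + c\<^sup>2)"
        using sum_squares_bound[of "norm (e t)" c] by simp
      also have "\<dots> \<le> (2 * L + 1) * ((norm (e t))\<^sup>2 + c\<^sup>2)"
        using L by (simp add: algebra_simps)
      finally show "2 * (e t \<bullet> e' t) - (2 * L + 1) * (e t \<bullet> e t + c\<^sup>2) \<le> 0"
        by (simp add: power2_norm_eq_inner)
    qed simp
    ultimately show "\<exists>y. (\<phi> has_real_derivative y) (at t) \<and> y \<le> 0" by blast
  qed
  then have "((norm (e T))\<^sup>2 + c\<^sup>2) * exp (- ((2 * L + 1) * T)) \<le> (norm (e 0))\<^sup>2 + c\<^sup>2"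
    by (simp add: \<phi>_def power2_norm_eq_inner)
  moreover have "a \<le> b * exp X" if "a * exp (- X) \<le> b" for a b X :: real
    using that by (simp add: exp_minus field_simps)
  ultimately show ?thesis by blast
qed

text \<open>Both directions of time are reduced to the forward one by running along
  \<open>\<alpha> + \<sigma> * t\<close> with \<open>\<sigma>\<close> equal to 1 or -1. The bound on
  \<open>e'\<close> is confined to a window of size \<open>K\<close>, since Lipschitz constants will
  be uniform only there.\<close>

lemma gronwall:
  fixes e :: "real \<Rightarrow> 'a::real_inner"
  assumes L: "0 \<le> L" "0 \<le> c"
    and d: "\<And>t. (e has_vector_derivative e' t) (at t)"
    and b: "\<And>t. \<bar>t\<bar> \<le> K \<Longrightarrow> norm (e' t) \<le> L * norm (e t) + c"
    and ab: "\<bar>\<alpha>\<bar> \<le> K" "\<bar>\<beta>\<bar> \<le> K"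
  shows "norm (e \<beta>) \<le> (norm (e \<alpha>) + c) * exp ((L + 1) * \<bar>\<beta> - \<alpha>\<bar>)"
proof -
  define \<sigma> where "\<sigma> = (if \<alpha> \<le> \<beta> then 1 else - 1 :: real)"
  define T where "T = \<bar>\<beta> - \<alpha>\<bar>"
  have \<sigma>: "\<bar>\<sigma>\<bar> = 1" "\<alpha> + \<sigma> * T = \<beta>" by (auto simp: \<sigma>_def T_def)
  have "(norm (e (\<alpha> + \<sigma> * T)))\<^sup>2 + c\<^sup>2 \<le> ((norm (e (\<alpha> + \<sigma> * 0)))\<^sup>2 + c\<^sup>2) * exp ((2 * L + 1) * T)"
  proof (rule gronwall_forward[where e = "\<lambda>t. e (\<alpha> + \<sigma> * t)" and e' = "\<lambda>t. \<sigma> *\<^sub>R e' (\<alpha> + \<sigma> * t)"])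
    fix t assume t: "0 \<le> t" "t \<le> T"
    have "((\<lambda>t. \<alpha> + \<sigma> * t) has_vector_derivative \<sigma>) (at t)"
      by (auto intro!: derivative_eq_intros simp: has_vector_derivative_def)
    then show "((\<lambda>t. e (\<alpha> + \<sigma> * t)) has_vector_derivative \<sigma> *\<^sub>R e' (\<alpha> + \<sigma> * t)) (at t)"
      using vector_diff_chain_at[of "\<lambda>t. \<alpha> + \<sigma> * t" \<sigma> t e] d by (simp add: o_def)
    have "\<bar>\<alpha> + \<sigma> * t\<bar> \<le> K" using t ab by (auto simp: \<sigma>_def T_def split: if_splits)
    then show "norm (\<sigma> *\<^sub>R e' (\<alpha> + \<sigma> * t)) \<le> L * norm (e (\<alpha> + \<sigma> * t)) + c"
      using b \<sigma> by simp
  qed (use L in \<open>auto simp: T_def\<close>)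
  then have "(norm (e \<beta>))\<^sup>2 \<le> ((norm (e \<alpha>))\<^sup>2 + c\<^sup>2) * exp ((2 * L + 1) * T)"
    using \<sigma> zero_le_power2[of c] by (simp only: mult_zero_right add_0_right)
  also have "\<dots> \<le> (norm (e \<alpha>) + c)\<^sup>2 * exp (2 * ((L + 1) * T))"
    by (intro mult_mono) (use L in \<open>auto simp: power2_sum T_def algebra_simps\<close>)
  also have "\<dots> = ((norm (e \<alpha>) + c) * exp ((L + 1) * T))\<^sup>2"
    by (simp add: power_mult_distrib exp_double)
  finally show ?thesis unfolding T_def
    by (rule power2_le_imp_le) (use L in auto)
qed

section \<open>Global solutions by Picard iteration\<close>

definition primitive :: "(real \<Rightarrow> 'a::euclidean_space) \<Rightarrow> real \<Rightarrow> 'a"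
  where "primitive g t = (LBINT s=0..t. g s)"

lemma primitive_0 [simp]: "primitive g 0 = 0"
  by (simp add: primitive_def flip: zero_ereal_def)

lemma primitive_has_vector_derivative:
  assumes "continuous_on UNIV g"
  shows "(primitive g has_vector_derivative g t) (at t)"
proof -
  let ?K = "\<bar>t\<bar> + 1"
  have "((\<lambda>u. LBINT y=ereal 0..u. g y) has_vector_derivative g t) (at t within {-?K..?K})"
    by (rule interval_integral_FTC2) (use assms in \<open>auto intro: continuous_on_subset\<close>)
  moreover have "at t within {-?K..?K} = at t"
    by (rule at_within_interior) (simp add: abs_if)
  ultimately show ?thesis by (simp add: primitive_def[abs_def] zero_ereal_def)
qed

text \<open>Powers of \<bar>t\<bar> are kept because the factorials in Picard iteration come from
  integrating them repeatedly; \<open>n = 0\<close> serves for the passage to the limit in the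
  integral equation.\<close>

lemma primitive_bound:
  fixes G :: "real \<Rightarrow> 'a::real_normed_vector"
  assumes d: "\<And>t. (G has_vector_derivative g t) (at t)" and 0: "G 0 = 0"
    and b: "\<And>t. \<bar>t\<bar> \<le> K \<Longrightarrow> norm (g t) \<le> C * \<bar>t\<bar> ^ n" and t: "\<bar>t\<bar> \<le> K"
  shows "norm (G t) \<le> C * \<bar>t\<bar> ^ Suc n / Suc n"
proof (cases "t = 0")
  case False
  have "norm (G (sgn t * \<bar>t\<bar>) - G (sgn t * 0)) \<le> C * \<bar>t\<bar> ^ Suc n / Suc n - C * 0 ^ Suc n / Suc n"
  proof (rule differentiable_bound_general[where f = "\<lambda>s. G (sgn t * s)" and f' = "\<lambda>s. sgn t *\<^sub>R g (sgn t * s)"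
        and \<phi>' = "\<lambda>s. C * s ^ n"])
    have *: "((\<lambda>s. G (sgn t * s)) has_vector_derivative sgn t *\<^sub>R g (sgn t * s)) (at s)" for s
    proof -
      have "((\<lambda>s. sgn t * s) has_vector_derivative sgn t) (at s)"
        by (auto intro!: derivative_eq_intros simp: has_vector_derivative_def)
      then show ?thesis using vector_diff_chain_at[of "\<lambda>s. sgn t * s" "sgn t" s G] d by (simp add: o_def)
    qed
    then show "((\<lambda>s. G (sgn t * s)) has_vector_derivative sgn t *\<^sub>R g (sgn t * s)) (at s)" for s .
    show "continuous_on {0..\<bar>t\<bar>} (\<lambda>s. G (sgn t * s))"
      by (intro continuous_at_imp_continuous_on ballI has_vector_derivative_continuous[OF *])
    have "((\<lambda>s. C / Suc n * s ^ Suc n) has_real_derivative C / Suc n * (Suc n * s ^ n)) (at s)" for s :: real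
      using DERIV_pow[of "Suc n" s] by (intro DERIV_cmult) (simp del: of_nat_Suc power_Suc)
    then show "((\<lambda>s. C * s ^ Suc n / Suc n) has_vector_derivative C * s ^ n) (at s)" for s
      by (simp add: has_real_derivative_iff_has_vector_derivative del: of_nat_Suc power_Suc)
    show "norm (sgn t *\<^sub>R g (sgn t * s)) \<le> C * s ^ n" if "0 < s" "s < \<bar>t\<bar>" for s
      using b[of "sgn t * s"] that t False by (simp add: abs_mult abs_sgn_eq)
    show "continuous_on {0..\<bar>t\<bar>} (\<lambda>s. C * s ^ Suc n / Suc n)" by (intro continuous_intros) simp
  qed (use False in simp)
  then show ?thesis using 0 by (simp add: sgn_mult_abs)
qed (use 0 in simp)

text \<open>The Lipschitz constant may depend on the time window but not on the state, so the
  iterates converge uniformly on every window. The limit is given by one series for all times and is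
  therefore the same for all windows.\<close>

lemma picard_exists:
  fixes f :: "real \<times> 'a::euclidean_space \<Rightarrow> 'a"
  assumes cont: "continuous_on UNIV f"
    and lip: "\<And>K. \<exists>L\<ge>0. \<forall>t x y. \<bar>t\<bar> \<le> K \<longrightarrow> norm (f (t, x) - f (t, y)) \<le> L * norm (x - y)"
  shows "\<exists>y. y 0 = x0 \<and> (\<forall>t. (y has_vector_derivative f (t, y t)) (at t))"
proof -
  define \<psi> where "\<psi> = rec_nat (\<lambda>t. x0) (\<lambda>n u t. x0 + primitive (\<lambda>s. f (s, u s)) t)"
  have \<psi>0: "\<psi> 0 = (\<lambda>t. x0)" and \<psi>S: "\<psi> (Suc n) = (\<lambda>t. x0 + primitive (\<lambda>s. f (s, \<psi> n s)) t)" for n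
    by (simp_all add: \<psi>_def)
  have comp: "continuous_on UNIV (\<lambda>s. f (s, u s))" if "continuous_on UNIV u" for u
    by (rule continuous_on_compose2[OF cont]) (auto intro!: continuous_intros that)
  have c: "continuous_on UNIV (\<psi> n)" for n
  proof (induction n)
    case (Suc n)
    show ?case unfolding \<psi>S
      by (intro continuous_intros continuous_at_imp_continuous_on ballI
          has_vector_derivative_continuous[OF primitive_has_vector_derivative[OF comp[OF Suc]]])
  qed (simp add: \<psi>0)
  have d: "(\<psi> (Suc n) has_vector_derivative f (t, \<psi> n t)) (at t)" for n t
    unfolding \<psi>S using primitive_has_vector_derivative[OF comp[OF c], of n t] by (auto intro!: derivative_eq_intros)
  have z: "\<psi> n 0 = x0" for n by (cases n) (auto simp: \<psi>0 \<psi>S)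
  define y where "y t = x0 + (\<Sum>n. \<psi> (Suc n) t - \<psi> n t)" for t
  have ul: "uniform_limit {-K..K} \<psi> y sequentially" if K: "0 \<le> K" for K
  proof -
    obtain L where L: "L \<ge> 0" "\<And>t x y. \<bar>t\<bar> \<le> K \<Longrightarrow> norm (f (t, x) - f (t, y)) \<le> L * norm (x - y)"
      using lip by meson
    have "compact ((\<lambda>s. f (s, x0)) ` {-K..K})"
      by (intro compact_continuous_image continuous_on_subset[OF comp]) auto
    then obtain C where "\<forall>x\<in>(\<lambda>s. f (s, x0)) ` {-K..K}. norm x \<le> C"
      using compact_imp_bounded bounded_iff by blast
    then have C: "norm (f (s, x0)) \<le> C" if "\<bar>s\<bar> \<le> K" for s
      using that by (auto simp: abs_le_iff)
    have C0: "C \<ge> 0" using C[of 0] K norm_ge_zero[of "f (0,x0)"] by linarith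
    have bd: "norm (\<psi> (Suc n) t - \<psi> n t) \<le> C * L ^ n / fact n * \<bar>t\<bar> ^ Suc n / Suc n" if "\<bar>t\<bar> \<le> K" for n t
      using that
    proof (induction n arbitrary: t)
      case 0
      have "norm (\<psi> (Suc 0) t - x0) \<le> C * \<bar>t\<bar> ^ Suc 0 / Suc 0"
        by (rule primitive_bound[where g = "\<lambda>t. f (t, x0)" and K = K])
          (use d[of 0] C 0 z in \<open>auto simp: \<psi>0 intro!: derivative_eq_intros\<close>)
      then show ?case by (simp add: \<psi>0)
    next
      case (Suc n)
      have "norm (\<psi> (Suc (Suc n)) t - \<psi> (Suc n) t) \<le> L * (C * L ^ n / fact n / Suc n) * \<bar>t\<bar> ^ Suc (Suc n) / Suc (Suc n)"
      proof (rule primitive_bound[where g = "\<lambda>t. f (t, \<psi> (Suc n) t) - f (t, \<psi> n t)" and K = K])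
        show "((\<lambda>t. \<psi> (Suc (Suc n)) t - \<psi> (Suc n) t) has_vector_derivative f (t, \<psi> (Suc n) t) - f (t, \<psi> n t)) (at t)" for t
          by (intro has_vector_derivative_diff d)
        show "norm (f (t, \<psi> (Suc n) t) - f (t, \<psi> n t)) \<le> L * (C * L ^ n / fact n / Suc n) * \<bar>t\<bar> ^ Suc n" if "\<bar>t\<bar> \<le> K" for t
          using L(2)[OF that, of "\<psi> (Suc n) t" "\<psi> n t"] mult_left_mono[OF Suc.IH[OF that] L(1)] by (simp add: mult_ac)
      qed (use z Suc.prems in auto)
      also have "\<dots> = C * L ^ Suc n / fact (Suc n) * \<bar>t\<bar> ^ Suc (Suc n) / Suc (Suc n)"
        by (simp add: field_simps)
      finally show ?case .
    qed
    define M where "M n = C * K * ((L * K) ^ n / fact n)" for n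
    have "norm (\<psi> (Suc n) t - \<psi> n t) \<le> M n" if "t \<in> {-K..K}" for n t
    proof -
      have t: "\<bar>t\<bar> \<le> K" using that by auto
      have "C * L ^ n / fact n * \<bar>t\<bar> ^ Suc n / Suc n \<le> C * L ^ n / fact n * K ^ Suc n / 1"
        by (intro frac_le mult_left_mono power_mono t) (use C0 L K in auto)
      moreover have "C * L ^ n / fact n * K ^ Suc n / 1 = M n" by (simp add: M_def power_mult_distrib)
      ultimately show ?thesis using bd[OF t, of n] by linarith
    qed
    moreover have "summable M" unfolding M_def
      by (intro summable_mult) (use summable_exp[of "L * K"] in \<open>simp add: field_simps\<close>)
    ultimately have "uniform_limit {-K..K} (\<lambda>n t. \<Sum>i<n. \<psi> (Suc i) t - \<psi> i t) (\<lambda>t. \<Sum>n. \<psi> (Suc n) t - \<psi> n t) sequentially"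
      by (rule Weierstrass_m_test)
    then have "uniform_limit {-K..K} (\<lambda>n t. x0 + (\<Sum>i<n. \<psi> (Suc i) t - \<psi> i t)) y sequentially"
      unfolding y_def by (intro uniform_limit_intros)
    moreover have "x0 + (\<Sum>i<n. \<psi> (Suc i) t - \<psi> i t) = \<psi> n t" for n t
      using sum_lessThan_telescope[of "\<lambda>i. \<psi> i t" n] by (simp add: \<psi>0)
    ultimately show ?thesis by simp
  qed
  have cy: "continuous_on UNIV y"
  proof (rule continuous_at_imp_continuous_on, rule ballI)
    fix t :: real
    have "continuous_on {-(\<bar>t\<bar>+1)..\<bar>t\<bar>+1} y"
      by (rule uniform_limit_theorem[OF _ ul]) (auto intro!: always_eventually continuous_on_subset[OF c])
    then show "isCont y t" by (rule continuous_on_interior) (simp add: abs_if)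
  qed
  have yt: "y t = x0 + primitive (\<lambda>s. f (s, y s)) t" for t
  proof -
    let ?K = "\<bar>t\<bar>"
    obtain L where L: "L \<ge> 0" "\<And>t x y. \<bar>t\<bar> \<le> ?K \<Longrightarrow> norm (f (t, x) - f (t, y)) \<le> L * norm (x - y)"
      using lip by meson
    have l1: "(\<lambda>n. \<psi> n t) \<longlonglongrightarrow> y t"
      by (rule tendsto_uniform_limitI[OF ul[of ?K]]) auto
    have "(\<lambda>n. \<psi> (Suc n) t) \<longlonglongrightarrow> x0 + primitive (\<lambda>s. f (s, y s)) t"
    proof (rule LIMSEQ_I)
      fix r :: real assume r: "r > 0"
      \<comment> \<open>The summand 1 keeps the denominator positive when \<open>L * ?K = 0\<close>,
        and still leaves the error \<open>L * e * ?K\<close> of the integral below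
        \<open>r\<close>.\<close>
      define e where "e = r / (L * ?K + 1)"
      have e: "e > 0" "L * e * ?K < r"
      proof -
        show "e > 0" using r L(1) by (simp add: e_def add_nonneg_pos)
        have "L * ?K < L * ?K + 1" "L * ?K + 1 > 0" using L(1) by (auto simp: add_nonneg_pos)
        then show "L * e * ?K < r" using r by (simp add: e_def field_simps)
      qed
      obtain N where N: "\<And>n s. n \<ge> N \<Longrightarrow> s \<in> {-?K..?K} \<Longrightarrow> dist (\<psi> n s) (y s) < e"
        using uniform_limitD[OF ul[of ?K] e(1)] unfolding eventually_sequentially by force
      show "\<exists>no. \<forall>n\<ge>no. norm (\<psi> (Suc n) t - (x0 + primitive (\<lambda>s. f (s, y s)) t)) < r"
      proof (intro exI allI impI)
        fix n assume n: "N \<le> n"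
        have "norm (\<psi> (Suc n) t - (x0 + primitive (\<lambda>s. f (s, y s)) t)) \<le> (L * e) * \<bar>t\<bar> ^ Suc 0 / Suc 0"
        proof (rule primitive_bound[where g = "\<lambda>t. f (t, \<psi> n t) - f (t, y t)" and K = ?K])
          show "((\<lambda>t. \<psi> (Suc n) t - (x0 + primitive (\<lambda>s. f (s, y s)) t)) has_vector_derivative
              f (t, \<psi> n t) - f (t, y t)) (at t)" for t
            using primitive_has_vector_derivative[OF comp[OF cy], of t]
            by (intro has_vector_derivative_diff d) (auto intro!: derivative_eq_intros)
          show "norm (f (s, \<psi> n s) - f (s, y s)) \<le> L * e * \<bar>s\<bar> ^ 0" if s: "\<bar>s\<bar> \<le> ?K" for s
          proof -
            have "norm (\<psi> n s - y s) \<le> e" using N[OF n, of s] s by (auto simp: dist_norm abs_le_iff)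
            from mult_left_mono[OF this L(1)] show ?thesis using L(2)[OF s, of "\<psi> n s" "y s"] by simp
          qed
        qed (use z in auto)
        then show "norm (\<psi> (Suc n) t - (x0 + primitive (\<lambda>s. f (s, y s)) t)) < r" using e(2) by simp
      qed
    qed
    then show ?thesis using LIMSEQ_unique LIMSEQ_Suc[OF l1] by blast
  qed
  have y: "(\<lambda>t. x0 + primitive (\<lambda>s. f (s, y s)) t) = y" by (rule ext) (rule yt[symmetric])
  show ?thesis
  proof (intro exI[of _ y] conjI allI)
    have "x0 + primitive (\<lambda>s. f (s, y s)) 0 = x0" by simp
    then show "y 0 = x0" unfolding fun_cong[OF y] .
    have "((\<lambda>t. x0 + primitive (\<lambda>s. f (s, y s)) t) has_vector_derivative f (t, y t)) (at t)" for t
      using primitive_has_vector_derivative[OF comp[OF cy], of t] by (auto intro!: derivative_eq_intros)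
    then show "(y has_vector_derivative f (t, y t)) (at t)" for t
      unfolding y .
  qed
qed

text \<open>Uniform continuity on the compact 1-neighbourhood of \<open>C\<close>, which contains
  every point compared once \<open>d \<le> 1\<close>.\<close>

lemma uniformly_continuous_near_compact:
  fixes A :: "'a::euclidean_space \<Rightarrow> 'b::real_normed_vector"
  assumes "continuous_on UNIV A" "compact C" "0 < \<epsilon>"
  obtains d where "0 < d" "\<And>c z. c \<in> C \<Longrightarrow> dist z c < d \<Longrightarrow> dist (A z) (A c) < \<epsilon>"
proof -
  define C' where "C' = {x + y |x y. x \<in> C \<and> y \<in> cball 0 1}"
  have "compact C'" unfolding C'_def by (rule compact_sums[OF \<open>compact C\<close> compact_cball])
  then have "uniformly_continuous_on C' A"
    by (intro compact_uniformly_continuous continuous_on_subset[OF assms(1)]) auto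
  then obtain d where d: "d > 0" "\<And>x x'. x \<in> C' \<Longrightarrow> x' \<in> C' \<Longrightarrow> dist x' x < d \<Longrightarrow> dist (A x') (A x) < \<epsilon>"
    unfolding uniformly_continuous_on_def using \<open>0 < \<epsilon>\<close> by meson
  show thesis
  proof (rule that[of "min d 1"])
    fix c z assume c: "c \<in> C" "dist z c < min d 1"
    have "c \<in> C'" unfolding C'_def using c(1) by (intro CollectI exI[of _ c] exI[of _ 0]) auto
    moreover have "z \<in> C'" unfolding C'_def using c
      by (intro CollectI exI[of _ c] exI[of _ "z - c"]) (auto simp: dist_norm norm_minus_commute)
    ultimately show "dist (A z) (A c) < \<epsilon>" using d(2) c(2) by simp
  qed (use d in auto)
qed

text \<open>An increment is split into a move in the second variable, controlled uniformly for
  nearby times, and a move in time at fixed \<open>x\<close>. The uniform part is what Gronwall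
  delivers for \<open>flow\<close> and \<open>dflow\<close>.\<close>

lemma continuous_on_Times_of_locally_uniform:
  fixes g :: "real \<Rightarrow> 'a::metric_space \<Rightarrow> 'b::metric_space"
  assumes t: "\<And>x. continuous_on UNIV (\<lambda>t. g t x)"
    and x: "\<And>K x e. 0 < e \<Longrightarrow> \<exists>d>0. \<forall>t x'. \<bar>t\<bar> \<le> K \<longrightarrow> dist x' x < d \<longrightarrow> dist (g t x') (g t x) < e"
  shows "continuous_on UNIV (\<lambda>(t, x). g t x)"
proof (rule continuous_at_imp_continuous_on, clarify)
  fix t x
  show "isCont (\<lambda>(t, x). g t x) (t, x)"
    unfolding continuous_at_eps_delta
  proof clarsimp
    fix e :: real assume e: "0 < e"
    have "isCont (\<lambda>t. g t x) t" using t[of x] by (simp add: continuous_on_eq_continuous_at)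
    then obtain d1 where d1: "d1 > 0" "\<And>t'. dist t' t < d1 \<Longrightarrow> dist (g t' x) (g t x) < e / 2"
      unfolding continuous_at_eps_delta using e by (meson half_gt_zero)
    obtain d2 where d2: "d2 > 0" "\<And>t' x'. \<bar>t'\<bar> \<le> \<bar>t\<bar> + 1 \<Longrightarrow> dist x' x < d2 \<Longrightarrow> dist (g t' x') (g t' x) < e / 2"
      using x[of "e / 2" "\<bar>t\<bar> + 1" x] e by auto
    show "\<exists>d>0. \<forall>a b. dist (a, b) (t, x) < d \<longrightarrow> dist (g a b) (g t x) < e"
    proof (intro exI[of _ "min (min d1 d2) 1"] conjI allI impI)
      fix a b assume d: "dist (a, b) (t, x) < min (min d1 d2) 1"
      have "dist a t \<le> dist (a, b) (t, x)" "dist b x \<le> dist (a, b) (t, x)"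
        by (auto simp: dist_Pair_Pair intro: real_le_rsqrt)
      then have "dist a t < d1" "dist a t < 1" "dist b x < d2" using d by auto
      moreover from this have "\<bar>a\<bar> \<le> \<bar>t\<bar> + 1" by (auto simp: dist_real_def)
      ultimately have "dist (g a b) (g a x) < e / 2" "dist (g a x) (g t x) < e / 2"
        using d1 d2 by auto
      then show "dist (g a b) (g t x) < e" using dist_triangle[of "g a b" "g t x" "g a x"] by linarith
    qed (use d1 d2 in auto)
  qed
qed

definition inr_blinfun :: "'b::real_normed_vector \<Rightarrow>\<^sub>L ('a::real_normed_vector \<times> 'b)"
  where "inr_blinfun = Blinfun (\<lambda>h. (0, h))"

lemma inr_blinfun_apply [simp]: "blinfun_apply inr_blinfun h = (0, h)"
  unfolding inr_blinfun_def
  by (rule bounded_linear_Blinfun_apply[THEN fun_cong]) (intro bounded_linear_Pair bounded_linear_zero bounded_linear_ident)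

text \<open>Compact support in the state variable bounds the partial derivative on each bounded time
  window. This gives a Lipschitz constant per window, hence solutions for all times and a flow by
  bijections of the whole space.\<close>

locale compactly_supported_flow =
  fixes f :: "real \<times> 'a::euclidean_space \<Rightarrow> 'a" and f' :: "real \<times> 'a \<Rightarrow> (real \<times> 'a) \<Rightarrow>\<^sub>L 'a" and R :: real
  assumes f_deriv: "\<And>z. (f has_derivative blinfun_apply (f' z)) (at z)"
    and f'_cont: "continuous_on UNIV f'"
    and supp: "\<And>t x. R \<le> norm x \<Longrightarrow> f (t, x) = 0"
begin

text \<open>The partial derivative in the state variable: the coefficient of the variational
  equation.\<close>

definition A :: "real \<times> 'a \<Rightarrow> 'a \<Rightarrow>\<^sub>L 'a" where "A z = f' z o\<^sub>L inr_blinfun"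

lemma A_cont: "continuous_on UNIV A"
  unfolding A_def by (intro bounded_bilinear.continuous_on[OF bounded_bilinear_blinfun_compose] f'_cont continuous_intros)

lemma f_cont: "continuous_on UNIV f"
  using f_deriv has_derivative_continuous continuous_at_imp_continuous_on by blast

lemma A_comp_cont: "continuous_on UNIV u \<Longrightarrow> continuous_on UNIV (\<lambda>s. A (s, u s))"
  by (rule continuous_on_compose2[OF A_cont]) (auto intro!: continuous_intros)

lemma f_partial: "((\<lambda>x. f (t, x)) has_derivative blinfun_apply (A (t, x))) (at x within S)"
proof -
  have "((\<lambda>x. (t, x)) has_derivative (\<lambda>h. (0, h))) (at x within S)" by (auto intro!: derivative_eq_intros)
  then have "((f \<circ> (\<lambda>x. (t, x))) has_derivative blinfun_apply (f' (t, x)) \<circ> (\<lambda>h. (0, h))) (at x within S)"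
    by (rule diff_chain_within) (use f_deriv has_derivative_at_withinI in blast)
  moreover have "blinfun_apply (f' (t, x)) \<circ> (\<lambda>h. (0, h)) = blinfun_apply (A (t, x))"
    by (simp add: A_def fun_eq_iff)
  ultimately show ?thesis by (simp add: o_def)
qed

lemma A_supp:
  assumes "R < norm x" shows "A (t, x) = 0"
proof -
  have "((\<lambda>x. f (t, x)) has_derivative (\<lambda>h. 0)) (at x)"
  proof (rule has_derivative_transform_within_open[OF has_derivative_const])
    show "open {x. R < norm x}" by (intro open_Collect_less continuous_intros)
  qed (use assms supp in auto)
  then have "blinfun_apply (A (t, x)) = (\<lambda>h. 0)" using f_partial has_derivative_unique by blast
  then show ?thesis by (intro blinfun_eqI) (simp add: zero_blinfun.rep_eq)
qed

lemma A_bound: "\<exists>L\<ge>0. \<forall>t x. \<bar>t\<bar> \<le> K \<longrightarrow> norm (A (t, x)) \<le> L"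
proof -
  have "compact (A ` ({-K..K} \<times> cball 0 R))"
    by (intro compact_continuous_image continuous_on_subset[OF A_cont] compact_Times) auto
  then obtain L where L: "\<forall>y\<in>A ` ({-K..K} \<times> cball 0 R). norm y \<le> L"
    using compact_imp_bounded bounded_iff by blast
  have "norm (A (t, x)) \<le> max L 0" if "\<bar>t\<bar> \<le> K" for t x
  proof (cases "norm x \<le> R")
    case True
    then have "norm (A (t, x)) \<le> L" using L that by (auto simp: abs_le_iff)
    then show ?thesis by simp
  qed (simp add: A_supp)
  then show ?thesis by (intro exI[of _ "max L 0"]) auto
qed

definition lip :: "real \<Rightarrow> real" where "lip K = (SOME L. 0 \<le> L \<and> (\<forall>t x. \<bar>t\<bar> \<le> K \<longrightarrow> norm (A (t, x)) \<le> L))"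

lemma lip_nonneg: "0 \<le> lip K" and A_le: "\<bar>t\<bar> \<le> K \<Longrightarrow> norm (A (t, x)) \<le> lip K"
  using someI_ex[OF A_bound[of K]] unfolding lip_def[symmetric] by auto

lemma A_apply_le: "\<bar>t\<bar> \<le> K \<Longrightarrow> norm (blinfun_apply (A (t, x)) h) \<le> lip K * norm h"
  by (meson A_le mult_right_mono norm_blinfun norm_ge_zero order_trans)

lemma f_lip: "\<bar>t\<bar> \<le> K \<Longrightarrow> norm (f (t, x) - f (t, y)) \<le> lip K * norm (x - y)"
  by (rule differentiable_bound[of UNIV "\<lambda>x. f (t, x)" "\<lambda>x. blinfun_apply (A (t, x))"])
    (auto intro: f_partial A_le simp flip: norm_blinfun.rep_eq)

text \<open>The bound \<open>t\<close> inside the choice shadows the argument: one solution is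
  chosen for each \<open>x\<close> and then evaluated, so that \<open>flow\<close> is a solution in
  its first argument. \<open>dflow\<close> is built in the same way.\<close>

definition flow :: "real \<Rightarrow> 'a \<Rightarrow> 'a"
  where "flow t x = (SOME y. y 0 = x \<and> (\<forall>t. (y has_vector_derivative f (t, y t)) (at t))) t"

lemma flow_0 [simp]: "flow 0 x = x"
  and flow_deriv: "((\<lambda>t. flow t x) has_vector_derivative f (t, flow t x)) (at t)"
proof -
  have ex: "\<exists>y. y 0 = x \<and> (\<forall>t. (y has_vector_derivative f (t, y t)) (at t))"
  proof (rule picard_exists[OF f_cont])
    show "\<exists>L\<ge>0. \<forall>t x y. \<bar>t\<bar> \<le> K \<longrightarrow> norm (f (t, x) - f (t, y)) \<le> L * norm (x - y)" for K
      using f_lip[of _ K] lip_nonneg[of K] by blast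
  qed
  from someI_ex[OF ex] show "flow 0 x = x" "((\<lambda>t. flow t x) has_vector_derivative f (t, flow t x)) (at t)"
    unfolding flow_def[abs_def] by auto
qed

lemma solutions_close:
  assumes "\<And>t. (y has_vector_derivative f (t, y t)) (at t)" "\<And>t. (z has_vector_derivative f (t, z t)) (at t)"
    and "\<bar>s\<bar> \<le> K" "\<bar>t\<bar> \<le> K"
  shows "norm (y t - z t) \<le> norm (y s - z s) * exp ((lip K + 1) * \<bar>t - s\<bar>)"
proof -
  have "norm (y t - z t) \<le> (norm (y s - z s) + 0) * exp ((lip K + 1) * \<bar>t - s\<bar>)"
    by (rule gronwall[where e = "\<lambda>t. y t - z t" and e' = "\<lambda>t. f (t, y t) - f (t, z t)" and K = K])
      (use assms lip_nonneg f_lip in \<open>auto intro!: has_vector_derivative_diff\<close>)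
  then show ?thesis by simp
qed

lemma solution_unique:
  assumes "\<And>t. (y has_vector_derivative f (t, y t)) (at t)" "\<And>t. (z has_vector_derivative f (t, z t)) (at t)"
    and "y s = z s"
  shows "y t = z t"
  using solutions_close[OF assms(1,2), of s "max \<bar>s\<bar> \<bar>t\<bar>" t] assms(3) by simp

lemma flow_close: "\<bar>t\<bar> \<le> K \<Longrightarrow> norm (flow t x - flow t y) \<le> norm (x - y) * exp ((lip K + 1) * K)"
proof -
  assume t: "\<bar>t\<bar> \<le> K"
  have "norm (flow t x - flow t y) \<le> norm (flow 0 x - flow 0 y) * exp ((lip K + 1) * \<bar>t - 0\<bar>)"
    by (rule solutions_close[OF flow_deriv flow_deriv]) (use t in auto)
  also have "\<dots> \<le> norm (flow 0 x - flow 0 y) * exp ((lip K + 1) * K)"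
    using t lip_nonneg[of K] by (intro mult_left_mono) auto
  finally show ?thesis by simp
qed

text \<open>Injectivity is uniqueness backwards from time \<open>t\<close>. A preimage of
  \<open>z\<close> is found by solving the time-shifted field from \<open>z\<close> and following
  that solution back to time 0.\<close>

lemma flow_bij: "bij (flow t)"
proof (rule bijI)
  show "inj (flow t)"
  proof (rule injI)
    fix x y assume "flow t x = flow t y"
    then have "flow 0 x = flow 0 y" by (rule solution_unique[OF flow_deriv flow_deriv])
    then show "x = y" by simp
  qed
  show "surj (flow t)"
  proof
    show "UNIV \<subseteq> range (flow t)"
    proof
      fix z
      obtain v where v: "v 0 = z" "\<And>s. (v has_vector_derivative f (s + t, v s)) (at s)"
      proof -
        have "\<exists>y. y 0 = z \<and> (\<forall>s. (y has_vector_derivative (\<lambda>(s, x). f (s + t, x)) (s, y s)) (at s))"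
        proof (rule picard_exists)
          show "continuous_on UNIV (\<lambda>(s, x). f (s + t, x))"
            unfolding split_beta by (rule continuous_on_compose2[OF f_cont]) (auto intro!: continuous_intros)
          show "\<exists>L\<ge>0. \<forall>s x y. \<bar>s\<bar> \<le> K \<longrightarrow> norm ((case (s, x) of (s, x) \<Rightarrow> f (s + t, x)) - (case (s, y) of (s, x) \<Rightarrow> f (s + t, x))) \<le> L * norm (x - y)" for K
          proof (intro exI conjI allI impI)
            show "0 \<le> lip (K + \<bar>t\<bar>)" by (rule lip_nonneg)
            fix s x y assume "\<bar>s\<bar> \<le> K"
            then show "norm ((case (s, x) of (s, x) \<Rightarrow> f (s + t, x)) - (case (s, y) of (s, x) \<Rightarrow> f (s + t, x))) \<le> lip (K + \<bar>t\<bar>) * norm (x - y)"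
              using f_lip[of "s + t" "K + \<bar>t\<bar>" x y] by simp
          qed
        qed
        then show thesis using that by auto
      qed
      define y where "y s = v (s - t)" for s
      have y: "(y has_vector_derivative f (s, y s)) (at s)" for s
      proof -
        have "((\<lambda>s. s - t) has_vector_derivative 1) (at s)"
          by (auto intro!: derivative_eq_intros simp: has_vector_derivative_def)
        then have "((v \<circ> (\<lambda>s. s - t)) has_vector_derivative 1 *\<^sub>R f (s - t + t, v (s - t))) (at s)"
          by (rule vector_diff_chain_at) (rule v(2))
        then show ?thesis unfolding y_def by (simp add: o_def)
      qed
      have "y t = flow t (y 0)" by (rule solution_unique[OF y flow_deriv, of 0]) simp
      then show "z \<in> range (flow t)" using v(1) by (simp add: y_def)
    qed
  qed simp
qed

lemma flow_cont: "continuous_on UNIV (\<lambda>(t, x). flow t x)"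
proof (rule continuous_on_Times_of_locally_uniform)
  show "continuous_on UNIV (\<lambda>t. flow t x)" for x
    by (intro continuous_at_imp_continuous_on ballI has_vector_derivative_continuous[OF flow_deriv])
  fix K x and e :: real assume e: "0 < e"
  let ?E = "exp ((lip K + 1) * K)"
  show "\<exists>d>0. \<forall>t x'. \<bar>t\<bar> \<le> K \<longrightarrow> dist x' x < d \<longrightarrow> dist (flow t x') (flow t x) < e"
  proof (intro exI[of _ "e / ?E"] conjI allI impI)
    fix t x' assume t: "\<bar>t\<bar> \<le> K" "dist x' x < e / ?E"
    have "norm (flow t x' - flow t x) \<le> norm (x' - x) * ?E" by (rule flow_close[OF t(1)])
    also have "\<dots> < e" using t(2) by (simp add: dist_norm field_simps)
    finally show "dist (flow t x') (flow t x) < e" by (simp add: dist_norm)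
  qed (use e in simp)
qed

lemma flow_time_cont: "continuous_on UNIV (\<lambda>t. flow t x)"
  by (intro continuous_at_imp_continuous_on ballI has_vector_derivative_continuous[OF flow_deriv])

text \<open>The solution operator of the variational equation along the trajectory of
  \<open>x\<close>, the candidate for the derivative of \<open>flow t\<close> at
  \<open>x\<close>.\<close>

definition dflow :: "real \<Rightarrow> 'a \<Rightarrow> 'a \<Rightarrow> 'a"
  where "dflow t x h = (SOME y. y 0 = h \<and> (\<forall>t. (y has_vector_derivative blinfun_apply (A (t, flow t x)) (y t)) (at t))) t"

lemma dflow_0 [simp]: "dflow 0 x h = h"
  and dflow_deriv: "((\<lambda>t. dflow t x h) has_vector_derivative blinfun_apply (A (t, flow t x)) (dflow t x h)) (at t)"
proof -
  have ex: "\<exists>y. y 0 = h \<and> (\<forall>t. (y has_vector_derivative (\<lambda>(t, v). blinfun_apply (A (t, flow t x)) v) (t, y t)) (at t))"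
  proof (rule picard_exists)
    show "continuous_on UNIV (\<lambda>(t, v). blinfun_apply (A (t, flow t x)) v)"
      unfolding split_beta
      by (intro bounded_bilinear.continuous_on[OF bounded_bilinear_blinfun_apply] continuous_intros
          continuous_on_compose2[OF A_comp_cont[OF flow_time_cont]]) auto
    show "\<exists>L\<ge>0. \<forall>t v v'. \<bar>t\<bar> \<le> K \<longrightarrow> norm ((case (t, v) of (t, v) \<Rightarrow> blinfun_apply (A (t, flow t x)) v) - (case (t, v') of (t, v) \<Rightarrow> blinfun_apply (A (t, flow t x)) v)) \<le> L * norm (v - v')" for K
      using A_apply_le[of _ K] lip_nonneg[of K] by (auto simp flip: blinfun.diff_right)
  qed
  from someI_ex[OF ex] show "dflow 0 x h = h"
    "((\<lambda>t. dflow t x h) has_vector_derivative blinfun_apply (A (t, flow t x)) (dflow t x h)) (at t)"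
    unfolding dflow_def[abs_def] by auto
qed

lemma linear_solutions_close:
  assumes "\<And>t. (y has_vector_derivative blinfun_apply (A (t, flow t x)) (y t)) (at t)"
    and "\<bar>s\<bar> \<le> K" "\<bar>t\<bar> \<le> K"
  shows "norm (y t) \<le> norm (y s) * exp ((lip K + 1) * \<bar>t - s\<bar>)"
proof -
  have "norm (y t) \<le> (norm (y s) + 0) * exp ((lip K + 1) * \<bar>t - s\<bar>)"
    by (rule gronwall[where e = y and e' = "\<lambda>t. blinfun_apply (A (t, flow t x)) (y t)" and K = K])
      (use assms lip_nonneg A_apply_le in auto)
  then show ?thesis by simp
qed

lemma dflow_unique:
  assumes "\<And>t. (y has_vector_derivative blinfun_apply (A (t, flow t x)) (y t)) (at t)"
  shows "y t = dflow t x (y 0)"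
proof -
  have "norm (y t - dflow t x (y 0)) \<le> norm (y 0 - dflow 0 x (y 0)) * exp ((lip \<bar>t\<bar> + 1) * \<bar>t - 0\<bar>)"
    by (rule linear_solutions_close[where y = "\<lambda>t. y t - dflow t x (y 0)"])
      (use assms dflow_deriv in \<open>auto intro!: has_vector_derivative_diff simp: blinfun.diff_right\<close>)
  then show ?thesis by simp
qed

lemma dflow_le: "\<bar>t\<bar> \<le> K \<Longrightarrow> norm (dflow t x h) \<le> norm h * exp ((lip K + 1) * K)"
proof -
  assume t: "\<bar>t\<bar> \<le> K"
  have "norm (dflow t x h) \<le> norm (dflow 0 x h) * exp ((lip K + 1) * \<bar>t - 0\<bar>)"
    by (rule linear_solutions_close[OF dflow_deriv]) (use t in auto)
  also have "\<dots> \<le> norm (dflow 0 x h) * exp ((lip K + 1) * K)"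
    using t lip_nonneg[of K] by (intro mult_left_mono) auto
  finally show ?thesis by simp
qed

lemma dflow_bounded_linear: "bounded_linear (dflow t x)"
proof (rule bounded_linear_intro)
  show "dflow t x (a + b) = dflow t x a + dflow t x b" for a b
    using dflow_unique[of "\<lambda>t. dflow t x a + dflow t x b" x t] dflow_deriv
    by (simp add: blinfun.add_right has_vector_derivative_add)
  show "dflow t x (r *\<^sub>R a) = r *\<^sub>R dflow t x a" for r a
    using dflow_unique[of "\<lambda>t. r *\<^sub>R dflow t x a" x t] dflow_deriv[of x a]
      bounded_linear.has_vector_derivative[OF bounded_linear_scaleR_right, of "\<lambda>t. dflow t x a" _ _ r]
    by (simp add: blinfun.scaleR_right)
  show "norm (dflow t x h) \<le> norm h * exp ((lip \<bar>t\<bar> + 1) * \<bar>t\<bar>)" for h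
    by (rule dflow_le) simp
qed

text \<open>Gronwall run backwards, from time \<open>t\<close> to time 0.\<close>

lemma dflow_ker: "dflow t x h = 0 \<Longrightarrow> h = 0"
  using linear_solutions_close[OF dflow_deriv, of t "\<bar>t\<bar>" 0 x h] by simp

lemma A_near_orbit:
  assumes "0 < \<epsilon>"
  obtains d where "0 < d" "\<And>t z. \<bar>t\<bar> \<le> K \<Longrightarrow> dist z (flow t x) < d \<Longrightarrow> norm (A (t, z) - A (t, flow t x)) \<le> \<epsilon>"
proof -
  have "compact ((\<lambda>t. (t, flow t x)) ` {-K..K})"
    by (intro compact_continuous_image continuous_intros continuous_on_subset[OF flow_time_cont]) auto
  then obtain d where d: "0 < d"
    "\<And>c z. c \<in> (\<lambda>t. (t, flow t x)) ` {-K..K} \<Longrightarrow> dist z c < d \<Longrightarrow> dist (A z) (A c) < \<epsilon>"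
    using uniformly_continuous_near_compact[OF A_cont _ assms] by metis
  show thesis
  proof (rule that[OF d(1)])
    fix t z assume t: "\<bar>t\<bar> \<le> K" "dist z (flow t x) < d"
    have "dist (A (t, z)) (A (t, flow t x)) < \<epsilon>"
      by (rule d(2)) (use t in \<open>auto simp: dist_Pair_Pair abs_le_iff\<close>)
    then show "norm (A (t, z) - A (t, flow t x)) \<le> \<epsilon>" by (simp add: dist_norm)
  qed
qed

lemma flow_close_radius:
  assumes "0 < d"
  obtains \<eta> where "0 < \<eta>" "\<And>t y. \<bar>t\<bar> \<le> K \<Longrightarrow> dist y x < \<eta> \<Longrightarrow> dist (flow t y) (flow t x) < d"
proof (rule that[of "d / exp ((lip K + 1) * K)"])
  fix t y assume t: "\<bar>t\<bar> \<le> K" "dist y x < d / exp ((lip K + 1) * K)"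
  have "norm (flow t y - flow t x) \<le> norm (y - x) * exp ((lip K + 1) * K)" by (rule flow_close[OF t(1)])
  also have "\<dots> < d" using t(2) by (simp add: dist_norm field_simps)
  finally show "dist (flow t y) (flow t x) < d" by (simp add: dist_norm)
qed (use assms in simp)

text \<open>The linearization error satisfies the variational equation up to a forcing term of size
  \<open>\<epsilon> * norm (flow s y - flow s x)\<close>, because \<open>A\<close> varies by at most
  \<open>\<epsilon>\<close> near the trajectory of \<open>x\<close>. Gronwall turns this into a
  bound relative to \<open>norm (y - x)\<close>.\<close>

lemma flow_has_derivative: "(flow t has_derivative dflow t x) (at x)"
  unfolding has_derivative_at_alt
proof (intro conjI allI impI)
  show "bounded_linear (dflow t x)" by (rule dflow_bounded_linear)
  fix e :: real assume e: "0 < e"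
  let ?K = "\<bar>t\<bar>" let ?E = "exp ((lip ?K + 1) * ?K)"
  \<comment> \<open>One factor \<open>?E\<close> pays for the separation of the two trajectories,
    the other for Gronwall applied to the error.\<close>
  define \<epsilon> where "\<epsilon> = e / (?E * ?E)"
  have \<epsilon>: "0 < \<epsilon>" using e by (simp add: \<epsilon>_def)
  obtain d where d: "0 < d" "\<And>s z. \<bar>s\<bar> \<le> ?K \<Longrightarrow> dist z (flow s x) < d \<Longrightarrow> norm (A (s, z) - A (s, flow s x)) \<le> \<epsilon>"
    using A_near_orbit[OF \<epsilon>] by metis
  obtain \<eta> where \<eta>: "0 < \<eta>" "\<And>s y. \<bar>s\<bar> \<le> ?K \<Longrightarrow> dist y x < \<eta> \<Longrightarrow> dist (flow s y) (flow s x) < d"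
    using flow_close_radius[OF d(1)] by metis
  show "\<exists>d>0. \<forall>y. norm (y - x) < d \<longrightarrow> norm (flow t y - flow t x - dflow t x (y - x)) \<le> e * norm (y - x)"
  proof (intro exI[of _ \<eta>] conjI allI impI \<eta>(1))
    fix y assume y: "norm (y - x) < \<eta>"
    define c where "c = \<epsilon> * (norm (y - x) * ?E)"
    have "norm (flow t y - flow t x - dflow t x (y - x)) \<le>
        (norm (flow 0 y - flow 0 x - dflow 0 x (y - x)) + c) * exp ((lip ?K + 1) * \<bar>t - 0\<bar>)"
    proof (rule gronwall[where e = "\<lambda>t. flow t y - flow t x - dflow t x (y - x)" and K = ?K
          and e' = "\<lambda>t. f (t, flow t y) - f (t, flow t x) - blinfun_apply (A (t, flow t x)) (dflow t x (y - x))"])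
      show "0 \<le> c" using \<epsilon> by (simp add: c_def)
      show "((\<lambda>t. flow t y - flow t x - dflow t x (y - x)) has_vector_derivative
          f (s, flow s y) - f (s, flow s x) - blinfun_apply (A (s, flow s x)) (dflow s x (y - x))) (at s)" for s
        by (intro has_vector_derivative_diff flow_deriv dflow_deriv)
      fix s assume s: "\<bar>s\<bar> \<le> ?K"
      let ?a = "flow s x" let ?b = "flow s y"
      have ab: "dist ?b ?a < d" using \<eta>(2)[OF s] y by (simp add: dist_norm)
      have "norm (f (s, ?b) - f (s, ?a) - blinfun_apply (A (s, ?a)) (?b - ?a)) \<le> norm (?b - ?a) * \<epsilon>"
      proof (rule differentiable_bound_linearization[where S = "ball ?a d" and f = "\<lambda>x. f (s, x)" and f' = "\<lambda>x. blinfun_apply (A (s, x))"])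
        fix u :: real assume u: "u \<in> {0..1}"
        have "norm (u *\<^sub>R (?b - ?a)) \<le> norm (?b - ?a)" using u by (simp add: mult_left_le_one_le)
        then show "?a + u *\<^sub>R (?b - ?a) \<in> ball ?a d" using ab by (simp add: dist_norm)
      next
        fix z assume "z \<in> ball ?a d"
        then have "norm (A (s, z) - A (s, ?a)) \<le> \<epsilon>" using d(2)[OF s, of z] by (simp add: dist_commute)
        then show "onorm (blinfun_apply (A (s, z)) - blinfun_apply (A (s, ?a))) \<le> \<epsilon>"
          by (simp add: norm_blinfun.rep_eq minus_blinfun.rep_eq fun_diff_def)
      qed (use d(1) f_partial in auto)
      also have "\<dots> \<le> c" unfolding c_def mult.commute[of \<epsilon>]
        using flow_close[OF s, of y x] \<epsilon> by (intro mult_right_mono) auto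
      finally have 1: "norm (f (s, ?b) - f (s, ?a) - blinfun_apply (A (s, ?a)) (?b - ?a)) \<le> c" .
      have "f (s, ?b) - f (s, ?a) - blinfun_apply (A (s, ?a)) (dflow s x (y - x)) =
          blinfun_apply (A (s, ?a)) (?b - ?a - dflow s x (y - x)) + (f (s, ?b) - f (s, ?a) - blinfun_apply (A (s, ?a)) (?b - ?a))"
        by (simp add: blinfun.diff_right)
      also have "norm \<dots> \<le> lip ?K * norm (?b - ?a - dflow s x (y - x)) + c"
        by (rule order_trans[OF norm_triangle_ineq]) (intro add_mono 1 A_apply_le s)
      finally show "norm (f (s, ?b) - f (s, ?a) - blinfun_apply (A (s, ?a)) (dflow s x (y - x))) \<le>
          lip ?K * norm (?b - ?a - dflow s x (y - x)) + c" .
    qed (use lip_nonneg in auto)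
    also have "\<dots> = e * norm (y - x)" by (simp add: c_def \<epsilon>_def)
    finally show "norm (flow t y - flow t x - dflow t x (y - x)) \<le> e * norm (y - x)" .
  qed
qed

text \<open>The difference of the variational solutions along two trajectories solves one of the
  equations with a forcing term, namely the difference of the coefficients applied to the other
  solution. That term is small since neighbouring trajectories stay close on a bounded
  window.\<close>

lemma dflow_cont: "continuous_on UNIV (\<lambda>(t, x). dflow t x h)"
proof (rule continuous_on_Times_of_locally_uniform)
  show "continuous_on UNIV (\<lambda>t. dflow t x h)" for x
    by (intro continuous_at_imp_continuous_on ballI has_vector_derivative_continuous[OF dflow_deriv])
  fix K x and e :: real assume e: "0 < e"
  show "\<exists>d>0. \<forall>t x'. \<bar>t\<bar> \<le> K \<longrightarrow> dist x' x < d \<longrightarrow> dist (dflow t x' h) (dflow t x h) < e"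
  proof (cases "0 \<le> K")
    case K: True
    let ?E = "exp ((lip K + 1) * K)"
    \<comment> \<open>\<open>norm h + 1\<close> avoids a zero denominator for \<open>h = 0\<close>,
      and the factor 2 makes the final inequality strict.\<close>
    define \<epsilon> where "\<epsilon> = e / (2 * (?E * ?E * (norm h + 1)))"
    have pos: "0 < norm h + 1" by (simp add: add_nonneg_pos)
    have \<epsilon>: "0 < \<epsilon>" unfolding \<epsilon>_def using e pos by (intro divide_pos_pos mult_pos_pos) auto
    obtain d where d: "0 < d" "\<And>s z. \<bar>s\<bar> \<le> K \<Longrightarrow> dist z (flow s x) < d \<Longrightarrow> norm (A (s, z) - A (s, flow s x)) \<le> \<epsilon>"
      using A_near_orbit[OF \<epsilon>] by metis
    obtain \<eta> where \<eta>: "0 < \<eta>" "\<And>s y. \<bar>s\<bar> \<le> K \<Longrightarrow> dist y x < \<eta> \<Longrightarrow> dist (flow s y) (flow s x) < d"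
      using flow_close_radius[OF d(1)] by metis
    show ?thesis
    proof (intro exI[of _ \<eta>] conjI allI impI \<eta>(1))
      fix t y assume t: "\<bar>t\<bar> \<le> K" and y: "dist y x < \<eta>"
      define c where "c = \<epsilon> * (norm h * ?E)"
      have c0: "0 \<le> c" using \<epsilon> by (simp add: c_def)
      have "norm (dflow t y h - dflow t x h) \<le> (norm (dflow 0 y h - dflow 0 x h) + c) * exp ((lip K + 1) * \<bar>t - 0\<bar>)"
      proof (rule gronwall[where e = "\<lambda>t. dflow t y h - dflow t x h" and K = K
            and e' = "\<lambda>t. blinfun_apply (A (t, flow t y)) (dflow t y h) - blinfun_apply (A (t, flow t x)) (dflow t x h)"])
        show "((\<lambda>t. dflow t y h - dflow t x h) has_vector_derivative
            blinfun_apply (A (s, flow s y)) (dflow s y h) - blinfun_apply (A (s, flow s x)) (dflow s x h)) (at s)" for s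
          by (intro has_vector_derivative_diff dflow_deriv)
        fix s assume s: "\<bar>s\<bar> \<le> K"
        have 1: "norm (blinfun_apply (A (s, flow s y) - A (s, flow s x)) (dflow s x h)) \<le> c"
          unfolding c_def
          by (rule order_trans[OF norm_blinfun]) (intro mult_mono d(2)[OF s] \<eta>(2)[OF s] y dflow_le[OF s], use \<epsilon> in auto)
        have "blinfun_apply (A (s, flow s y)) (dflow s y h) - blinfun_apply (A (s, flow s x)) (dflow s x h) =
            blinfun_apply (A (s, flow s y)) (dflow s y h - dflow s x h) + blinfun_apply (A (s, flow s y) - A (s, flow s x)) (dflow s x h)"
          by (simp add: blinfun.diff_right blinfun.diff_left)
        also have "norm \<dots> \<le> lip K * norm (dflow s y h - dflow s x h) + c"
          by (rule order_trans[OF norm_triangle_ineq]) (intro add_mono 1 A_apply_le s)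
        finally show "norm (blinfun_apply (A (s, flow s y)) (dflow s y h) - blinfun_apply (A (s, flow s x)) (dflow s x h))
            \<le> lip K * norm (dflow s y h - dflow s x h) + c" .
      qed (use lip_nonneg c0 K t in auto)
      also have "\<dots> \<le> c * ?E" using c0 t lip_nonneg[of K] by (auto intro!: mult_left_mono)
      also have "\<dots> = \<epsilon> * (?E * ?E) * norm h" by (simp add: c_def)
      also have "\<dots> \<le> \<epsilon> * (?E * ?E) * (norm h + 1)" using \<epsilon> by (intro mult_left_mono) auto
      also have "\<dots> = e / 2"
      proof -
        have "a / (2 * X) * X = a / 2" if "X \<noteq> 0" for a X :: real using that by simp
        from this[of "?E * ?E * (norm h + 1)" e] show ?thesis
          unfolding \<epsilon>_def using pos by (simp only: mult.assoc) simp
      qed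
      also have "\<dots> < e" using e by simp
      finally show "dist (dflow t y h) (dflow t x h) < e" by (simp add: dist_norm)
    qed
  qed (auto intro: exI[of _ 1])
qed

end

section \<open>The straightening map of the extended phase space and its inverse\<close>

context compactly_supported_flow
begin

definition Q :: "real \<times> 'a \<Rightarrow> real \<times> 'a" where "Q = (\<lambda>(t, x). (t, flow t x))"

definition dQ :: "real \<times> 'a \<Rightarrow> (real \<times> 'a) \<Rightarrow>\<^sub>L (real \<times> 'a)"
  where "dQ z = Blinfun (\<lambda>v. (fst v, fst v *\<^sub>R f (Q z) + dflow (fst z) (snd z) (snd v)))"

lemma dQ_apply: "blinfun_apply (dQ z) v = (fst v, fst v *\<^sub>R f (Q z) + dflow (fst z) (snd z) (snd v))"
  unfolding dQ_def
  by (rule bounded_linear_Blinfun_apply[THEN fun_cong])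
    (intro bounded_linear_Pair bounded_linear_add bounded_linear_fst
      bounded_linear_compose[OF bounded_linear_scaleR_left bounded_linear_fst]
      bounded_linear_compose[OF dflow_bounded_linear bounded_linear_snd])

lemma Q_cont: "continuous_on UNIV Q"
  using flow_cont unfolding Q_def split_beta by (auto intro!: continuous_intros)

lemma dQ_cont: "continuous_on UNIV dQ"
proof (rule continuous_on_blinfun_componentwise)
  fix v :: "real \<times> 'a"
  have "continuous_on UNIV (\<lambda>z. f (Q z))" using continuous_on_compose2[OF f_cont Q_cont] by auto
  then show "continuous_on UNIV (\<lambda>z. blinfun_apply (dQ z) v)"
    unfolding dQ_apply using dflow_cont[of "snd v"] unfolding split_beta by (auto intro!: continuous_intros)
qed

text \<open>The derivative is assembled from the two partial derivatives; the continuity required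
  for this is that of the spatial one, that is, of \<open>dflow\<close>.\<close>

lemma Q_has_derivative: "(Q has_derivative blinfun_apply (dQ z)) (at z)"
proof -
  define D where "D t x = Blinfun (dflow t x)" for t x
  have D: "blinfun_apply (D t x) = dflow t x" for t x
    unfolding D_def by (rule bounded_linear_Blinfun_apply[OF dflow_bounded_linear])
  obtain t x where z: "z = (t, x)" by (cases z)
  have cD: "continuous_on UNIV (\<lambda>(t, x). D t x)"
  proof (rule continuous_on_blinfun_componentwise)
    show "continuous_on UNIV (\<lambda>z. blinfun_apply (case z of (t, x) \<Rightarrow> D t x) h)" for h
      using dflow_cont[of h] by (simp add: split_beta D)
  qed
  have "((\<lambda>(t, x). flow t x) has_derivative (\<lambda>(a, h). a *\<^sub>R f (t, flow t x) + blinfun_apply (D t x) h)) (at (t, x) within UNIV \<times> UNIV)"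
  proof (rule has_derivative_partialsI)
    show "((\<lambda>t. flow t x) has_derivative (\<lambda>a. a *\<^sub>R f (t, flow t x))) (at t within UNIV)"
      using flow_deriv[of x t] by (simp add: has_vector_derivative_def)
    show "(flow t has_derivative blinfun_apply (D t x)) (at x within UNIV)" for t x
      using flow_has_derivative[of t x] by (simp add: D)
    show "continuous (at (t, x) within UNIV \<times> UNIV) (\<lambda>(t, x). D t x)"
      using cD by (simp add: continuous_on_eq_continuous_at)
  qed auto
  then have "((\<lambda>z. (fst z, flow (fst z) (snd z))) has_derivative
      (\<lambda>v. (fst v, fst v *\<^sub>R f (t, flow t x) + dflow t x (snd v)))) (at (t, x))"
    unfolding split_beta D by (auto intro!: derivative_eq_intros)
  then show ?thesis
    by (simp add: z Q_def case_prod_unfold dQ_apply[abs_def])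
qed

lemma Q_bij: "bij Q"
proof (rule bijI)
  show "inj Q" unfolding Q_def using bij_is_inj[OF flow_bij] by (auto simp: inj_def)
  show "surj Q"
  proof (rule surjI)
    show "Q ((\<lambda>(t, y). (t, inv (flow t) y)) z) = z" for z
      by (cases z) (simp add: Q_def surj_f_inv_f[OF bij_is_surj[OF flow_bij]])
  qed
qed

lemma dQ_ker: "blinfun_apply (dQ z) v = 0 \<Longrightarrow> v = 0"
  using dflow_ker by (cases v) (auto simp: dQ_apply zero_prod_def)

lemma Q_C1: "C1_on UNIV Q"
  by (rule C1_onI[OF Q_has_derivative dQ_cont])

lemma Q_inverse_C1: "C1_on UNIV (inv Q)"
proof -
  have "the_inv Q = inv Q"
  proof
    fix y
    obtain x where "y = Q x" using bij_is_surj[OF Q_bij] by (metis surjD)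
    then show "the_inv Q y = inv Q y" using bij_is_inj[OF Q_bij] by (simp add: the_inv_f_f)
  qed
  moreover have "C1_on (range Q) (the_inv Q)"
    by (rule C1_inverse_function(3)[OF open_UNIV bij_is_inj[OF Q_bij] Q_has_derivative dQ_cont]) (rule dQ_ker)
  ultimately show ?thesis using bij_is_surj[OF Q_bij] by simp
qed

end

section \<open>The Hastings--McLeod solution\<close>

lemma continuous_on_of_DERIV:
  fixes g :: "real \<Rightarrow> real"
  assumes "\<And>x. (g has_real_derivative g' x) (at x)"
  shows "continuous_on S g"
  by (intro continuous_at_imp_continuous_on ballI DERIV_isCont[OF assms])

lemma DERIV_nonneg_le:
  fixes g :: "real \<Rightarrow> real"
  assumes "a \<le> b" "\<And>x. (g has_real_derivative g' x) (at x)" "\<And>x. a < x \<Longrightarrow> x < b \<Longrightarrow> 0 \<le> g' x"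
  shows "g a \<le> g b"
  by (rule DERIV_nonneg_imp_increasing_open[OF assms(1)])
    (use assms(2,3) in \<open>blast intro: continuous_on_of_DERIV\<close>)+

locale hastings_mcleod_solution =
  fixes w :: "real \<Rightarrow> real"
  assumes hm: "hastings_mcleod w"
begin

lemma w_deriv: "(w has_real_derivative deriv w x) (at x)"
  and w_deriv2: "(deriv w has_real_derivative x * w x + 2 * w x ^ 3) (at x)"
  and w_pos: "0 < w x"
  and w_monotone: "mono w \<or> antimono w"
  and w_asymp: "w \<sim>[at_bot] (\<lambda>x. sqrt (- x / 2))"
  using hm unfolding hastings_mcleod_def by auto

lemma w_ratio: "((\<lambda>x. w x / sqrt (- x / 2)) \<longlongrightarrow> 1) at_bot"
  by (rule asymp_equivD_strong[OF w_asymp]) (use w_pos in \<open>auto intro!: always_eventually simp: less_imp_neq[THEN not_sym]\<close>)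

lemma w_filterlim: "filterlim w at_top at_bot"
proof (rule asymp_equiv_at_top_transfer[OF asymp_equiv_sym[THEN iffD1, OF w_asymp]])
  have "filterlim (\<lambda>x::real. 1/2 * - x) at_top at_bot"
    by (rule filterlim_tendsto_pos_mult_at_top[OF tendsto_const]) (auto intro: filterlim_uminus_at_top_at_bot)
  then have "filterlim (\<lambda>x::real. - x / 2) at_top at_bot" by simp
  from filterlim_compose[OF sqrt_at_top this] show "filterlim (\<lambda>x. sqrt (- x / 2)) at_top at_bot" .
qed

lemma w_unbounded: "\<exists>x\<le>X. C < w x"
proof -
  have "\<forall>\<^sub>F x in at_bot. C < w x" using w_filterlim by (simp add: filterlim_at_top_dense)
  moreover have "\<forall>\<^sub>F x in at_bot. x \<le> X" by (rule eventually_le_at_bot)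
  ultimately have "\<forall>\<^sub>F x in at_bot. x \<le> X \<and> C < w x" by eventually_elim auto
  then obtain N where "\<forall>n\<le>N. n \<le> X \<and> C < w n" by (auto simp: eventually_at_bot_linorder)
  then show ?thesis by blast
qed

text \<open>The growth of \<open>w\<close> towards minus infinity excludes the increasing
  alternative.\<close>

lemma w_antimono: "x \<le> y \<Longrightarrow> w y \<le> w x"
proof -
  obtain z where "z \<le> 0" "w 0 < w z" using w_unbounded by blast
  then have "\<not> mono w" using monoD[of w z 0] by linarith
  then have "antimono w" using w_monotone by blast
  then show "x \<le> y \<Longrightarrow> w y \<le> w x" by (rule antimonoD)
qed

lemma w'_nonpos: "deriv w x \<le> 0"
proof (rule ccontr)
  assume "\<not> deriv w x \<le> 0"
  then obtain d where "d > 0" "\<forall>h>0. h < d \<longrightarrow> w x < w (x + h)"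
    using DERIV_pos_inc_right[OF w_deriv] by (meson not_le)
  then have "w x < w (x + d / 2)" by simp
  then show False using w_antimono[of x "x + d / 2"] \<open>d > 0\<close> by simp
qed

lemma w_deriv3: "((\<lambda>x. x * w x + 2 * w x ^ 3) has_real_derivative w x + (x + 6 * (w x)\<^sup>2) * deriv w x) (at x)"
  by (auto intro!: derivative_eq_intros w_deriv simp: algebra_simps power2_eq_square)

text \<open>At a zero of \<open>w'\<close>, a maximum of \<open>w'\<close>, the second derivative of \<open>w'\<close> would be \<open>w > 0\<close>.\<close>

lemma w'_neg: "deriv w x < 0"
proof (rule ccontr)
  assume "\<not> deriv w x < 0"
  then have z: "deriv w x = 0" using w'_nonpos[of x] by simp
  let ?q = "\<lambda>x. x * w x + 2 * w x ^ 3"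
  have q0: "?q x = 0" by (rule DERIV_local_max[OF w_deriv2, of 1]) (use w'_nonpos z in auto)
  have "(?q has_real_derivative w x) (at x)" using w_deriv3[of x] z by simp
  from DERIV_pos_inc_right[OF this w_pos] obtain d where d: "d > 0" "\<forall>h>0. h < d \<longrightarrow> ?q x < ?q (x + h)" by blast
  have "deriv w x < deriv w (x + d / 2)"
  proof (rule DERIV_pos_imp_increasing_open[where f = "deriv w"])
    fix y assume y: "x < y" "y < x + d / 2"
    then have "0 < ?q y" using d(2)[rule_format, of "y - x"] d(1) q0 by simp
    then show "\<exists>q. (deriv w has_real_derivative q) (at y) \<and> 0 < q" using w_deriv2 by blast
  qed (use d(1) continuous_on_of_DERIV[OF w_deriv2] in auto)
  then show False using z w'_nonpos[of "x + d / 2"] by simp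
qed

text \<open>The equation makes w'' nonnegative on the positive half-line.\<close>

lemma w'_bounded: "0 \<le> x \<Longrightarrow> deriv w 0 \<le> deriv w x"
  by (rule DERIV_nonneg_le[OF _ w_deriv2]) (use w_pos in \<open>auto intro!: add_pos_pos mult_pos_pos less_imp_le\<close>)

text \<open>Otherwise w'' \<le> w' on a half-line, so that w - w' is nondecreasing there; as w'
  \<le> 0, this would bound w towards minus infinity. At the points found, z = - w' has a
  logarithmic derivative below 1, which is the starting condition for the Wronskian.\<close>

lemma slope_points: "\<exists>s\<le>X. deriv w s < s * w s + 2 * w s ^ 3"
proof (rule ccontr)
  assume "\<not> ?thesis"
  then have *: "s * w s + 2 * w s ^ 3 \<le> deriv w s" if "s \<le> X" for s using that by (auto simp: not_less)
  have "w s \<le> w X - deriv w X" if "s \<le> X" for s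
  proof -
    have "w s - deriv w s \<le> w X - deriv w X"
      by (rule DERIV_nonneg_le[OF that, of _ "\<lambda>s. deriv w s - (s * w s + 2 * w s ^ 3)"])
        (use * in \<open>auto intro!: DERIV_diff w_deriv w_deriv2\<close>)
    then show ?thesis using w'_nonpos[of s] by simp
  qed
  then show False using w_unbounded[of X "w X - deriv w X"] by (meson not_le)
qed

text \<open>With \<open>S = sqrt (- y / 2)\<close> the equation reads w'' = 2 w (w - S) (w + S), and
  the asymptotics make this at most a small multiple of \<open>b * sqrt b\<close>, where
  \<open>b = - x\<close>. On a step of length \<open>h = 1 / sqrt b\<close> the mean value theorem
  finds a point with \<bar>w'\<bar> \<le> 1 + 2 \<epsilon> b, and over that step w' changes by at
  most 9 \<epsilon> b.\<close>

lemma w'_sublinear: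
  assumes e: "0 < e"
  shows "\<forall>\<^sub>F x in at_bot. \<bar>deriv w x\<bar> \<le> e * \<bar>x\<bar>"
proof -
  \<comment> \<open>The final bound is \<open>1 + 11 * \<epsilon> * b\<close>: this choice makes the
    second summand at most \<open>e / 2 * b\<close>, and \<open>b \<ge> 2 / e\<close> does the same
    for the first. The cap 1/2 gives \<open>w y \<le> 3/2 * S\<close>.\<close>
  define \<epsilon> where "\<epsilon> = min (e / 22) (1 / 2)"
  have \<epsilon>: "0 < \<epsilon>" "\<epsilon> \<le> 1 / 2" "22 * \<epsilon> \<le> e" using e by (auto simp: \<epsilon>_def)
  have "\<forall>\<^sub>F x in at_bot. \<bar>w x / sqrt (- x / 2) - 1\<bar> < \<epsilon>"
    using tendstoD[OF w_ratio \<epsilon>(1)] by (simp add: dist_real_def)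
  then obtain X0 where X0: "\<And>x. x \<le> X0 \<Longrightarrow> \<bar>w x / sqrt (- x / 2) - 1\<bar> < \<epsilon>"
    by (auto simp: eventually_at_bot_linorder)
  define X where "X = min X0 (min (- 1) (- (2 / e)))"
  have "\<bar>deriv w x\<bar> \<le> e * \<bar>x\<bar>" if x: "x \<le> X" for x
  proof -
    define b where "b = - x"
    define h where "h = 1 / sqrt b"
    have b: "1 \<le> b" "2 / e \<le> b" and xX: "x \<le> X0" using x by (auto simp: b_def X_def)
    have sb: "0 < sqrt b" "sqrt b * sqrt b = b" "1 \<le> sqrt b" using b by auto
    have h: "0 < h" "h \<le> 1" "h * sqrt b = 1" using sb by (auto simp: h_def)
    have r: "(1 - \<epsilon>) * sqrt (- y / 2) \<le> w y" "w y \<le> (1 + \<epsilon>) * sqrt (- y / 2)" if "y \<le> x" for y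
    proof -
      have p: "0 < sqrt (- y / 2)" using that b by (simp add: b_def)
      have "\<bar>w y / sqrt (- y / 2) - 1\<bar> < \<epsilon>" using X0 that xX by auto
      then have "1 - \<epsilon> < w y / sqrt (- y / 2)" "w y / sqrt (- y / 2) < 1 + \<epsilon>" by (auto simp: abs_less_iff)
      then show "(1 - \<epsilon>) * sqrt (- y / 2) \<le> w y" "w y \<le> (1 + \<epsilon>) * sqrt (- y / 2)"
        using p by (auto simp: pos_less_divide_eq pos_divide_less_eq)
    qed
    have sy: "sqrt (- y / 2) \<le> sqrt b" if "x - h \<le> y" for y
      using that h b by (auto simp: b_def)
    have q: "\<bar>y * w y + 2 * w y ^ 3\<bar> \<le> 9 * \<epsilon> * b * sqrt b" if y: "x - h \<le> y" "y \<le> x" for y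
    proof -
      define S where "S = sqrt (- y / 2)"
      have S: "0 \<le> S" "S * S = - y / 2" "S \<le> sqrt b" using y b sy[OF y(1)] by (auto simp: S_def b_def)
      have y': "y = - (2 * S * S)" using S(2) by simp
      have rS: "(1 - \<epsilon>) * S \<le> w y" "w y \<le> (1 + \<epsilon>) * S" using r[OF y(2)] by (auto simp: S_def)
      have a1: "\<bar>w y - S\<bar> \<le> \<epsilon> * S" using rS by (auto simp: abs_le_iff algebra_simps)
      have w1: "w y \<le> 3/2 * S" using rS(2) \<epsilon>(2) S(1) mult_right_mono[of "1 + \<epsilon>" "3/2" S] by simp
      have m1: "\<bar>w y - S\<bar> * (w y + S) \<le> (\<epsilon> * S) * (5/2 * S)"
        by (rule mult_mono[OF a1]) (use w1 S(1) \<epsilon>(1) w_pos[of y] in auto)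
      have "2 * w y * (\<bar>w y - S\<bar> * (w y + S)) \<le> 2 * (3/2 * S) * ((\<epsilon> * S) * (5/2 * S))"
        by (rule mult_mono[OF _ m1]) (use w1 S(1) w_pos[of y] in auto)
      moreover have "y * w y + 2 * w y ^ 3 = 2 * w y * ((w y - S) * (w y + S))"
        unfolding y' by (subst (1) y'[symmetric]) (simp add: y' power3_eq_cube algebra_simps)
      then have "\<bar>y * w y + 2 * w y ^ 3\<bar> = 2 * w y * (\<bar>w y - S\<bar> * (w y + S))"
        using w_pos[of y] S(1) by (simp add: abs_mult)
      ultimately have "\<bar>y * w y + 2 * w y ^ 3\<bar> \<le> 15/2 * \<epsilon> * (S * S * S)" by (simp add: algebra_simps)
      also have "\<dots> \<le> 9 * \<epsilon> * (b * sqrt b)"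
      proof -
      have "S * S * S \<le> sqrt b * sqrt b * sqrt b" using S b by (intro mult_mono) auto
      then have SSS: "S * S * S \<le> b * sqrt b" using sb by simp
      have "15/2 * \<epsilon> * (S * S * S) \<le> 9 * \<epsilon> * (b * sqrt b)"
        by (rule mult_mono[OF _ SSS]) (use \<epsilon>(1) S(1) b in auto)
      then show ?thesis .
      qed
      finally show ?thesis by (simp add: mult_ac)
    qed
    have lt: "x - h < x" using h by simp
    obtain \<xi> where \<xi>: "x - h < \<xi>" "\<xi> < x" "w x - w (x - h) = (x - (x - h)) * deriv w \<xi>"
      using MVT2[OF lt, of w "deriv w"] w_deriv by blast
    obtain \<eta> where \<eta>: "\<xi> < \<eta>" "\<eta> < x" "deriv w x - deriv w \<xi> = (x - \<xi>) * (\<eta> * w \<eta> + 2 * w \<eta> ^ 3)"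
      using MVT2[OF \<xi>(2), of "deriv w" "\<lambda>y. y * w y + 2 * w y ^ 3"] w_deriv2 by blast
    have "\<bar>deriv w x - deriv w \<xi>\<bar> \<le> h * (9 * \<epsilon> * b * sqrt b)"
      unfolding \<eta>(3) abs_mult by (rule mult_mono) (use \<xi> \<eta> h q[of \<eta>] in auto)
    also have "\<dots> = 9 * \<epsilon> * b * (h * sqrt b)" by simp
    finally have 1: "\<bar>deriv w x - deriv w \<xi>\<bar> \<le> 9 * \<epsilon> * b" by (simp add: h(3))
    \<comment> \<open>Below, \<open>T \<ge> 1/4\<close> makes the cross term
      \<open>2 * h * T\<close> of the square at least \<open>h / 2\<close>, which is the increment
      under the root.\<close>
    have s1: "sqrt (- (x - h) / 2) \<le> sqrt (- x / 2) + h"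
    proof (rule real_le_lsqrt)
      define T where "T = sqrt (- x / 2)"
      have T: "1 / 4 \<le> T" "T * T = - x / 2"
      proof -
        have "(1 / 4)\<^sup>2 \<le> - x / 2" using b by (simp add: b_def power2_eq_square)
        then show "1 / 4 \<le> T" unfolding T_def by (rule real_le_rsqrt)
        show "T * T = - x / 2" using b by (simp add: T_def b_def)
      qed
      have 1: "h * (1 / 4) \<le> h * T" using h T(1) by (intro mult_left_mono) auto
      have 2: "- (x - h) / 2 = T * T + h / 2" using T(2) by (simp add: diff_divide_distrib)
      have "a \<le> c + 2 * q + p" if "h * (1 / 4) \<le> q" "a = c + h / 2" "0 \<le> p" for a c p q
        using that by linarith
      from this[OF 1 2 zero_le_square[of h]] have "- (x - h) / 2 \<le> T * T + 2 * (h * T) + h * h" .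
      then show "- (x - h) / 2 \<le> (sqrt (- x / 2) + h)\<^sup>2"
        unfolding T_def[symmetric] by (simp add: power2_eq_square algebra_simps)
    qed (use h b in \<open>auto simp: b_def\<close>)
    have "w (x - h) - w x \<le> (1 + \<epsilon>) * sqrt (- (x - h) / 2) - (1 - \<epsilon>) * sqrt (- x / 2)"
      using r[of x] r[of "x - h"] h by simp
    also have "\<dots> \<le> h + 2 * \<epsilon> * sqrt b"
    proof -
      have "\<epsilon> * sqrt (- (x - h) / 2) \<le> \<epsilon> * sqrt b" "\<epsilon> * sqrt (- x / 2) \<le> \<epsilon> * sqrt b"
        using sy[of "x - h"] sy[of x] \<epsilon>(1) h by (auto intro: mult_left_mono)
      then show ?thesis using s1 by (simp add: algebra_simps)
    qed
    finally have "h * - deriv w \<xi> \<le> h + 2 * \<epsilon> * sqrt b" using \<xi>(3) by simp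
    then have "sqrt b * (h * - deriv w \<xi>) \<le> sqrt b * (h + 2 * \<epsilon> * sqrt b)"
      using sb(1) by (intro mult_left_mono) auto
    moreover have "sqrt b * (h * - deriv w \<xi>) = (h * sqrt b) * - deriv w \<xi>" by simp
    moreover have "sqrt b * (h + 2 * \<epsilon> * sqrt b) = h * sqrt b + 2 * \<epsilon> * (sqrt b * sqrt b)" by (simp add: algebra_simps)
    ultimately have "- deriv w \<xi> \<le> 1 + 2 * \<epsilon> * b" by (simp only: h(3) sb(2))
    then have "\<bar>deriv w x\<bar> \<le> 1 + 11 * \<epsilon> * b" using 1 w'_nonpos[of x] w'_nonpos[of \<xi>] by (simp add: abs_le_iff)
    also have "\<dots> \<le> e / 2 * b + e / 2 * b"
    proof (rule add_mono)
      show "1 \<le> e / 2 * b" using b(2) e by (simp add: field_simps)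
      show "11 * \<epsilon> * b \<le> e / 2 * b" using \<epsilon>(3) b(1) by (intro mult_right_mono) auto
    qed
    finally show ?thesis using b(1) by (simp add: b_def)
  qed
  then show ?thesis by (auto simp: eventually_at_bot_linorder)
qed

text \<open>\<open>- w'\<close> is a positive supersolution of the linearized equation, so its Wronskian with a
  solution \<open>y > 0\<close> is increasing.\<close>

lemma linearization_positive_False:
  assumes y: "\<And>s. (y has_real_derivative y' s) (at s)" "\<And>s. (y' has_real_derivative (s + 6 * (w s)\<^sup>2) * y s) (at s)"
    and s1: "deriv w s1 < s1 * w s1 + 2 * w s1 ^ 3" "y' s1 = \<sigma>1 * y s1" "1 \<le> \<sigma>1"
    and s3: "\<And>s. s3 \<le> s \<Longrightarrow> \<exists>\<sigma>\<ge>1/2. y' s = - \<sigma> * sqrt s * y s"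
    and pos: "0 < y s1"
  shows False
proof -
  let ?q = "\<lambda>s. s * w s + 2 * w s ^ 3"
  \<comment> \<open>The Wronskian of \<open>y\<close> and z = - w'. Its derivative is
    \<open>y * w\<close>, coming from the source term in the equation for z.\<close>
  define W where "W s = y s * ?q s - y' s * deriv w s" for s
  \<comment> \<open>The quotient y / z has derivative W / z^2, so it cannot fall to zero while
    \<open>W\<close> is positive.\<close>
  define \<phi> where "\<phi> s = y s / - deriv w s" for s
  have W': "(W has_real_derivative y s * w s) (at s)" for s
    unfolding W_def
    by (rule DERIV_cong, rule DERIV_diff[OF DERIV_mult[OF y(1) w_deriv3] DERIV_mult[OF y(2) w_deriv2]])
      (simp add: algebra_simps power2_eq_square power3_eq_cube)
  have \<phi>': "(\<phi> has_real_derivative W s / (deriv w s)\<^sup>2) (at s)" for s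
    unfolding \<phi>_def
    by (rule DERIV_cong, rule DERIV_divide[OF y(1) DERIV_minus[OF w_deriv2]])
      (use w'_neg[of s] in \<open>auto simp: W_def power2_eq_square field_simps\<close>)
  have W1: "0 < W s1"
  proof -
    have "W s1 = y s1 * (?q s1 - \<sigma>1 * deriv w s1)" by (simp add: W_def s1 algebra_simps)
    moreover have "\<sigma>1 * deriv w s1 \<le> deriv w s1"
      using mult_right_mono_neg[OF s1(3), of "deriv w s1"] w'_nonpos by simp
    ultimately show ?thesis using s1(1) pos by simp
  qed
  have inc: "W s1 \<le> W s \<and> \<phi> s1 \<le> \<phi> s" if s: "s1 \<le> s" and yp: "\<And>u. s1 < u \<Longrightarrow> u < s \<Longrightarrow> 0 < y u" for s
  proof
    have W: "W s1 \<le> W u" if "s1 \<le> u" "u \<le> s" for u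
      by (rule DERIV_nonneg_le[OF that(1) W']) (use yp that w_pos in \<open>auto intro!: mult_nonneg_nonneg less_imp_le\<close>)
    show "W s1 \<le> W s" by (rule W) (use s in auto)
    show "\<phi> s1 \<le> \<phi> s"
    proof (rule DERIV_nonneg_le[OF s \<phi>'])
      fix u assume "s1 < u" "u < s"
      then have "W s1 \<le> W u" using W by simp
      then show "0 \<le> W u / (deriv w u)\<^sup>2" using W1 by simp
    qed
  qed
  have \<phi>y: "0 < \<phi> s \<longleftrightarrow> 0 < y s" for s using w'_neg[of s] by (auto simp: \<phi>_def divide_less_0_iff)
  have cont: "continuous_on S y" for S by (rule continuous_on_of_DERIV[OF y(1)])
  have ypos: "0 < y s" if s: "s1 \<le> s" for s
  proof (rule ccontr)
    assume n: "\<not> 0 < y s"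
    \<comment> \<open>At the first point of \<open>?Z\<close> the quotient \<open>\<phi>\<close> has
      not decreased since \<open>s1\<close>, because \<open>y\<close> is positive before; so
      \<open>y\<close> is positive there too.\<close>
    let ?Z = "{s1..s} \<inter> y -` {..0}"
    have "closed ?Z" by (intro continuous_closed_vimage closed_Int cont continuous_closed_preimage) (auto intro: cont)
    then have "compact ?Z" using compact_Int_closed[of "{s1..s}" ?Z] by (simp add: Int_absorb1)
    moreover have "?Z \<noteq> {}" using n s by auto
    ultimately obtain z where z: "z \<in> ?Z" "\<And>u. u \<in> ?Z \<Longrightarrow> z \<le> u" using compact_attains_inf[of ?Z] by blast
    have "0 < y u" if "s1 < u" "u < z" for u using z(2)[of u] that z(1) by (auto simp: not_le[symmetric])
    then have "\<phi> s1 \<le> \<phi> z" using inc[of z] z(1) by auto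
    then have "0 < y z" using \<phi>y[of z] \<phi>y[of s1] pos by simp
    then show False using z(1) by simp
  qed
  have Wge: "W s1 \<le> W s" if "s1 \<le> s" for s using inc[OF that] ypos by auto
  \<comment> \<open>Beyond 4 one has \<open>sqrt s \<ge> 2\<close>, so the slope condition yields
    \<open>y' \<le> - y\<close> and \<open>y\<close> decays at least like exp (- s).\<close>
  define S where "S = max 4 (max s3 s1)"
  define C where "C = y S * exp S"
  have slope: "y' s \<le> - y s \<and> y' s \<le> 0" if "S \<le> s" for s
  proof -
    have "s3 \<le> s" using that by (simp add: S_def)
    then obtain \<sigma> where \<sigma>: "1/2 \<le> \<sigma>" "y' s = - \<sigma> * sqrt s * y s" using s3 by blast
    have "2 \<le> sqrt s" using that by (intro real_le_rsqrt) (auto simp: S_def)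
    then have "1/2 * 2 \<le> \<sigma> * sqrt s" using \<sigma>(1) by (intro mult_mono) auto
    moreover have "0 < y s" using ypos that by (auto simp: S_def)
    ultimately have "1 * y s \<le> \<sigma> * sqrt s * y s" by (intro mult_right_mono) auto
    then show ?thesis using \<sigma>(2) \<open>0 < y s\<close> by simp
  qed
  have decay: "y s * exp s \<le> C" if "S \<le> s" for s
  proof -
    have "- (y S * exp S) \<le> - (y s * exp s)"
    proof (rule DERIV_nonneg_le[OF that])
      show "((\<lambda>s. - (y s * exp s)) has_real_derivative - ((y' u + y u) * exp u)) (at u)" for u
        by (auto intro!: derivative_eq_intros y(1) simp: algebra_simps)
      show "0 \<le> - ((y' u + y u) * exp u)" if "S < u" "u < s" for u
        using slope[of u] that by (simp add: mult_nonpos_nonneg)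
    qed
    then show ?thesis by (simp add: C_def)
  qed
  define K where "K = C * (w 0 + 2 * w 0 ^ 3)"
  have bound: "W s1 \<le> K * (s ^ 1 / exp s)" if s: "S \<le> s" for s
  proof -
    have s0: "4 \<le> s" "s1 \<le> s" using s by (auto simp: S_def)
    have yp: "0 < y s" using ypos s0 by simp
    have "?q s \<le> s * w 0 + s * (2 * w 0 ^ 3)"
    proof (rule add_mono)
      show "s * w s \<le> s * w 0" using w_antimono[of 0 s] s0 by (intro mult_left_mono) auto
      have "w s ^ 3 \<le> w 0 ^ 3" using w_antimono[of 0 s] s0 w_pos[of s] by (intro power_mono) auto
      also have "\<dots> \<le> s * w 0 ^ 3" using s0 w_pos[of 0] by simp
      finally show "2 * w s ^ 3 \<le> s * (2 * w 0 ^ 3)" by simp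
    qed
    then have q: "?q s \<le> s * (w 0 + 2 * w 0 ^ 3)" by (simp add: algebra_simps)
    \<comment> \<open>The product of the two nonpositive derivatives enters \<open>W\<close> with a
      minus sign, so an upper bound for \<open>W\<close> needs only the decay of
      \<open>y\<close>.\<close>
    have "0 \<le> y' s * deriv w s" using slope[OF s] w'_nonpos by (simp add: mult_nonpos_nonpos)
    then have "W s \<le> y s * ?q s" by (simp add: W_def)
    also have "\<dots> \<le> y s * (s * (w 0 + 2 * w 0 ^ 3))" using q yp by (intro mult_left_mono) auto
    also have "y s \<le> C / exp s" using decay[OF s] by (simp add: pos_le_divide_eq)
    then have "y s * (s * (w 0 + 2 * w 0 ^ 3)) \<le> C / exp s * (s * (w 0 + 2 * w 0 ^ 3))"
      using s0 w_pos[of 0] by (intro mult_right_mono) (auto intro!: mult_nonneg_nonneg add_nonneg_nonneg)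
    also have "\<dots> = K * (s ^ 1 / exp s)" by (simp add: K_def)
    finally show ?thesis using Wge[OF s0(2)] by simp
  qed
  have "((\<lambda>s. K * (s ^ 1 / exp s)) \<longlongrightarrow> K * 0) at_top" by (intro tendsto_intros tendsto_power_div_exp_0)
  moreover have "\<forall>\<^sub>F s in at_top. W s1 \<le> K * (s ^ 1 / exp s)"
    using eventually_ge_at_top[of S] by eventually_elim (rule bound)
  ultimately have "W s1 \<le> K * 0" by (rule tendsto_lowerbound) simp
  then show False using W1 by simp
qed

text \<open>The slope conditions are linear in \<open>y\<close>, so the negative case is the
  positive one for \<open>- y\<close>.\<close>

lemma no_connecting_solution:
  assumes y: "\<And>s. (y has_real_derivative y' s) (at s)" "\<And>s. (y' has_real_derivative (s + 6 * (w s)\<^sup>2) * y s) (at s)"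
    and s1: "deriv w s1 < s1 * w s1 + 2 * w s1 ^ 3" "y' s1 = \<sigma>1 * y s1" "1 \<le> \<sigma>1"
    and s3: "\<And>s. s3 \<le> s \<Longrightarrow> \<exists>\<sigma>\<ge>1/2. y' s = - \<sigma> * sqrt s * y s"
  shows "y s1 = 0"
proof (rule ccontr)
  assume "y s1 \<noteq> 0"
  then consider "0 < y s1" | "0 < - y s1" by linarith
  then show False
  proof cases
    case 1
    then show ?thesis using linearization_positive_False[OF assms] by blast
  next
    case 2
    have s3': "\<exists>\<sigma>\<ge>1/2. - y' s = - \<sigma> * sqrt s * - y s" if "s3 \<le> s" for s
      using s3[OF that] by force
    show ?thesis
      by (rule linearization_positive_False[where y = "\<lambda>s. - y s" and y' = "\<lambda>s. - y' s", OF _ _ s1(1) _ s1(3) s3' 2])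
        (use y[THEN DERIV_minus] s1 in auto)
  qed
qed

end

section \<open>Straightening the flow along the orbit\<close>

text \<open>A quadratic spline with knots 0, 1/2 and 1, rising from 0 to 1 with second derivative 4
  and then -4. Each squared positive part is C1, the smoothness that the flow requires.\<close>

definition smooth_step :: "real \<Rightarrow> real"
  where "smooth_step y = 2 * (max 0 y)\<^sup>2 - 4 * (max 0 (y - 1/2))\<^sup>2 + 2 * (max 0 (y - 1))\<^sup>2"

lemma smooth_step_0: "y \<le> 0 \<Longrightarrow> smooth_step y = 0"
  by (simp add: smooth_step_def)

lemma smooth_step_1: "1 \<le> y \<Longrightarrow> smooth_step y = 1"
  by (simp add: smooth_step_def power2_eq_square algebra_simps)

lemma smooth_step_nonneg: "0 \<le> smooth_step y"
proof -
  consider "y \<le> 1/2" | "1/2 \<le> y" "y \<le> 1" | "1 \<le> y" by linarith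
  then show ?thesis
  proof cases
    case 2
    then have "smooth_step y = 1 - 2 * (1 - y)\<^sup>2"
      by (simp add: smooth_step_def power2_eq_square algebra_simps)
    moreover have "(1 - y)\<^sup>2 \<le> (1/2)\<^sup>2" using 2 by (intro power_mono) auto
    ultimately show ?thesis by (simp add: power2_eq_square)
  qed (simp_all add: smooth_step_1, simp add: smooth_step_def)
qed

lemma max_square_deriv: "((\<lambda>y. (max 0 y)\<^sup>2) has_real_derivative 2 * max 0 y) (at (y::real))"
proof -
  consider "y < 0" | "y = 0" | "0 < y" by linarith
  then show ?thesis
  proof cases
    case 1
    have "((\<lambda>y. 0) has_real_derivative 0) (at y)" by simp
    then have "((\<lambda>y. (max 0 y)\<^sup>2) has_real_derivative 0) (at y)"
      by (rule has_field_derivative_transform_within_open[where S = "{..<0}"]) (use 1 in auto)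
    then show ?thesis using 1 by simp
  next
    case 3
    have "((\<lambda>y. y\<^sup>2) has_real_derivative 2 * y) (at y)" by (auto intro!: derivative_eq_intros)
    then have "((\<lambda>y. (max 0 y)\<^sup>2) has_real_derivative 2 * y) (at y)"
      by (rule has_field_derivative_transform_within_open[where S = "{0<..}"]) (use 3 in auto)
    then show ?thesis using 3 by simp
  next
    case 2
    have "((\<lambda>h. (max 0 h)\<^sup>2 / h) \<longlongrightarrow> 0) (at (0::real))"
    proof (rule Lim_null_comparison)
      show "\<forall>\<^sub>F h in at (0::real). norm ((max 0 h)\<^sup>2 / h) \<le> \<bar>h\<bar>"
        by (rule always_eventually) (auto simp: max_def power2_eq_square)
      show "((\<lambda>h::real. \<bar>h\<bar>) \<longlongrightarrow> 0) (at 0)" by (rule tendsto_rabs_zero) (rule tendsto_ident_at)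
    qed
    then show ?thesis using 2 by (simp add: DERIV_def)
  qed
qed

lemma C1_on_max_square:
  fixes f :: "_ \<Rightarrow> real"
  shows "C1_on S f \<Longrightarrow> C1_on S (\<lambda>x. (max 0 (f x))\<^sup>2)"
  by (rule C1_on_real_compose[where h = "\<lambda>y. (max 0 y)\<^sup>2" and h' = "\<lambda>y. 2 * max 0 y" and T = UNIV])
    (auto intro!: continuous_intros simp: max_square_deriv simp flip: has_real_derivative_iff_has_vector_derivative)

lemma C1_on_smooth_step: "C1_on S f \<Longrightarrow> C1_on S (\<lambda>x. smooth_step (f x))"
  unfolding smooth_step_def by (intro C1_intros C1_on_max_square)

text \<open>\<open>\<mu>\<^sub>2' = - lapse\<close> along the rescaling-chart flow; dividing by \<open>lapse\<close> turns \<open>- \<mu>\<^sub>2\<close> into time.\<close>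

definition lapse :: "state \<Rightarrow> real" where "lapse = (\<lambda>(u, v, m, r). 1 - r^4 * m^2)"

section \<open>The cut-off field around the orbit\<close>

context hastings_mcleod_solution
begin

definition U :: "real \<Rightarrow> real" where "U s = sqrt 2 * w s"
definition V :: "real \<Rightarrow> real" where "V s = sqrt 2 * deriv w s"

lemma U_deriv: "(U has_real_derivative V s) (at s)"
  unfolding U_def V_def by (auto intro!: derivative_eq_intros w_deriv)

lemma V_deriv: "(V has_real_derivative s * U s + U s ^ 3) (at s)"
proof -
  have "sqrt 2 ^ 3 = 2 * sqrt (2::real)" by (simp add: power3_eq_cube)
  then show ?thesis
    unfolding U_def V_def
    by (auto intro!: derivative_eq_intros w_deriv2 simp: power_mult_distrib algebra_simps)
qed

lemma U_C1: "C1_on S g \<Longrightarrow> C1_on S (\<lambda>x. U (g x))"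
proof (rule C1_on_real_compose[where T = UNIV and h = U and h' = V])
  show "(U has_vector_derivative V x) (at x)" for x
    using U_deriv by (simp add: has_real_derivative_iff_has_vector_derivative)
  show "continuous_on UNIV V" by (meson DERIV_continuous_on DERIV_subset V_deriv subset_UNIV)
qed auto

lemma V_C1: "C1_on S g \<Longrightarrow> C1_on S (\<lambda>x. V (g x))"
proof (rule C1_on_real_compose[where T = UNIV and h = V and h' = "\<lambda>s. s * U s + U s ^ 3"])
  show "(V has_vector_derivative x * U x + U x ^ 3) (at x)" for x
    using V_deriv by (simp add: has_real_derivative_iff_has_vector_derivative)
  show "continuous_on UNIV (\<lambda>s. s * U s + U s ^ 3)"
    by (intro continuous_intros) (meson DERIV_continuous_on DERIV_subset U_deriv subset_UNIV)+
qed auto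

text \<open>The field \<open>K2_field / lapse\<close> in coordinates \<open>(s, p, q, r)\<close> with \<open>s = - \<mu>\<^sub>2\<close> and \<open>(p, q)\<close> the deviation
  from the orbit; the first cut-off removes the pole of \<open>1 / lapse\<close>, the second one makes the
  field compactly supported in \<open>(p, q, r)\<close>.\<close>

definition inv_lapse :: "state \<Rightarrow> real"
  where "inv_lapse = (\<lambda>(s, p, q, r). inverse (1 - (r^4 * s^2) * (1 - smooth_step (4 * (r^4 * s^2) - 1))))"

definition fld0 :: "state \<Rightarrow> real \<times> real \<times> real"
  where "fld0 = (\<lambda>(s, p, q, r). ((V s + q) * inv_lapse (s, p, q, r) - V s,
    (s * (U s + p) + (U s + p)^3) * inv_lapse (s, p, q, r) - (s * U s + U s ^ 3), 0))"

definition fld :: "state \<Rightarrow> real \<times> real \<times> real"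
  where "fld z = (1 - smooth_step (snd z \<bullet> snd z - 1)) *\<^sub>R fld0 z"

text \<open>Up to \<open>x = 1/2\<close> the subtracted term is at most 1/2; beyond it the step
  function equals 1 and nothing is subtracted.\<close>

lemma inv_lapse_denominator: "0 < 1 - x * (1 - smooth_step (4 * x - 1))" if "0 \<le> x"
proof (cases "x \<le> 1/2")
  case True
  have "x * (1 - smooth_step (4 * x - 1)) \<le> x * 1"
    using that smooth_step_nonneg by (intro mult_left_mono) auto
  then show ?thesis using True by simp
qed (simp add: smooth_step_1)

lemma inv_lapse_eq:
  assumes "r^4 * s^2 < 1/4" shows "inv_lapse (s, p, q, r) = 1 / (1 - r^4 * s^2)"
proof -
  have "smooth_step (4 * (r^4 * s^2) - 1) = 0" by (rule smooth_step_0) (use assms in simp)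
  then show ?thesis by (simp only: inv_lapse_def split inverse_eq_divide diff_zero mult_1_right)
qed

lemma fld_C1: "C1_on UNIV fld"
proof -
  have nz: "1 - x * (1 - smooth_step (4 * x - 1)) \<noteq> 0" if "0 \<le> x" for x
    using inv_lapse_denominator[OF that] by simp
  have B: "C1_on UNIV inv_lapse"
    unfolding inv_lapse_def split_beta
  proof (rule C1_on_inverse)
    show "C1_on UNIV (\<lambda>z::state. 1 - snd (snd (snd z)) ^ 4 * (fst z)\<^sup>2 * (1 - smooth_step (4 * (snd (snd (snd z)) ^ 4 * (fst z)\<^sup>2) - 1)))"
      by (intro C1_intros C1_on_smooth_step)
    show "1 - snd (snd (snd z)) ^ 4 * (fst z)\<^sup>2 * (1 - smooth_step (4 * (snd (snd (snd z)) ^ 4 * (fst z)\<^sup>2) - 1)) \<noteq> 0" for z :: state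
      by (rule nz) simp
  qed
  have "C1_on UNIV fld0"
    unfolding fld0_def split_beta by (simp, intro C1_intros U_C1 V_C1 B)
  then show ?thesis unfolding fld_def
    by (intro C1_intros C1_on_smooth_step C1_on_bilinear[OF bounded_bilinear_inner])
qed

definition fld' :: "state \<Rightarrow> state \<Rightarrow>\<^sub>L (real \<times> real \<times> real)"
  where "fld' = (SOME f'. (\<forall>x\<in>UNIV. (fld has_derivative blinfun_apply (f' x)) (at x)) \<and> continuous_on UNIV f')"

text \<open>The outer cut-off factor vanishes as soon as the squared norm reaches 2, whence the
  radius \<open>sqrt 2\<close>.\<close>

sublocale compactly_supported_flow fld fld' "sqrt 2"
proof
  have "(\<forall>x\<in>UNIV. (fld has_derivative blinfun_apply (fld' x)) (at x)) \<and> continuous_on UNIV fld'"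
    unfolding fld'_def using fld_C1[unfolded C1_on_def] by (rule someI_ex)
  then show "(fld has_derivative blinfun_apply (fld' z)) (at z)" "continuous_on UNIV fld'" for z by blast+
  show "fld (t, x) = 0" if "sqrt 2 \<le> norm x" for t x
  proof -
    have "(sqrt 2)\<^sup>2 \<le> (norm x)\<^sup>2" using that by (intro power_mono) auto
    then show ?thesis by (simp add: fld_def smooth_step_1 power2_norm_eq_inner)
  qed
qed

lemma fld_near: "norm x < 1 \<Longrightarrow> fld (s, x) = fld0 (s, x)"
proof -
  assume "norm x < 1"
  then have "(norm x)\<^sup>2 < 1" by (simp add: power_less_one_iff)
  then show ?thesis by (simp add: fld_def smooth_step_0 power2_norm_eq_inner)
qed

lemma fld0_zero: "fld0 (s, 0) = 0"
  by (simp add: fld0_def zero_prod_def inv_lapse_def)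

lemma flow_zero [simp]: "flow s 0 = 0"
proof -
  have "((\<lambda>_. 0) has_vector_derivative fld (t, 0)) (at t)" for t
    using fld0_zero[of t] by (simp add: fld_near)
  then have "(\<lambda>_. 0) s = flow s 0" by (rule solution_unique[OF _ flow_deriv, of _ 0]) simp
  then show ?thesis by simp
qed

lemma third_A: "snd (snd (blinfun_apply (A z) h)) = 0"
proof -
  obtain t x where z: "z = (t, x)" by (cases z)
  have "((\<lambda>x. snd (snd (fld (t, x)))) has_derivative (\<lambda>h. snd (snd (blinfun_apply (A (t, x)) h)))) (at x)"
    by (intro has_derivative_snd f_partial)
  moreover have "(\<lambda>x. snd (snd (fld (t, x)))) = (\<lambda>x. 0)" by (auto simp: fld_def fld0_def)
  ultimately have "(\<lambda>h. snd (snd (blinfun_apply (A (t, x)) h))) = (\<lambda>h. 0)"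
    using has_derivative_unique[OF _ has_derivative_const] by force
  from fun_cong[OF this, of h] show ?thesis by (simp add: z)
qed

text \<open>\<open>r\<close> is constant along the flow; therefore the plane of vanishing
  \<open>r\<close>-component is invariant under the linearization.\<close>

lemma third_dflow: "snd (snd (dflow s x h)) = snd (snd h)"
proof -
  have "((\<lambda>s. snd (snd (dflow s x h))) has_vector_derivative 0) (at t within UNIV)" for t
    using bounded_linear.has_vector_derivative[OF bounded_linear_compose[OF bounded_linear_snd bounded_linear_snd] dflow_deriv, of x h t]
    by (simp add: third_A)
  then obtain c where "\<And>t. snd (snd (dflow t x h)) = c"
    using has_vector_derivative_zero_constant[of UNIV "\<lambda>s. snd (snd (dflow s x h))"] by auto
  from this[of s] this[of 0] show ?thesis by simp
qed

text \<open>At \<open>r = 0\<close> the factor \<open>inv_lapse\<close> is 1, so \<open>fld\<close>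
  can be differentiated explicitly along the ray through (p, q, 0). The coefficient 6 w^2 is 3 U^2,
  as U = sqrt 2 w.\<close>

lemma A_zero: "blinfun_apply (A (s, 0)) (p, q, 0) = (q, (s + 6 * (w s)\<^sup>2) * p, 0)"
proof -
  let ?X = "(p, q, 0) :: real \<times> real \<times> real"
  have "((\<lambda>\<tau>::real. \<tau> *\<^sub>R ?X) has_vector_derivative ?X) (at 0)" by (auto intro!: derivative_eq_intros)
  then have "(((\<lambda>x. fld (s, x)) \<circ> (\<lambda>\<tau>. \<tau> *\<^sub>R ?X)) has_vector_derivative blinfun_apply (A (s, 0)) ?X) (at 0)"
    by (rule vector_derivative_diff_chain_within) (use f_partial[of s 0] in \<open>simp add: zero_prod_def\<close>)
  moreover have "(((\<lambda>x. fld (s, x)) \<circ> (\<lambda>\<tau>. \<tau> *\<^sub>R ?X)) has_vector_derivative (q, (s + 6 * (w s)\<^sup>2) * p, 0)) (at 0)"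
  proof -
    have U2: "3 * (U s)\<^sup>2 = 6 * (w s)\<^sup>2" by (simp add: U_def power_mult_distrib)
    have "((\<lambda>\<tau>. s * (U s + \<tau> * p) + (U s + \<tau> * p)^3 - (s * U s + U s ^ 3)) has_real_derivative (s + 3 * (U s)\<^sup>2) * p) (at 0)"
      by (auto intro!: derivative_eq_intros simp: algebra_simps)
    then have 1: "((\<lambda>\<tau>. s * (U s + \<tau> * p) + (U s + \<tau> * p)^3 - (s * U s + U s ^ 3)) has_vector_derivative (s + 6 * (w s)\<^sup>2) * p) (at 0)"
      by (simp only: U2 has_real_derivative_iff_has_vector_derivative)
    have 2: "((\<lambda>\<tau>. \<tau> * q) has_vector_derivative q) (at 0)"
      by (auto intro!: derivative_eq_intros simp flip: has_real_derivative_iff_has_vector_derivative)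
    have 3: "((\<lambda>\<tau>. (\<tau> * q, s * (U s + \<tau> * p) + (U s + \<tau> * p)^3 - (s * U s + U s ^ 3), 0::real)) has_vector_derivative (q, (s + 6 * (w s)\<^sup>2) * p, 0)) (at 0)"
      by (intro has_vector_derivative_Pair 1 2 has_vector_derivative_const)
    show ?thesis
    proof (rule has_vector_derivative_transform_within_open[OF 3])
      show "open {\<tau>. norm (\<tau> *\<^sub>R ?X) < 1}" by (intro open_Collect_less continuous_intros)
      show "(\<tau> * q, s * (U s + \<tau> * p) + (U s + \<tau> * p)^3 - (s * U s + U s ^ 3), 0) = ((\<lambda>x. fld (s, x)) \<circ> (\<lambda>\<tau>. \<tau> *\<^sub>R ?X)) \<tau>"
        if "\<tau> \<in> {\<tau>. norm (\<tau> *\<^sub>R ?X) < 1}" for \<tau>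
        using that fld_near[of "\<tau> *\<^sub>R ?X" s] by (simp add: fld0_def inv_lapse_def)
    qed simp
  qed
  ultimately show ?thesis by (rule vector_derivative_unique_at)
qed

section \<open>Co-moving coordinates and the straightening map\<close>

definition comoving :: "state \<Rightarrow> state"
  where "comoving = (\<lambda>(s, p, q, r). (U s + p, V s + q, - s, r))"

definition comoving_inv :: "state \<Rightarrow> state"
  where "comoving_inv = (\<lambda>(u, v, m, r). (- m, u - U (- m), v - V (- m), r))"

lemma comoving_inverse [simp]: "comoving_inv (comoving z) = z" "comoving (comoving_inv z) = z"
  by (auto simp: comoving_def comoving_inv_def split_beta)

lemma comoving_C1: "C1_on UNIV comoving" "C1_on UNIV comoving_inv"
  unfolding comoving_def comoving_inv_def split_beta by (intro C1_intros U_C1 V_C1)+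

text \<open>Lines with fixed \<open>x\<close> go to trajectories of the cut-off field, which are
  orbits of \<open>K2_field\<close>, up to the choice of time, as long as they stay in the image of
  \<open>good\<close>.\<close>

definition Psi :: "state \<Rightarrow> state" where "Psi z = comoving (Q z)"

definition Psi_inv :: "state \<Rightarrow> state" where "Psi_inv z = inv Q (comoving_inv z)"

lemma Psi_inverse [simp]: "Psi_inv (Psi z) = z" "Psi (Psi_inv z) = z"
  by (simp_all add: Psi_def Psi_inv_def bij_is_inj[OF Q_bij] surj_f_inv_f[OF bij_is_surj[OF Q_bij]])

lemma Psi_C1: "C1_on UNIV Psi" and Psi_inv_C1: "C1_on UNIV Psi_inv"
  unfolding Psi_def[abs_def] Psi_inv_def[abs_def]
  using C1_on_compose[OF Q_C1 comoving_C1(1)] C1_on_compose[OF comoving_C1(2) Q_inverse_C1] by auto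

lemma Psi_mu: "fst (snd (snd (Psi (s, x)))) = - s"
  by (simp add: Psi_def comoving_def Q_def split_beta)

lemma Psi_axis: "Psi (s, 0) = hm_orbit w s"
  by (simp add: Psi_def comoving_def Q_def hm_orbit_def U_def V_def split_beta)

text \<open>On \<open>good\<close> both cut-offs are inactive.\<close>

definition good :: "state set"
  where "good = {z. norm (snd (Q z)) < 1 \<and> snd (snd (snd (Q z))) ^ 4 * fst z ^ 2 < 1/4}"

lemma good_open: "open good"
  unfolding good_def by (intro open_Collect_conj open_Collect_less continuous_intros Q_cont)

lemma axis_good: "(s, 0) \<in> good"
  by (simp add: good_def Q_def)

lemma lapse_pos: "z \<in> good \<Longrightarrow> 0 < lapse (Psi z)"
  by (cases z) (auto simp: good_def lapse_def Psi_def comoving_def Q_def split_beta)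

text \<open>Adding the motion of the base point (U, V) cancels the terms subtracted in
  \<open>fld0\<close>. What remains is \<open>K2_field\<close> per unit of \<open>- \<mu>\<close>,
  hence the division by \<open>lapse\<close>.\<close>

lemma Psi_line:
  assumes "(s, x) \<in> good"
  shows "((\<lambda>s. Psi (s, x)) has_vector_derivative (1 / lapse (Psi (s, x))) *\<^sub>R K2_field (Psi (s, x))) (at s)"
proof -
  obtain p q r where x: "flow s x = (p, q, r)" by (cases "flow s x")
  have g: "norm (p, q, r) < 1" "r^4 * s^2 < 1/4" using assms by (auto simp: good_def Q_def x)
  let ?B = "1 / (1 - r^4 * s^2)"
  have f: "fld (s, flow s x) = ((V s + q) * ?B - V s, (s * (U s + p) + (U s + p)^3) * ?B - (s * U s + U s ^ 3), 0)"
    unfolding x using g by (simp only: fld_near fld0_def inv_lapse_eq split)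
  have d1: "((\<lambda>s. fst (flow s x)) has_vector_derivative (V s + q) * ?B - V s) (at s)"
    using bounded_linear.has_vector_derivative[OF bounded_linear_fst flow_deriv, of x s] by (simp add: f)
  have d2: "((\<lambda>s. fst (snd (flow s x))) has_vector_derivative (s * (U s + p) + (U s + p)^3) * ?B - (s * U s + U s ^ 3)) (at s)"
    using bounded_linear.has_vector_derivative[OF bounded_linear_compose[OF bounded_linear_fst bounded_linear_snd] flow_deriv, of x s]
    by (simp add: f)
  have d3: "((\<lambda>s. snd (snd (flow s x))) has_vector_derivative 0) (at s)"
    using bounded_linear.has_vector_derivative[OF bounded_linear_compose[OF bounded_linear_snd bounded_linear_snd] flow_deriv, of x s]
    by (simp add: f)
  have "((\<lambda>s. (U s + fst (flow s x), V s + fst (snd (flow s x)), - s, snd (snd (flow s x)))) has_vector_derivative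
      (V s + ((V s + q) * ?B - V s), (s * U s + U s ^ 3) + ((s * (U s + p) + (U s + p)^3) * ?B - (s * U s + U s ^ 3)), - 1, 0)) (at s)"
    using U_deriv[of s] V_deriv[of s]
    by (intro has_vector_derivative_Pair has_vector_derivative_add d1 d2 d3 has_vector_derivative_minus has_vector_derivative_id)
      (simp_all add: has_real_derivative_iff_has_vector_derivative)
  moreover have "(\<lambda>s. Psi (s, x)) = (\<lambda>s. (U s + fst (flow s x), V s + fst (snd (flow s x)), - s, snd (snd (flow s x))))"
    by (simp add: Psi_def comoving_def Q_def split_beta)
  moreover have "(1 / lapse (Psi (s, x))) *\<^sub>R K2_field (Psi (s, x)) =
      (V s + ((V s + q) * ?B - V s), (s * U s + U s ^ 3) + ((s * (U s + p) + (U s + p)^3) * ?B - (s * U s + U s ^ 3)), - 1, 0)"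
  proof -
    have "1 - r^4 * s^2 \<noteq> 0" using g(2) by simp
    then have "?B * (- 1 + r^4 * s^2) = - 1" by (simp add: field_simps)
    then show ?thesis
      by (simp add: Psi_def comoving_def Q_def x K2_field_def lapse_def mult.commute)
  qed
  ultimately show ?thesis by simp
qed

text \<open>Through this differential, initial vectors with \<open>r\<close>-component 0 become the
  solutions (y, y') of the linearized equation, and at each time these values exhaust the (u,
  v)-plane.\<close>

lemma Psi_partial_axis:
  obtains D where "\<And>s. ((\<lambda>x. Psi (s, x)) has_derivative D s) (at 0)"
    "\<And>p q. \<exists>y y'. (\<forall>s. (y has_real_derivative y' s) (at s)) \<and> (\<forall>s. (y' has_real_derivative (s + 6 * (w s)\<^sup>2) * y s) (at s)) \<and>
       y 0 = p \<and> y' 0 = q \<and> (\<forall>s. D s (p, q, 0) = (y s, y' s, 0, 0))"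
    "\<And>s a b. \<exists>p q. D s (p, q, 0) = (a, b, 0, 0)"
    "\<And>s h. D s h = 0 \<Longrightarrow> h = 0"
proof
  define D where "D s h = (fst (dflow s 0 h), fst (snd (dflow s 0 h)), 0::real, snd (snd (dflow s 0 h)))" for s h
  show "((\<lambda>x. Psi (s, x)) has_derivative D s) (at 0)" for s
  proof -
    have "((\<lambda>x. (U s + fst (flow s x), V s + fst (snd (flow s x)), - s, snd (snd (flow s x)))) has_derivative D s) (at 0)"
      unfolding D_def[abs_def]
      by (intro has_derivative_Pair) (auto intro!: derivative_eq_intros flow_has_derivative)
    then show ?thesis by (simp add: Psi_def comoving_def Q_def split_beta)
  qed
  show "\<exists>y y'. (\<forall>s. (y has_real_derivative y' s) (at s)) \<and> (\<forall>s. (y' has_real_derivative (s + 6 * (w s)\<^sup>2) * y s) (at s)) \<and>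
       y 0 = p \<and> y' 0 = q \<and> (\<forall>s. D s (p, q, 0) = (y s, y' s, 0, 0))" for p q
  proof (intro exI conjI allI)
    let ?y = "\<lambda>s. fst (dflow s 0 (p, q, 0))" let ?y' = "\<lambda>s. fst (snd (dflow s 0 (p, q, 0)))"
    have eq: "dflow s 0 (p, q, 0) = (?y s, ?y' s, 0)" for s
      using third_dflow[of s 0 "(p, q, 0)"] by (simp add: prod_eq_iff)
    have d: "((\<lambda>s. dflow s 0 (p, q, 0)) has_vector_derivative (?y' s, (s + 6 * (w s)\<^sup>2) * ?y s, 0)) (at s)" for s
      using dflow_deriv[of 0 "(p, q, 0)" s] A_zero[of s "?y s" "?y' s"] eq[of s] by simp
    show "(?y has_real_derivative ?y' s) (at s)" for s
      using bounded_linear.has_vector_derivative[OF bounded_linear_fst d]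
      by (simp add: has_real_derivative_iff_has_vector_derivative)
    show "(?y' has_real_derivative (s + 6 * (w s)\<^sup>2) * ?y s) (at s)" for s
      using bounded_linear.has_vector_derivative[OF bounded_linear_compose[OF bounded_linear_fst bounded_linear_snd] d]
      by (simp add: has_real_derivative_iff_has_vector_derivative)
    show "D s (p, q, 0) = (?y s, ?y' s, 0, 0)" for s
      using third_dflow[of s 0 "(p, q, 0)"] by (simp add: D_def)
  qed auto
  show "h = 0" if "D s h = 0" for s h
  proof -
    have "dflow s 0 h = 0" using that by (simp add: D_def prod_eq_iff zero_prod_def)
    then show ?thesis by (rule dflow_ker)
  qed
  show "\<exists>p q. D s (p, q, 0) = (a, b, 0, 0)" for s a b
  proof -
    have lin: "linear (dflow s 0)" by (rule bounded_linear.linear[OF dflow_bounded_linear])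
    have "inj (dflow s 0)" using dflow_ker by (simp add: linear_injective_0[OF lin])
    then have "surj (dflow s 0)" by (rule linear_injective_imp_surjective[OF lin _ refl])
    then obtain h where h: "dflow s 0 h = (a, b, 0)" by (metis surjD)
    then have "snd (snd h) = 0" using third_dflow[of s 0 h] by simp
    then have "h = (fst h, fst (snd h), 0)" by (simp add: prod_eq_iff)
    then have "D s (fst h, fst (snd h), 0) = (a, b, 0, 0)" using h by (simp add: D_def)
    then show ?thesis by blast
  qed
qed

end

section \<open>The charts at both ends of the orbit\<close>

text \<open>A kernel vector is the velocity of a curve in the zero set of \<open>g\<close>, along
  which \<open>h\<close> vanishes as well. So two defining functions can be compared through their
  zero sets alone, without a formula relating them.\<close>

lemma level_set_kernel_le:
  fixes g :: "'a::euclidean_space \<Rightarrow> 'b::euclidean_space" and h :: "'a \<Rightarrow> 'c::real_normed_vector"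
  assumes Y: "open Y" "x \<in> Y" and g: "\<And>x. x \<in> Y \<Longrightarrow> (g has_derivative blinfun_apply (g' x)) (at x)" "continuous_on Y g'"
    and surj: "surj (blinfun_apply (g' x))" and "g x = 0"
    and h: "(h has_derivative h') (at x)" "\<And>y. y \<in> Y \<Longrightarrow> g y = 0 \<Longrightarrow> h y = 0"
    and v: "blinfun_apply (g' x) v = 0"
  shows "h' v = 0"
proof -
  obtain U V \<phi> \<psi> where U: "open U" "x \<in> U" "U \<subseteq> Y" "open V" "homeomorphism U V \<phi> \<psi>"
    "C1_on U \<phi>" "C1_on V \<psi>" "\<And>y. y \<in> U \<Longrightarrow> blinfun_apply (g' x) (\<phi> y) = g y" "(\<psi> has_derivative id) (at (\<phi> x))"
    by (rule level_set_straightening[of Y x g g']) (use Y g surj \<open>g x = 0\<close> in auto)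
  let ?c = "\<lambda>t::real. \<phi> x + t *\<^sub>R v"
  have px: "\<phi> x \<in> V" "\<psi> (\<phi> x) = x" using U(2,5) by (auto simp: homeomorphism_def)
  have c: "(?c has_vector_derivative v) (at 0)" by (auto intro!: derivative_eq_intros)
  have "((\<psi> \<circ> ?c) has_vector_derivative id v) (at 0)"
    by (rule vector_derivative_diff_chain_within[OF c]) (use U(9) in \<open>auto simp: id_def intro: has_derivative_at_withinI\<close>)
  then have "((h \<circ> (\<psi> \<circ> ?c)) has_vector_derivative h' (id v)) (at 0)"
    by (rule vector_derivative_diff_chain_within) (use h(1) px in \<open>auto intro: has_derivative_at_withinI\<close>)
  moreover have "((h \<circ> (\<psi> \<circ> ?c)) has_vector_derivative 0) (at 0)"
  proof (rule has_vector_derivative_transform_within_open[OF has_vector_derivative_const])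
    show "open (?c -` V)" by (rule open_vimage[OF U(4)]) (intro continuous_intros)
    show "0 \<in> ?c -` V" using px by simp
    fix t assume "t \<in> ?c -` V"
    then have t: "\<psi> (?c t) \<in> U" "\<phi> (\<psi> (?c t)) = ?c t" using U(5) by (auto simp: homeomorphism_def)
    have "g (\<psi> (?c t)) = blinfun_apply (g' x) (?c t)" using U(8)[OF t(1)] t(2) by simp
    also have "\<dots> = 0" using U(8)[OF U(2)] \<open>g x = 0\<close> v by (simp add: blinfun.bilinear_simps)
    finally have "h (\<psi> (?c t)) = 0" using h(2) U(3) t(1) by blast
    then show "0 = (h \<circ> (\<psi> \<circ> ?c)) t" by simp
  qed
  ultimately show ?thesis using vector_derivative_unique_at by fastforce
qed

text \<open>The tube lemma, prepared for conditions imposed along whole orbit segments.\<close>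

lemma open_forall_compact:
  fixes f :: "'t::topological_space \<times> 'a::topological_space \<Rightarrow> 'b::topological_space"
  assumes "compact K" "open A" "continuous_on UNIV f"
  shows "open {z. \<forall>\<tau>\<in>K. f (\<tau>, z) \<in> A}"
proof (subst open_subopen, rule ballI)
  fix z assume z: "z \<in> {z. \<forall>\<tau>\<in>K. f (\<tau>, z) \<in> A}"
  define H where "H = (\<lambda>(z, \<tau>). f (\<tau>, z)) -` A"
  have "open H" unfolding H_def split_beta
    by (intro open_vimage[OF assms(2)] continuous_on_compose2[OF assms(3)] continuous_intros) auto
  moreover have "{z} \<times> K \<subseteq> H" using z by (auto simp: H_def)
  ultimately obtain X where "z \<in> X" "open X" "X \<times> K \<subseteq> H"
    using Elementary_Topology.tube_lemma[OF assms(1), of H z] by blast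
  then show "\<exists>T. open T \<and> z \<in> T \<and> T \<subseteq> {z. \<forall>\<tau>\<in>K. f (\<tau>, z) \<in> A}"
    by (intro exI[of _ X]) (auto simp: H_def)
qed

text \<open>The new time is the integral of \<open>h\<close>; \<open>y\<close> composed with the
  inverse of that integral solves the unscaled equation and traces the same points.\<close>

lemma reparametrize:
  fixes F :: "'a::real_normed_vector \<Rightarrow> 'a"
  assumes ab: "a \<le> b" and y: "\<And>t. t \<in> {a..b} \<Longrightarrow> (y has_vector_derivative h t *\<^sub>R F (y t)) (at t within {a..b})"
    and h: "continuous_on {a..b} h" "\<And>t. t \<in> {a..b} \<Longrightarrow> 0 < h t"
  obtains z d where "solution_on F z 0 d" "z ` {0..d} = y ` {a..b}"
proof -
  \<comment> \<open>Clamping extends \<open>h\<close> to a positive continuous function on the line,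
    so \<open>\<Theta>\<close> is increasing everywhere and its inverse is differentiable at the end
    points too.\<close>
  define c where "c t = max a (min b t)" for t
  have c: "c t \<in> {a..b}" "t \<in> {a..b} \<Longrightarrow> c t = t" for t using ab by (auto simp: c_def)
  define \<Theta> where "\<Theta> t = primitive (\<lambda>t. h (c t)) t - primitive (\<lambda>t. h (c t)) a" for t
  have "continuous_on UNIV c" unfolding c_def by (intro continuous_intros)
  then have "continuous_on UNIV (\<lambda>t. h (c t))" by (rule continuous_on_compose2[OF h(1)]) (use c in auto)
  then have "(primitive (\<lambda>t. h (c t)) has_vector_derivative h (c t)) (at t)" for t
    by (rule primitive_has_vector_derivative)
  then have \<Theta>: "(\<Theta> has_real_derivative h (c t)) (at t)" for t
    unfolding \<Theta>_def has_real_derivative_iff_has_vector_derivative by (auto intro!: derivative_eq_intros)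
  have pos: "0 < h (c t)" for t using h(2) c by blast
  have mono: "s < t \<Longrightarrow> \<Theta> s < \<Theta> t" for s t
    by (rule DERIV_pos_imp_increasing) (use \<Theta> pos in auto)
  then have inj: "inj \<Theta>" by (metis injI linorder_neqE_linordered_idom order_less_irrefl)
  have cont: "isCont \<Theta> t" for t using \<Theta> by (rule DERIV_isCont)
  define \<zeta> where "\<zeta> = inv \<Theta>"
  have \<zeta>: "\<zeta> (\<Theta> t) = t" for t using inj by (simp add: \<zeta>_def)
  have surj: "\<exists>t. \<alpha> \<le> t \<and> t \<le> \<beta> \<and> \<Theta> t = u" if "\<Theta> \<alpha> \<le> u" "u \<le> \<Theta> \<beta>" "\<alpha> \<le> \<beta>" for u \<alpha> \<beta>
    using IVT[of \<Theta> \<alpha> u \<beta>] that cont by auto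
  have \<zeta>': "(\<zeta> has_real_derivative inverse (h (c t))) (at (\<Theta> t))" for t
  proof (rule DERIV_inverse_function[where f = \<Theta> and a = "\<Theta> (t - 1)" and b = "\<Theta> (t + 1)"])
    show "(\<Theta> has_real_derivative h (c t)) (at (\<zeta> (\<Theta> t)))" using \<Theta> \<zeta> by simp
    show "h (c t) \<noteq> 0" using pos[of t] by simp
    show "\<Theta> (t - 1) < \<Theta> t" "\<Theta> t < \<Theta> (t + 1)" by (auto intro: mono)
    show "\<Theta> (\<zeta> u) = u" if "\<Theta> (t - 1) < u" "u < \<Theta> (t + 1)" for u
      using surj[of "t - 1" u "t + 1"] that \<zeta> by force
    show "isCont \<zeta> (\<Theta> t)" by (rule isCont_inverse_function[of 1]) (use \<zeta> cont in auto)
  qed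
  have im: "\<zeta> u \<in> {a..b} \<and> \<Theta> (\<zeta> u) = u" if "u \<in> {0..\<Theta> b}" for u
    using surj[of a u b] that ab \<zeta> by (force simp: \<Theta>_def)
  have \<Theta>im: "\<Theta> t \<in> {0..\<Theta> b}" if "t \<in> {a..b}" for t
  proof -
    have "\<Theta> a = 0" by (simp add: \<Theta>_def)
    then show ?thesis using that mono[of a t] mono[of t b] by (cases "t = a"; cases "t = b") auto
  qed
  have "solution_on F (y \<circ> \<zeta>) 0 (\<Theta> b)"
    unfolding solution_on_def
  proof
    fix u assume u: "u \<in> {0..\<Theta> b}"
    have "(\<zeta> has_vector_derivative inverse (h (\<zeta> u))) (at u within {0..\<Theta> b})"
      using \<zeta>'[of "\<zeta> u"] im[OF u] c(2)
      by (auto simp: has_real_derivative_iff_has_vector_derivative intro: has_vector_derivative_at_within)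
    moreover have "(y has_vector_derivative h (\<zeta> u) *\<^sub>R F (y (\<zeta> u))) (at (\<zeta> u) within \<zeta> ` {0..\<Theta> b})"
      by (rule has_vector_derivative_within_subset[OF y]) (use im u in auto)
    ultimately have "((y \<circ> \<zeta>) has_vector_derivative inverse (h (\<zeta> u)) *\<^sub>R h (\<zeta> u) *\<^sub>R F (y (\<zeta> u))) (at u within {0..\<Theta> b})"
      by (rule vector_diff_chain_within)
    then show "((y \<circ> \<zeta>) has_vector_derivative F ((y \<circ> \<zeta>) u)) (at u within {0..\<Theta> b})"
      using h(2)[of "\<zeta> u"] im[OF u] by simp
  qed
  moreover have "(y \<circ> \<zeta>) ` {0..\<Theta> b} = y ` {a..b}"
  proof -
    have "\<zeta> ` {0..\<Theta> b} = {a..b}"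
    proof
      show "\<zeta> ` {0..\<Theta> b} \<subseteq> {a..b}" using im by blast
      show "{a..b} \<subseteq> \<zeta> ` {0..\<Theta> b}"
      proof
        fix t assume "t \<in> {a..b}"
        then show "t \<in> \<zeta> ` {0..\<Theta> b}" using \<Theta>im \<zeta>[of t] by (intro image_eqI[of _ _ "\<Theta> t"]) simp_all
      qed
    qed
    then show ?thesis by (simp only: image_comp[symmetric])
  qed
  ultimately show thesis by (rule that)
qed

text \<open>Local invariance speaks of true solutions; a positive change of time leaves the traced
  set, and thus membership in \<open>W\<close>, unaffected.\<close>

lemma locally_invariant_reparametrized:
  fixes F :: "'a::real_normed_vector \<Rightarrow> 'a"
  assumes "locally_invariant F U W" "a \<le> b"
    and "\<And>t. t \<in> {a..b} \<Longrightarrow> (y has_vector_derivative h t *\<^sub>R F (y t)) (at t within {a..b})"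
    and "continuous_on {a..b} h" "\<And>t. t \<in> {a..b} \<Longrightarrow> 0 < h t"
    and "y ` {a..b} \<subseteq> U" and s: "s \<in> {a..b}" "y s \<in> W" and t: "t \<in> {a..b}"
  shows "y t \<in> W"
proof -
  obtain z d where z: "solution_on F z 0 d" "z ` {0..d} = y ` {a..b}"
    using reparametrize[OF assms(2-5)] by blast
  have "\<exists>u\<in>{0..d}. z u \<in> W"
  proof -
    have "y s \<in> z ` {0..d}" using z(2) s(1) by simp
    then show ?thesis using s(2) by auto
  qed
  then have "z ` {0..d} \<subseteq> W" using assms(1,6) z unfolding locally_invariant_def by metis
  then show ?thesis using z(2) t by blast
qed

text \<open>The charts \<open>K\<^sub>1\<close> and \<open>K\<^sub>3\<close> are the cases \<open>\<sigma> = 1\<close> and \<open>\<sigma> = - 1\<close>;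
  \<open>chart_map 1\<close> is the inverse of \<open>kappa12\<close> and \<open>chart_map (- 1)\<close> is \<open>kappa23\<close>.\<close>

definition chart_field :: "real \<Rightarrow> state \<Rightarrow> state"
  where "chart_field \<sigma> = (\<lambda>(u, v, e, r).
    (v + \<sigma> / 2 * e * u * (1 - r^4), - \<sigma> * u + u^3 + \<sigma> * e * v * (1 - r^4),
     \<sigma> * (3 / 2 * e^2 * (1 - r^4)), - \<sigma> / 2 * r * e * (1 - r^4)))"

definition chart_map :: "real \<Rightarrow> state \<Rightarrow> state"
  where "chart_map \<sigma> = (\<lambda>(u, v, m, r).
    (u / sqrt (\<sigma> * m), v / sqrt (\<sigma> * m) ^ 2, 1 / sqrt (\<sigma> * m) ^ 3, r * sqrt (\<sigma> * m)))"

definition chart_dom :: "real \<Rightarrow> state set"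
  where "chart_dom \<sigma> = {X. 0 < \<sigma> * fst (snd (snd X))}"

lemma K1_field_eq: "K1_field = chart_field 1" and K3_field_eq: "K3_field = chart_field (- 1)"
  by (auto simp: K1_field_def K3_field_def chart_field_def fun_eq_iff)

lemma chart_map_C1: "C1_on (chart_dom \<sigma>) (chart_map \<sigma>)"
proof -
  have R: "C1_on (chart_dom \<sigma>) (\<lambda>X. sqrt (\<sigma> * fst (snd (snd X))))"
    by (rule C1_on_sqrt) (auto intro!: C1_intros simp: chart_dom_def)
  have Ri: "C1_on (chart_dom \<sigma>) (\<lambda>X. inverse (sqrt (\<sigma> * fst (snd (snd X)))))"
    by (rule C1_on_inverse[OF R]) (auto simp: chart_dom_def)
  have "chart_map \<sigma> = (\<lambda>X. (fst X * inverse (sqrt (\<sigma> * fst (snd (snd X)))),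
      fst (snd X) * inverse (sqrt (\<sigma> * fst (snd (snd X)))) ^ 2,
      inverse (sqrt (\<sigma> * fst (snd (snd X)))) ^ 3, snd (snd (snd X)) * sqrt (\<sigma> * fst (snd (snd X)))))"
    by (simp add: chart_map_def fun_eq_iff divide_inverse power_inverse)
  moreover have "C1_on (chart_dom \<sigma>) \<dots>" by (intro C1_intros R Ri)
  ultimately show ?thesis by simp
qed

text \<open>The factor \<open>sqrt (\<sigma> * \<mu>)\<close> is the ratio of the blow-up radii of
  the two charts, by which their rescaled times differ; \<open>c\<close> carries along a further
  change of time. Each component reduces to a rational identity in \<open>R\<close> because
  \<open>\<mu> = \<sigma> * R^2\<close>.\<close>

lemma chart_map_conjugates:
  assumes \<sigma>: "\<sigma> = 1 \<or> \<sigma> = - 1" and X: "X t \<in> chart_dom \<sigma>"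
    and d: "(X has_vector_derivative c *\<^sub>R K2_field (X t)) (at t within S)"
  shows "((\<lambda>t. chart_map \<sigma> (X t)) has_vector_derivative
    (c * sqrt (\<sigma> * fst (snd (snd (X t))))) *\<^sub>R chart_field \<sigma> (chart_map \<sigma> (X t))) (at t within S)"
proof -
  define u v m r where "u = (\<lambda>t. fst (X t))" and "v = (\<lambda>t. fst (snd (X t)))"
    and "m = (\<lambda>t. fst (snd (snd (X t))))" and "r = (\<lambda>t. snd (snd (snd (X t))))"
  have Xeq: "X t = (u t, v t, m t, r t)" for t by (simp add: u_def v_def m_def r_def)
  define R where "R t = sqrt (\<sigma> * m t)" for t
  have pos: "0 < \<sigma> * m t" using X by (simp add: chart_dom_def m_def)
  have R: "0 < R t" "R t ^ 2 = \<sigma> * m t" using pos by (auto simp: R_def)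
  have \<sigma>2: "\<sigma> * \<sigma> = 1" using \<sigma> by auto
  have m: "m t = \<sigma> * R t ^ 2" using R(2) \<sigma>2 by (simp add: mult.assoc[symmetric])
  have m2: "m t ^ 2 = R t ^ 4" using \<sigma>2 by (simp add: m power2_eq_square power4_eq_xxxx mult_ac)
  define R' where "R' = \<sigma> * (c * (- 1 + r t ^ 4 * R t ^ 4)) / (2 * R t)"
  note bl = bounded_linear.has_vector_derivative[OF _ d]
  have du: "(u has_real_derivative c * v t) (at t within S)"
    using bl[OF bounded_linear_fst] by (simp add: Xeq K2_field_def has_real_derivative_iff_has_vector_derivative)
  have dv: "(v has_real_derivative c * (- m t * u t + u t ^ 3)) (at t within S)"
    using bl[OF bounded_linear_compose[OF bounded_linear_fst bounded_linear_snd]]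
    by (simp add: Xeq K2_field_def has_real_derivative_iff_has_vector_derivative)
  have dm: "(m has_real_derivative c * (- 1 + r t ^ 4 * m t ^ 2)) (at t within S)"
    using bl[OF bounded_linear_compose[OF bounded_linear_fst bounded_linear_compose[OF bounded_linear_snd bounded_linear_snd]]]
    by (simp add: Xeq K2_field_def has_real_derivative_iff_has_vector_derivative)
  have dr: "(r has_real_derivative 0) (at t within S)"
    using bl[OF bounded_linear_compose[OF bounded_linear_snd bounded_linear_compose[OF bounded_linear_snd bounded_linear_snd]]]
    by (simp add: Xeq K2_field_def has_real_derivative_iff_has_vector_derivative)
  have dR: "(R has_real_derivative R') (at t within S)"
  proof -
    have "((\<lambda>t. sqrt (\<sigma> * m t)) has_real_derivative
        inverse (sqrt (\<sigma> * m t)) / 2 * (\<sigma> * (c * (- 1 + r t ^ 4 * m t ^ 2)))) (at t within S)"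
      by (rule DERIV_chain2[OF DERIV_real_sqrt[OF pos] DERIV_cmult[OF dm]])
    moreover have "inverse (sqrt (\<sigma> * m t)) / 2 * (\<sigma> * (c * (- 1 + r t ^ 4 * m t ^ 2))) = R'"
      unfolding R_def[symmetric] R'_def m2 using R(1) by (simp add: field_simps)
    ultimately show ?thesis by (simp add: R_def[abs_def])
  qed
  have 1: "((\<lambda>t. u t / R t) has_real_derivative (c * v t * R t - u t * R') / (R t * R t)) (at t within S)"
    by (rule DERIV_divide[OF du dR]) (use R in simp)
  have 2: "((\<lambda>t. v t / R t ^ 2) has_real_derivative
      (c * (- m t * u t + u t ^ 3) * R t ^ 2 - v t * (2 * R t * R')) / (R t ^ 2 * R t ^ 2)) (at t within S)"
    by (rule DERIV_divide[OF dv]) (use R in \<open>auto intro!: derivative_eq_intros dR\<close>)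
  have 3: "((\<lambda>t. 1 / R t ^ 3) has_real_derivative (0 * R t ^ 3 - 1 * (3 * R t ^ 2 * R')) / (R t ^ 3 * R t ^ 3)) (at t within S)"
    by (rule DERIV_divide[OF DERIV_const]) (use R in \<open>auto intro!: derivative_eq_intros dR\<close>)
  have 4: "((\<lambda>t. r t * R t) has_real_derivative 0 * R t + R' * r t) (at t within S)"
    by (rule DERIV_mult[OF dr dR])
  note eqs = R'_def m power2_eq_square power3_eq_cube power4_eq_xxxx
  have e1: "(c * v t * R t - u t * R') / (R t * R t) =
      (c * R t) * (v t / R t ^ 2 + \<sigma> / 2 * (1 / R t ^ 3) * (u t / R t) * (1 - (r t * R t) ^ 4))"
    using R(1) by (simp add: eqs field_simps)
  have e2: "(c * (- m t * u t + u t ^ 3) * R t ^ 2 - v t * (2 * R t * R')) / (R t ^ 2 * R t ^ 2) =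
      (c * R t) * (- \<sigma> * (u t / R t) + (u t / R t) ^ 3 + \<sigma> * (1 / R t ^ 3) * (v t / R t ^ 2) * (1 - (r t * R t) ^ 4))"
    using R(1) by (simp add: eqs field_simps)
  have e3: "(0 * R t ^ 3 - 1 * (3 * R t ^ 2 * R')) / (R t ^ 3 * R t ^ 3) =
      (c * R t) * (\<sigma> * (3 / 2 * (1 / R t ^ 3) ^ 2 * (1 - (r t * R t) ^ 4)))"
    using R(1) by (simp add: eqs field_simps)
  have e4: "0 * R t + R' * r t = (c * R t) * (- \<sigma> / 2 * (r t * R t) * (1 / R t ^ 3) * (1 - (r t * R t) ^ 4))"
    using R(1) by (simp add: eqs field_simps)
  have "((\<lambda>t. (u t / R t, v t / R t ^ 2, 1 / R t ^ 3, r t * R t)) has_vector_derivative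
      (c * R t) *\<^sub>R chart_field \<sigma> (u t / R t, v t / R t ^ 2, 1 / R t ^ 3, r t * R t)) (at t within S)"
    using 1 2 3 4 unfolding e1 e2 e3 e4 chart_field_def split scaleR_Pair has_real_derivative_iff_has_vector_derivative
    by (simp only: real_scaleR_def) (intro has_vector_derivative_Pair)
  moreover have "chart_map \<sigma> (X s) = (u s / R s, v s / R s ^ 2, 1 / R s ^ 3, r s * R s)" for s
    by (simp add: Xeq chart_map_def R_def)
  ultimately show ?thesis by (simp add: R_def m_def)
qed

text \<open>One end of the orbit, where \<open>- \<sigma> * s\<close> is \<bar>s\<bar>. In
  \<open>B\<close> the manifold is the zero set of \<open>g\<close>, and its tangent planes meet the
  (u, v)-plane in lines of slope within 2/5 of \<open>slope\<close>. From \<open>T0\<close> on the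
  orbit lies in \<open>B \<inter> W\<close>; \<open>T\<close> is the reference time at which the
  manifold will be described.\<close>

locale chart_side = hastings_mcleod_solution w for w :: "real \<Rightarrow> real" +
  fixes \<sigma> slope T0 T :: real and p :: state and W B B' :: "state set"
    and g :: "state \<Rightarrow> real" and g' :: "state \<Rightarrow> state \<Rightarrow>\<^sub>L real"
  assumes sgn: "\<sigma> = 1 \<or> \<sigma> = - 1"
    and B_open: "open B" and g_deriv: "\<And>x. x \<in> B \<Longrightarrow> (g has_derivative blinfun_apply (g' x)) (at x)"
    and g'_cont: "continuous_on B g'" and W_iff: "\<And>x. x \<in> B \<Longrightarrow> x \<in> W \<longleftrightarrow> g x = 0"
    and W_inv: "locally_invariant (chart_field \<sigma>) B' W" and B_sub: "B \<subseteq> B'"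
    and slope_v: "\<And>x. x \<in> B \<Longrightarrow> blinfun_apply (g' x) (0, 1, 0, 0) \<noteq> 0"
    and slope_u: "\<And>x. x \<in> B \<Longrightarrow> \<exists>l. \<bar>l - slope\<bar> \<le> 2/5 \<and>
      blinfun_apply (g' x) (1, 0, 0, 0) = - l * blinfun_apply (g' x) (0, 1, 0, 0)"
    and T0: "1 \<le> T0" "T0 < T"
    and orbit: "\<And>s. T0 \<le> - \<sigma> * s \<Longrightarrow> chart_map \<sigma> (hm_orbit w s) \<in> B \<inter> W"
    and p_third: "fst (snd (snd p)) = 0"
begin

definition ch :: "state \<Rightarrow> state" where "ch z = chart_map \<sigma> (Psi z)"

text \<open>\<open>ch z\<close> has to lie in \<open>B\<close> from time \<open>T\<close> on, but
  not before. Writing this as a union of two sets that overlap between \<open>T0\<close> and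
  \<open>T\<close> makes it open.\<close>

definition nbhd :: "state set"
  where "nbhd = {z. - \<sigma> * fst z < T} \<union> {z. T0 < - \<sigma> * fst z \<and> ch z \<in> B}"

definition G :: "real \<Rightarrow> real \<times> real \<times> real \<Rightarrow> real" where "G s x = g (ch (s, x))"

text \<open>The part of the local manifold close to the equilibrium, seen in the rescaling chart:
  the set to be continued by the flow.\<close>

definition target :: "real \<Rightarrow> state set"
  where "target \<rho> = {X \<in> chart_dom \<sigma>. chart_map \<sigma> X \<in> W \<inter> ball p \<rho>}"

lemma Psi_in_dom: "0 < - \<sigma> * fst z \<longleftrightarrow> Psi z \<in> chart_dom \<sigma>"
  using Psi_mu[of "fst z" "snd z"] by (simp add: chart_dom_def)

lemma Psi_cont: "continuous_on S Psi"
  using C1_on_imp_continuous_on[OF Psi_C1] continuous_on_subset by blast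

lemma ch_C1: "C1_on {z. 0 < - \<sigma> * fst z} ch"
  unfolding ch_def[abs_def]
  by (rule C1_on_compose[OF C1_on_subset[OF Psi_C1] chart_map_C1]) (use Psi_in_dom in auto)

lemma ch_cont: "continuous_on {z. 0 < - \<sigma> * fst z} ch"
  by (rule C1_on_imp_continuous_on[OF ch_C1])

lemma ch_vimage_open:
  assumes "open E" "0 \<le> c" shows "open {z. c < - \<sigma> * fst z \<and> ch z \<in> E}"
proof -
  have o: "open {z::state. c < - \<sigma> * fst z}" by (intro open_Collect_less continuous_intros)
  have "continuous_on {z. c < - \<sigma> * fst z} ch"
    by (rule continuous_on_subset[OF ch_cont]) (use assms in auto)
  from continuous_open_preimage[OF this o assms(1)] show ?thesis
    by (simp add: Collect_conj_eq vimage_def)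
qed

lemma nbhd_open: "open nbhd"
  unfolding nbhd_def
  by (intro open_Un ch_vimage_open B_open open_Collect_less continuous_intros) (use T0 in auto)

lemma ch_axis: "T0 \<le> - \<sigma> * s \<Longrightarrow> ch (s, 0) \<in> B \<inter> W"
  using orbit by (simp add: ch_def Psi_axis)

lemma axis_nbhd: "(s, 0) \<in> nbhd"
  using ch_axis[of s] T0 by (auto simp: nbhd_def)

lemma nbhd_ch: "z \<in> nbhd \<Longrightarrow> T \<le> - \<sigma> * fst z \<Longrightarrow> ch z \<in> B"
  by (auto simp: nbhd_def)

lemma ch_line:
  assumes "(s, x) \<in> good" "0 < - \<sigma> * s"
  shows "((\<lambda>s. ch (s, x)) has_vector_derivative
    (1 / lapse (Psi (s, x)) * sqrt (- \<sigma> * s)) *\<^sub>R chart_field \<sigma> (ch (s, x))) (at s within S)"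
proof -
  have X: "Psi (s, x) \<in> chart_dom \<sigma>" using assms(2) Psi_in_dom[of "(s, x)"] by simp
  from chart_map_conjugates[OF sgn, of "\<lambda>s. Psi (s, x)", OF X has_vector_derivative_at_within[OF Psi_line[OF assms(1)]]]
  show ?thesis by (simp add: ch_def Psi_mu)
qed

lemma lapse_cont: "continuous_on S lapse"
  unfolding lapse_def split_beta by (intro continuous_intros)

text \<open>A line with fixed \<open>x\<close> is, up to a positive change of time, an orbit of the
  chart field that stays in \<open>B \<subseteq> B'\<close>, so local invariance applies.\<close>

lemma W_along_line:
  assumes seg: "\<And>\<tau>. \<tau> \<in> closed_segment s s' \<Longrightarrow> (\<tau>, x) \<in> nbhd \<inter> good \<and> T \<le> - \<sigma> * \<tau>"
    and "ch (s, x) \<in> W"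
  shows "ch (s', x) \<in> W"
proof -
  let ?a = "min s s'" let ?b = "max s s'"
  have ab: "closed_segment s s' = {?a..?b}" by (auto simp: closed_segment_eq_real_ivl)
  show ?thesis
  proof (rule locally_invariant_reparametrized[OF W_inv, where y = "\<lambda>s. ch (s, x)" and a = ?a and b = ?b
        and h = "\<lambda>s. 1 / lapse (Psi (s, x)) * sqrt (- \<sigma> * s)"])
    fix t assume "t \<in> {?a..?b}"
    then have t: "(t, x) \<in> nbhd" "(t, x) \<in> good" "T \<le> - \<sigma> * t" using seg ab by auto
    then have t0: "0 < - \<sigma> * t" using T0 by simp
    show "((\<lambda>s. ch (s, x)) has_vector_derivative
      (1 / lapse (Psi (t, x)) * sqrt (- \<sigma> * t)) *\<^sub>R chart_field \<sigma> (ch (t, x))) (at t within {?a..?b})"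
      by (rule ch_line[OF t(2) t0])
    show "0 < 1 / lapse (Psi (t, x)) * sqrt (- \<sigma> * t)"
      using lapse_pos[OF t(2)] t0 by simp
  next
    have "continuous_on {?a..?b} (\<lambda>s. Psi (s, x))"
      by (rule continuous_on_compose2[OF Psi_cont[of UNIV]]) (auto intro!: continuous_intros)
    then have "continuous_on {?a..?b} (\<lambda>s. lapse (Psi (s, x)))"
      by (rule continuous_on_compose2[OF lapse_cont[of UNIV]]) auto
    moreover have "\<forall>t\<in>{?a..?b}. lapse (Psi (t, x)) \<noteq> 0"
      using lapse_pos seg ab by (metis IntD2 less_irrefl)
    ultimately show "continuous_on {?a..?b} (\<lambda>s. 1 / lapse (Psi (s, x)) * sqrt (- \<sigma> * s))"
      by (intro continuous_intros)
    show "(\<lambda>s. ch (s, x)) ` {?a..?b} \<subseteq> B'"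
    proof
      fix X assume "X \<in> (\<lambda>s. ch (s, x)) ` {?a..?b}"
      then obtain t where "X = ch (t, x)" "t \<in> closed_segment s s'" using ab by auto
      then show "X \<in> B'" using nbhd_ch[of "(t, x)"] seg[of t] B_sub by auto
    qed
  qed (use assms in auto)
qed

text \<open>The functions \<open>G s\<close> differ for different \<open>s\<close>, but invariance
  in both time directions makes their zero sets agree along the segment. This is why the manifold
  can be described at the single time \<open>T\<close>.\<close>

lemma G_zero_along_line:
  assumes seg: "\<And>\<tau>. \<tau> \<in> closed_segment s s' \<Longrightarrow> (\<tau>, x) \<in> nbhd \<inter> good \<and> T \<le> - \<sigma> * \<tau>"
  shows "G s x = 0 \<longleftrightarrow> G s' x = 0"
proof -
  have "ch (s, x) \<in> B" "ch (s', x) \<in> B" using seg[of s] seg[of s'] nbhd_ch by auto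
  moreover have "ch (s, x) \<in> W \<longleftrightarrow> ch (s', x) \<in> W"
    using W_along_line[of s s' x] W_along_line[of s' s x] seg by (auto simp: closed_segment_commute)
  ultimately show ?thesis by (simp add: G_def W_iff)
qed

definition G_dom :: "real \<Rightarrow> (real \<times> real \<times> real) set" where "G_dom s = {x. ch (s, x) \<in> B}"

lemma G_dom_open: assumes "0 < - \<sigma> * s" shows "open (G_dom s)"
proof -
  have "open ((\<lambda>x. (s, x)) -` {z. 0 < - \<sigma> * fst z \<and> ch z \<in> B})"
    by (intro open_vimage ch_vimage_open B_open continuous_intros) simp
  then show ?thesis using assms by (simp add: G_dom_def vimage_def)
qed

lemma G_C1: assumes "0 < - \<sigma> * s" shows "C1_on (G_dom s) (G s)"
proof -
  have 1: "C1_on (G_dom s) (\<lambda>x. (s, x))" by (intro C1_intros)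
  have 2: "C1_on (G_dom s) (\<lambda>x. ch (s, x))"
    by (rule C1_on_compose[OF 1 ch_C1]) (use assms in auto)
  have 3: "C1_on B g" by (rule C1_onI[OF g_deriv g'_cont])
  show ?thesis unfolding G_def[abs_def] by (rule C1_on_compose[OF 2 3]) (auto simp: G_dom_def)
qed

lemma G_axis: "T0 \<le> - \<sigma> * s \<Longrightarrow> 0 \<in> G_dom s \<and> G s 0 = 0"
  using ch_axis[of s] W_iff[of "ch (s, 0)"] by (auto simp: G_dom_def G_def)

text \<open>On vectors with vanishing \<mu>- and r-component the differential of
  \<open>chart_map\<close> divides u by \<open>R\<close> and v by \<open>R^2\<close>, with
  \<open>R = sqrt (- \<sigma> * s)\<close>. A kernel vector therefore satisfies b = l R a: its slope
  is the chart slope multiplied by \<open>R\<close>.\<close>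

lemma G_deriv_axis:
  assumes s: "T0 \<le> - \<sigma> * s"
  obtains \<beta> l where "\<beta> \<noteq> 0" "\<bar>l - slope\<bar> \<le> 2/5"
    "\<And>L D h a b. (G s has_derivative L) (at 0) \<Longrightarrow> ((\<lambda>x. Psi (s, x)) has_derivative D) (at 0) \<Longrightarrow>
      D h = (a, b, 0, 0) \<Longrightarrow> L h = \<beta> * (b / (- \<sigma> * s) - l * (a / sqrt (- \<sigma> * s)))"
proof -
  let ?X = "Psi (s, 0)" let ?R = "sqrt (- \<sigma> * s)"
  have s0: "0 < - \<sigma> * s" using s T0 by simp
  then have X: "?X \<in> chart_dom \<sigma>" using Psi_in_dom[of "(s, 0)"] by simp
  have c: "ch (s, 0) \<in> B" using ch_axis[OF s] by simp
  let ?g = "blinfun_apply (g' (ch (s, 0)))"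
  obtain l where l: "\<bar>l - slope\<bar> \<le> 2/5" "?g (1, 0, 0, 0) = - l * ?g (0, 1, 0, 0)" using slope_u[OF c] by blast
  obtain K where K: "(chart_map \<sigma> has_derivative K) (at ?X)"
    using chart_map_C1 X by (metis C1_onE)
  have Kab: "K (a, b, 0, 0) = (a / ?R, b / ?R ^ 2, 0, 0)" for a b
  proof -
    let ?v = "(a, b, 0, 0) :: state"
    have "((\<lambda>t. ?X + t *\<^sub>R ?v) has_vector_derivative ?v) (at 0)" by (auto intro!: derivative_eq_intros simp: zero_prod_def)
    then have "((chart_map \<sigma> \<circ> (\<lambda>t. ?X + t *\<^sub>R ?v)) has_vector_derivative K ?v) (at 0)"
      by (rule vector_derivative_diff_chain_within) (rule has_derivative_at_withinI, use K in \<open>simp only: scaleR_zero_left add_0_right\<close>)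
    moreover have "chart_map \<sigma> \<circ> (\<lambda>t. ?X + t *\<^sub>R ?v) = (\<lambda>t. chart_map \<sigma> ?X + t *\<^sub>R (a / ?R, b / ?R ^ 2, 0, 0))"
      by (simp add: fun_eq_iff Psi_axis hm_orbit_def chart_map_def add_divide_distrib)
    moreover have "((\<lambda>t. chart_map \<sigma> ?X + t *\<^sub>R (a / ?R, b / ?R ^ 2, 0::real, 0::real)) has_vector_derivative (a / ?R, b / ?R ^ 2, 0, 0)) (at 0)"
      by (auto intro!: derivative_eq_intros simp: zero_prod_def)
    ultimately show ?thesis using vector_derivative_unique_at by metis
  qed
  show thesis
  proof (rule that[OF slope_v[OF c] l(1)])
    fix L D h a b assume L: "(G s has_derivative L) (at 0)" and D: "((\<lambda>x. Psi (s, x)) has_derivative D) (at 0)"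
      and h: "D h = (a, b, 0, 0)"
    have "((chart_map \<sigma> \<circ> (\<lambda>x. Psi (s, x))) has_derivative K \<circ> D) (at 0)"
      by (rule diff_chain_at[OF D K])
    then have "((g \<circ> (chart_map \<sigma> \<circ> (\<lambda>x. Psi (s, x)))) has_derivative ?g \<circ> (K \<circ> D)) (at 0)"
      by (rule diff_chain_at) (use g_deriv[OF c] in \<open>simp add: ch_def\<close>)
    then have "L = ?g \<circ> (K \<circ> D)"
      using L has_derivative_unique by (simp add: G_def[abs_def] ch_def o_def) blast
    then have "L h = ?g (a / ?R, b / ?R ^ 2, 0, 0)" using h Kab by simp
    also have "(a / ?R, b / ?R ^ 2, 0, 0) = (a / ?R) *\<^sub>R (1, 0, 0, 0) + (b / ?R ^ 2) *\<^sub>R (0, 1, 0, 0 :: real)" by simp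
    also have "?g \<dots> = (a / ?R) * ?g (1, 0, 0, 0) + (b / ?R ^ 2) * ?g (0, 1, 0, 0)"
      by (simp only: blinfun.add_right blinfun.scaleR_right real_scaleR_def)
    also have "\<dots> = ?g (0, 1, 0, 0) * (b / (- \<sigma> * s) - l * (a / ?R))"
      using s0 unfolding l(2) by (simp add: algebra_simps)
    finally show "L h = ?g (0, 1, 0, 0) * (b / (- \<sigma> * s) - l * (a / ?R))" .
  qed
qed

lemma end_time: "- \<sigma> * (- \<sigma> * T) = T"
  using sgn by auto

text \<open>The zero set at time \<open>T\<close> is contained in the one at time \<open>s\<close>
  near the axis, so kernels can be compared; \<open>h'\<close> is there to make \<open>L\<close>
  onto. One vector in the kernel at \<open>T\<close> thus has controlled slope at all later
  times.\<close>

lemma G_kernel_transport: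
  assumes s: "T \<le> - \<sigma> * s" and L: "(G (- \<sigma> * T) has_derivative L) (at 0)" "L h = 0" "L h' \<noteq> 0"
    and L': "(G s has_derivative L') (at 0)"
  shows "L' h = 0"
proof -
  let ?s = "- \<sigma> * T"
  define Y where "Y = G_dom ?s \<inter> {x. \<forall>\<tau>\<in>closed_segment ?s s. (\<tau>, x) \<in> nbhd \<inter> good}"
  have sT: "0 < - \<sigma> * ?s" "T0 \<le> - \<sigma> * ?s" unfolding end_time using T0 by auto
  have "open {x. \<forall>\<tau>\<in>closed_segment ?s s. (\<lambda>z. z) (\<tau>, x) \<in> nbhd \<inter> good}"
    by (rule open_forall_compact) (auto intro: nbhd_open good_open open_Int continuous_intros)
  then have Y: "open Y" unfolding Y_def by (intro open_Int G_dom_open[OF sT(1)]) simp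
  have 0: "0 \<in> Y" unfolding Y_def using G_axis[OF sT(2)] axis_nbhd axis_good by auto
  obtain G' where G': "\<And>x. x \<in> G_dom ?s \<Longrightarrow> (G ?s has_derivative blinfun_apply (G' x)) (at x)" "continuous_on (G_dom ?s) G'"
    using G_C1[OF sT(1)] by (metis C1_onE)
  have LG: "L = blinfun_apply (G' 0)" using has_derivative_unique[OF L(1) G'(1)] G_axis[OF sT(2)] by blast
  have seg: "T \<le> - \<sigma> * \<tau>" if "\<tau> \<in> closed_segment ?s s" for \<tau>
    using that s sgn by (auto simp: closed_segment_eq_real_ivl split: if_splits)
  show ?thesis
  proof (rule level_set_kernel_le[OF Y 0, of "G ?s" G'])
    show "(G ?s has_derivative blinfun_apply (G' x)) (at x)" if "x \<in> Y" for x using G'(1) that by (auto simp: Y_def)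
    show "continuous_on Y G'" by (rule continuous_on_subset[OF G'(2)]) (auto simp: Y_def)
    show "surj (blinfun_apply (G' 0))"
    proof (rule surjI[of _ "\<lambda>c. (c / L h') *\<^sub>R h'"])
      show "blinfun_apply (G' 0) ((c / L h') *\<^sub>R h') = c" for c
        using L(3) by (simp add: LG blinfun.scaleR_right)
    qed
    show "G ?s 0 = 0" using G_axis[OF sT(2)] by simp
    show "(G s has_derivative L') (at 0)" by (rule L')
    show "G s y = 0" if "y \<in> Y" "G ?s y = 0" for y
      using G_zero_along_line[of ?s s y] seg that by (auto simp: Y_def)
    show "blinfun_apply (G' 0) h = 0" using L(2) LG by simp
  qed
qed

text \<open>The third chart coordinate is \<bar>s\<bar>^(-3/2) and is bounded by the distance to
  \<open>p\<close>, so a small ball forces a late time.\<close>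

lemma target_time:
  assumes \<rho>: "\<rho> \<le> 1 / sqrt T ^ 3" and z: "Psi z \<in> target \<rho>"
  shows "T < - \<sigma> * fst z"
proof -
  let ?R = "sqrt (- \<sigma> * fst z)"
  have d: "0 < - \<sigma> * fst z" using z Psi_in_dom by (simp add: target_def)
  have "fst (snd (snd (ch z))) = 1 / ?R ^ 3"
    using Psi_mu[of "fst z" "snd z"] by (simp add: ch_def chart_map_def split_beta)
  moreover have "fst (snd (snd (ch z))) \<le> dist (ch z) p"
  proof -
    have "dist (fst (snd (snd (ch z)))) (fst (snd (snd p))) \<le> dist (ch z) p"
      using dist_fst_le[of "snd (snd (ch z))" "snd (snd p)"] dist_snd_le[of "snd (ch z)" "snd p"]
        dist_snd_le[of "ch z" p] by linarith
    then show ?thesis using p_third by (simp add: dist_real_def)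
  qed
  moreover have "dist (ch z) p < \<rho>" using z by (simp add: target_def ch_def dist_commute)
  ultimately have "1 / ?R ^ 3 < 1 / sqrt T ^ 3" using \<rho> by linarith
  moreover have "0 < ?R" "0 < sqrt T" using d T0 by auto
  ultimately have "sqrt T ^ 3 < ?R ^ 3" by (simp add: field_simps)
  then have "sqrt T < ?R" by (rule power_less_imp_less_base) (use d in simp)
  then show ?thesis by simp
qed

lemma segment_to_end_time:
  assumes s: "T \<le> - \<sigma> * s" and \<tau>: "\<tau> \<in> closed_segment s (- \<sigma> * T)"
  shows "T \<le> - \<sigma> * \<tau> \<and> \<tau> \<in> closed_segment 0 s"
  using sgn s \<tau> T0 by (auto simp: closed_segment_eq_real_ivl split: if_splits)

text \<open>\<open>Om\<close> is closed under moving a point towards time 0, so the segment down to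
  the reference time stays inside it and zeros of \<open>G\<close> can be carried along.\<close>

lemma target_G_zero:
  assumes Om: "Om \<subseteq> nbhd \<inter> good" "\<And>s x \<tau>. (s, x) \<in> Om \<Longrightarrow> \<tau> \<in> closed_segment 0 s \<Longrightarrow> (\<tau>, x) \<in> Om"
    and \<rho>: "\<rho> \<le> 1 / sqrt T ^ 3" and z: "(s, x) \<in> Om"
  shows "Psi (s, x) \<in> target \<rho> \<Longrightarrow> G (- \<sigma> * T) x = 0"
    and "T < - \<sigma> * s \<Longrightarrow> ch (s, x) \<in> ball p \<rho> \<Longrightarrow> G (- \<sigma> * T) x = 0 \<Longrightarrow> Psi (s, x) \<in> target \<rho>"
proof -
  have eq: "G s x = 0 \<longleftrightarrow> G (- \<sigma> * T) x = 0" if "T \<le> - \<sigma> * s"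
    by (rule G_zero_along_line) (use segment_to_end_time[OF that] Om z in blast)
  show "Psi (s, x) \<in> target \<rho> \<Longrightarrow> G (- \<sigma> * T) x = 0"
  proof -
    assume t: "Psi (s, x) \<in> target \<rho>"
    have Ts: "T < - \<sigma> * s" using target_time[OF \<rho> t] by simp
    have "ch (s, x) \<in> B" using nbhd_ch[of "(s, x)"] Om(1) z Ts by auto
    moreover have "ch (s, x) \<in> W" using t by (simp add: target_def ch_def)
    ultimately show ?thesis using eq Ts W_iff by (simp add: G_def)
  qed
  show "T < - \<sigma> * s \<Longrightarrow> ch (s, x) \<in> ball p \<rho> \<Longrightarrow> G (- \<sigma> * T) x = 0 \<Longrightarrow> Psi (s, x) \<in> target \<rho>"
  proof -
    assume a: "T < - \<sigma> * s" "ch (s, x) \<in> ball p \<rho>" "G (- \<sigma> * T) x = 0"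
    have "ch (s, x) \<in> B" using nbhd_ch[of "(s, x)"] Om(1) z a(1) by auto
    then have "ch (s, x) \<in> W" using eq a W_iff by (simp add: G_def)
    moreover have "Psi (s, x) \<in> chart_dom \<sigma>" using Psi_in_dom[of "(s, x)"] a(1) T0 by simp
    ultimately show ?thesis using a(2) by (simp add: target_def ch_def)
  qed
qed

lemma target_relatively_open:
  assumes Om: "Om \<subseteq> nbhd \<inter> good" "\<And>s x \<tau>. (s, x) \<in> Om \<Longrightarrow> \<tau> \<in> closed_segment 0 s \<Longrightarrow> (\<tau>, x) \<in> Om"
    and \<rho>: "\<rho> \<le> 1 / sqrt T ^ 3" and z: "Psi z \<in> target \<rho>"
  shows "\<exists>H. open H \<and> z \<in> H \<and> (\<forall>y\<in>H \<inter> Om. G (- \<sigma> * T) (snd y) = 0 \<longrightarrow> Psi y \<in> target \<rho>)"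
proof (intro exI conjI ballI impI)
  let ?H = "{z. T < - \<sigma> * fst z \<and> ch z \<in> ball p \<rho>}"
  show "open ?H" by (rule ch_vimage_open) (use T0 in auto)
  show "z \<in> ?H" using target_time[OF \<rho> z] z by (simp add: target_def ch_def)
  fix y assume "y \<in> ?H \<inter> Om" "G (- \<sigma> * T) (snd y) = 0"
  then show "Psi y \<in> target \<rho>"
    using target_G_zero(2)[OF Om \<rho>, where s = "fst y" and x = "snd y"] by simp
qed

end

section \<open>Continuation by the flow in straightened coordinates\<close>

context hastings_mcleod_solution
begin

lemma Psi_inv_K2:
  assumes "z \<in> good" "(Psi_inv has_derivative D) (at (Psi z))"
  shows "D (K2_field (Psi z)) = (lapse (Psi z), 0)"
proof -
  obtain s x where z: "z = (s, x)" by (cases z)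
  have "((Psi_inv \<circ> (\<lambda>s. Psi (s, x))) has_vector_derivative D ((1 / lapse (Psi z)) *\<^sub>R K2_field (Psi z))) (at s)"
    using Psi_line[of s x] assms by (intro vector_derivative_diff_chain_within) (auto simp: z intro: has_derivative_at_withinI)
  moreover have "Psi_inv \<circ> (\<lambda>s. Psi (s, x)) = (\<lambda>s. (s, x))" by auto
  moreover have "((\<lambda>s. (s, x)) has_vector_derivative (1, 0)) (at s)"
    by (intro has_vector_derivative_Pair has_vector_derivative_id has_vector_derivative_const)
  ultimately have "D ((1 / lapse (Psi z)) *\<^sub>R K2_field (Psi z)) = (1, 0)"
    using vector_derivative_unique_at by metis
  then have "(1 / lapse (Psi z)) *\<^sub>R D (K2_field (Psi z)) = (1, 0)"
    by (simp add: linear_scale[OF has_derivative_linear[OF assms(2)]])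
  then have "lapse (Psi z) *\<^sub>R (1 / lapse (Psi z)) *\<^sub>R D (K2_field (Psi z)) = lapse (Psi z) *\<^sub>R (1, 0)" by simp
  then show ?thesis using lapse_pos[OF assms(1)] by simp
qed

text \<open>In straightened coordinates the field is (\<open>lapse\<close>, 0). A solution thus has
  constant \<open>x\<close>, and its time component has a connected image, which contains the whole
  segment between any two of its values. Conversely a segment becomes a solution after a change of
  time.\<close>

lemma flow_continuation_iff:
  assumes N: "N \<subseteq> Psi ` good"
  shows "Psi (s, x) \<in> flow_continuation K2_field N S \<longleftrightarrow>
    (\<exists>s'. Psi (s', x) \<in> S \<and> (\<forall>\<tau>\<in>closed_segment s s'. Psi (\<tau>, x) \<in> N))"
proof
  have good: "z \<in> good" if "Psi z \<in> N" for z
    using that N by (metis Psi_inverse(1) imageE subsetD)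
  {
    assume "Psi (s, x) \<in> flow_continuation K2_field N S"
    then obtain y a b t0 t where y: "solution_on K2_field y a b" "y ` {a..b} \<subseteq> N"
      "t0 \<in> {a..b}" "t \<in> {a..b}" "y t0 \<in> S" "y t = Psi (s, x)"
      unfolding flow_continuation_def by blast
    define P where "P u = Psi_inv (y u)" for u
    have yP: "y u = Psi (P u)" for u by (simp add: P_def)
    have P: "(P has_vector_derivative (lapse (y u), 0)) (at u within {a..b})" if u: "u \<in> {a..b}" for u
    proof -
      obtain D where D: "(Psi_inv has_derivative D) (at (y u))"
        using Psi_inv_C1 by (metis C1_onE UNIV_I)
      have "y u \<in> N" using y(2) u by auto
      then have "P u \<in> good" using good yP by simp
      then have "D (K2_field (y u)) = (lapse (y u), 0)" using Psi_inv_K2[of "P u" D] D yP by simp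
      moreover have "((Psi_inv \<circ> y) has_vector_derivative D (K2_field (y u))) (at u within {a..b})"
        using y(1) u D unfolding solution_on_def
        by (intro vector_derivative_diff_chain_within) (auto intro: has_derivative_at_withinI)
      ultimately show ?thesis by (simp add: P_def[abs_def] o_def)
    qed
    have z: "((\<lambda>u. snd (P u)) has_vector_derivative 0) (at u within {a..b})" if "u \<in> {a..b}" for u
      using bounded_linear.has_vector_derivative[OF bounded_linear_snd P[OF that]] by simp
    obtain c where c: "\<And>u. u \<in> {a..b} \<Longrightarrow> snd (P u) = c"
      by (rule has_vector_derivative_zero_constant[OF convex_real_interval(5) z]) (simp, blast)
    have Pt: "P t = (s, x)" using y(6) by (simp add: P_def)
    then have cx: "c = x" using c[OF y(4)] by simp
    have "continuous_on {a..b} P"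
      using P by (meson continuous_on_eq_continuous_within has_vector_derivative_continuous)
    then have "connected ((\<lambda>u. fst (P u)) ` {a..b})"
      by (intro connected_continuous_image continuous_intros) auto
    then have "convex ((\<lambda>u. fst (P u)) ` {a..b})" using is_interval_convex_1 is_interval_connected_1 by blast
    moreover have "s \<in> (\<lambda>u. fst (P u)) ` {a..b}" using y(4) Pt by (intro image_eqI[of _ _ t]) auto
    moreover have "fst (P t0) \<in> (\<lambda>u. fst (P u)) ` {a..b}" using y(3) by blast
    ultimately have "closed_segment s (fst (P t0)) \<subseteq> (\<lambda>u. fst (P u)) ` {a..b}"
      by (rule closed_segment_subset[rotated 2])
    moreover have "Psi (fst (P u), x) \<in> N" if "u \<in> {a..b}" for u
    proof -
      have "(fst (P u), x) = P u" using c[OF that] cx by (metis prod.collapse)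
      moreover have "y u \<in> N" using y(2) that by blast
      ultimately show ?thesis using yP[of u] by simp
    qed
    ultimately have "\<forall>\<tau>\<in>closed_segment s (fst (P t0)). Psi (\<tau>, x) \<in> N" by auto
    moreover have "Psi (fst (P t0), x) \<in> S"
      using c[OF y(3)] cx yP[of t0] y(5) by (metis prod.collapse)
    ultimately show "\<exists>s'. Psi (s', x) \<in> S \<and> (\<forall>\<tau>\<in>closed_segment s s'. Psi (\<tau>, x) \<in> N)" by blast
  }
  assume "\<exists>s'. Psi (s', x) \<in> S \<and> (\<forall>\<tau>\<in>closed_segment s s'. Psi (\<tau>, x) \<in> N)"
  then obtain s' where s': "Psi (s', x) \<in> S" "\<And>\<tau>. \<tau> \<in> closed_segment s s' \<Longrightarrow> Psi (\<tau>, x) \<in> N" by blast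
  let ?a = "min s s'" let ?b = "max s s'"
  have ab: "closed_segment s s' = {?a..?b}" by (auto simp: closed_segment_eq_real_ivl)
  have g: "(\<tau>, x) \<in> good" if "\<tau> \<in> {?a..?b}" for \<tau> using good s'(2) that ab by simp
  have cP: "continuous_on {?a..?b} (\<lambda>s. Psi (s, x))"
    by (rule continuous_on_compose2[OF C1_on_imp_continuous_on[OF Psi_C1]]) (auto intro!: continuous_intros)
  have "continuous_on UNIV lapse" unfolding lapse_def split_beta by (intro continuous_intros)
  then have cl: "continuous_on {?a..?b} (\<lambda>s. lapse (Psi (s, x)))"
    by (rule continuous_on_compose2[OF _ cP]) auto
  obtain z d where z: "solution_on K2_field z 0 d" "z ` {0..d} = (\<lambda>s. Psi (s, x)) ` {?a..?b}"
  proof (rule reparametrize[of ?a ?b "\<lambda>s. Psi (s, x)" "\<lambda>s. 1 / lapse (Psi (s, x))" K2_field])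
    show "((\<lambda>s. Psi (s, x)) has_vector_derivative (1 / lapse (Psi (t, x))) *\<^sub>R K2_field (Psi (t, x))) (at t within {?a..?b})"
      if "t \<in> {?a..?b}" for t
      by (rule has_vector_derivative_at_within[OF Psi_line[OF g[OF that]]])
    show "0 < 1 / lapse (Psi (t, x))" if "t \<in> {?a..?b}" for t using lapse_pos[OF g[OF that]] by simp
    have "\<forall>t\<in>{?a..?b}. lapse (Psi (t, x)) \<noteq> 0" using lapse_pos g by (metis less_irrefl)
    then show "continuous_on {?a..?b} (\<lambda>s. 1 / lapse (Psi (s, x)))" by (intro continuous_intros cl)
  qed auto
  have "Psi (s, x) \<in> z ` {0..d}" "Psi (s', x) \<in> z ` {0..d}" unfolding z(2) by auto
  then obtain t0 t1 where t: "t0 \<in> {0..d}" "t1 \<in> {0..d}" "Psi (s, x) = z t0" "Psi (s', x) = z t1" by blast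
  have "z ` {0..d} \<subseteq> N" unfolding z(2) using s'(2) ab by auto
  then show "Psi (s, x) \<in> flow_continuation K2_field N S"
    unfolding flow_continuation_def using z(1) t s'(1)
    by (intro CollectI exI[of _ z] exI[of _ 0] exI[of _ d] exI[of _ t1] exI[of _ t0]) auto
qed

text \<open>A continued point reaches \<open>S\<close> at some time \<open>s'\<close>, and nearby
  points of the zero set are joined to \<open>S\<close> at the same \<open>s'\<close>:
  \<open>V1\<close> keeps their segments up to \<open>s'\<close> inside \<open>N\<close>, an open
  condition by compactness, and \<open>V2\<close> makes them arrive in \<open>H\<close>, where
  \<open>\<gamma> = 0\<close> implies membership in \<open>S\<close>.\<close>

lemma flow_continuation_level:
  assumes Om: "Om \<subseteq> good" and N: "open N" "N \<subseteq> Psi ` Om"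
    and S0: "\<And>s x. (s, x) \<in> Om \<Longrightarrow> Psi (s, x) \<in> S \<Longrightarrow> \<gamma> x = 0"
    and S1: "\<And>z. Psi z \<in> S \<Longrightarrow> \<exists>H. open H \<and> z \<in> H \<and> (\<forall>y\<in>H \<inter> Om. \<gamma> (snd y) = 0 \<longrightarrow> Psi y \<in> S)"
    and X: "X \<in> flow_continuation K2_field N S"
  shows "X \<in> N" "\<gamma> (snd (Psi_inv X)) = (0::real)"
    "\<exists>V. open V \<and> X \<in> V \<and> (\<forall>Y\<in>V. \<gamma> (snd (Psi_inv Y)) = 0 \<longrightarrow> Y \<in> flow_continuation K2_field N S)"
proof -
  have Ng: "N \<subseteq> Psi ` good" using N(2) Om by blast
  have Om': "z \<in> Om" if "Psi z \<in> N" for z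
    using that N(2) by (metis Psi_inverse(1) imageE subsetD)
  obtain s x where sx: "Psi_inv X = (s, x)" by (cases "Psi_inv X")
  then have Xeq: "X = Psi (s, x)" by (metis Psi_inverse(2))
  obtain s' where s': "Psi (s', x) \<in> S" "\<And>\<tau>. \<tau> \<in> closed_segment s s' \<Longrightarrow> Psi (\<tau>, x) \<in> N"
    using X unfolding Xeq flow_continuation_iff[OF Ng] by blast
  show "X \<in> N" using s'(2)[of s] Xeq by simp
  have "\<gamma> x = 0" by (rule S0[OF _ s'(1)]) (use s'(2)[of s'] Om' in simp)
  then show "\<gamma> (snd (Psi_inv X)) = 0" by (simp add: sx)
  obtain H where H: "open H" "(s', x) \<in> H" "\<And>y. y \<in> H \<Longrightarrow> y \<in> Om \<Longrightarrow> \<gamma> (snd y) = 0 \<Longrightarrow> Psi y \<in> S"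
    using S1[OF s'(1)] by blast
  define V1 where "V1 = {z::state. \<forall>\<tau>\<in>{0..1}. (\<lambda>(\<tau>, z). Psi ((1 - \<tau>) * fst z + \<tau> * s', snd z)) (\<tau>, z) \<in> N}"
  have V1: "open V1" unfolding V1_def
  proof (rule open_forall_compact[OF _ N(1)])
    show "continuous_on UNIV (\<lambda>(\<tau>, z). Psi ((1 - \<tau>) * fst z + \<tau> * s', snd z))"
      unfolding split_beta
      by (rule continuous_on_compose2[OF C1_on_imp_continuous_on[OF Psi_C1]]) (auto intro!: continuous_intros)
  qed simp
  have seg: "closed_segment r s' = (\<lambda>\<tau>. (1 - \<tau>) * r + \<tau> * s') ` {0..1}" for r
    by (auto simp: closed_segment_def image_iff)
  have V1_iff: "z \<in> V1 \<longleftrightarrow> (\<forall>\<tau>\<in>closed_segment (fst z) s'. Psi (\<tau>, snd z) \<in> N)" for z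
    unfolding seg V1_def by auto
  define V2 where "V2 = (\<lambda>z::state. (s', snd z)) -` H"
  have V2: "open V2" unfolding V2_def by (intro open_vimage H(1) continuous_intros)
  show "\<exists>V. open V \<and> X \<in> V \<and> (\<forall>Y\<in>V. \<gamma> (snd (Psi_inv Y)) = 0 \<longrightarrow> Y \<in> flow_continuation K2_field N S)"
  proof (intro exI[of _ "Psi_inv -` (V1 \<inter> V2)"] conjI ballI impI)
    show "open (Psi_inv -` (V1 \<inter> V2))"
      by (intro open_vimage open_Int V1 V2 C1_on_imp_continuous_on[OF Psi_inv_C1])
    show "X \<in> Psi_inv -` (V1 \<inter> V2)" using s'(2) H(2) by (simp add: sx V1_iff V2_def)
    fix Y assume Y: "Y \<in> Psi_inv -` (V1 \<inter> V2)" "\<gamma> (snd (Psi_inv Y)) = 0"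
    obtain r x' where rx: "Psi_inv Y = (r, x')" by (cases "Psi_inv Y")
    then have Yeq: "Y = Psi (r, x')" by (metis Psi_inverse(2))
    have a: "\<And>\<tau>. \<tau> \<in> closed_segment r s' \<Longrightarrow> Psi (\<tau>, x') \<in> N" "(s', x') \<in> H"
      using Y(1) by (auto simp: rx V1_iff V2_def)
    have "(s', x') \<in> Om" using a(1)[of s'] Om' by simp
    then have "Psi (s', x') \<in> S" using H(3)[OF a(2)] Y(2) by (simp add: rx)
    then show "Y \<in> flow_continuation K2_field N S"
      unfolding Yeq flow_continuation_iff[OF Ng] using a(1) by blast
  qed
qed

lemma orbit_in_flow_continuation:
  assumes "N \<subseteq> Psi ` good" "range (hm_orbit w) \<subseteq> N" "hm_orbit w s' \<in> S"
  shows "range (hm_orbit w) \<subseteq> flow_continuation K2_field N S"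
proof
  fix X assume "X \<in> range (hm_orbit w)"
  then obtain s where X: "X = hm_orbit w s" by blast
  have "Psi (s, 0) \<in> flow_continuation K2_field N S"
    unfolding flow_continuation_iff[OF assms(1)] using assms(2,3) by (auto simp: Psi_axis)
  then show "X \<in> flow_continuation K2_field N S" by (simp add: X Psi_axis)
qed

end

section \<open>Local data at the equilibria\<close>

lemma kappa12_image: "kappa12 ` (C \<inter> dom12) = {X \<in> chart_dom 1. chart_map 1 X \<in> C}"
proof -
  have powrs: "e powr (- 1 / 3) = 1 / e powr (1 / 3)" "e powr (- 2 / 3) = 1 / (e powr (1 / 3)) ^ 2"
    "(e powr (1 / 3)) ^ 3 = e" if "0 < e" for e :: real
    using that by (auto simp: powr_minus_divide[of e "1/3", simplified] powr_minus_divide[of e "2/3", simplified]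
        powr_powr simp flip: powr_realpow)
  have 1: "kappa12 z \<in> chart_dom 1 \<and> chart_map 1 (kappa12 z) = z" if "z \<in> dom12" for z
  proof -
    obtain u v e r where z: "z = (u, v, e, r)" by (cases z)
    define c where "c = e powr (1 / 3)"
    have e: "0 < e" "0 < c" "c ^ 3 = e" using that powrs by (auto simp: z dom12_def c_def)
    have k: "kappa12 z = (1 / c * u, 1 / c ^ 2 * v, 1 / c ^ 2, c * r)"
      using powrs[OF e(1)] by (simp add: z kappa12_def c_def)
    have "sqrt (1 / c ^ 2) = 1 / c" using e(2) by (simp add: real_sqrt_divide)
    then show ?thesis unfolding k using e by (simp add: chart_dom_def chart_map_def z power_divide)
  qed
  have 2: "chart_map 1 X \<in> dom12 \<and> kappa12 (chart_map 1 X) = X" if "X \<in> chart_dom 1" for X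
  proof -
    obtain u v m r where X: "X = (u, v, m, r)" by (cases X)
    define R where "R = sqrt m"
    have R: "0 < R" "m = R ^ 2" using that by (auto simp: X chart_dom_def R_def)
    have c: "chart_map 1 X = (u / R, v / R ^ 2, 1 / R ^ 3, r * R)" by (simp add: X chart_map_def R_def)
    have "((1 / R ^ 3) powr (1 / 3)) ^ 3 = (1 / R) ^ 3" using powrs(3)[of "1 / R ^ 3"] R(1) by (simp add: power_divide)
    then have p: "(1 / R ^ 3) powr (1 / 3) = 1 / R"
      by (rule power_eq_imp_eq_base) (use R(1) in auto)
    have pos: "0 < 1 / R ^ 3" using R(1) by simp
    show ?thesis
      unfolding c kappa12_def split powrs(1,2)[OF pos] p using R by (simp add: X dom12_def power_divide)
  qed
  show ?thesis using 1 2 by (auto intro!: image_eqI[of _ kappa12 "chart_map 1 _"])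
qed

lemma kappa23_eq:
  assumes "X \<in> dom23" shows "kappa23 X = chart_map (- 1) X"
proof -
  obtain u v m r where X: "X = (u, v, m, r)" by (cases X)
  define M where "M = - m"
  have M: "0 < M" using assms by (simp add: X dom23_def M_def)
  have e: "M powr (- 1 / 2) = 1 / sqrt M" "M powr (- 1) = 1 / sqrt M ^ 2" "M powr (1 / 2) = sqrt M"
    using M by (auto simp: powr_minus_divide[of M "1/2", simplified] powr_half_sqrt powr_minus_divide)
  have e3: "M powr (- 3 / 2) = 1 / sqrt M ^ 3"
  proof -
    have "M powr (3 / 2) = sqrt M ^ 3"
      using M by (simp add: powr_half_sqrt[symmetric] powr_powr flip: powr_realpow)
    then show ?thesis using powr_minus_divide[of M "3/2"] by simp
  qed
  have "chart_map (- 1) X = (u / sqrt M, v / sqrt M ^ 2, 1 / sqrt M ^ 3, r * sqrt M)"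
    by (simp add: X chart_map_def M_def)
  moreover have "kappa23 X = (M powr (- 1 / 2) * u, M powr (- 1) * v, M powr (- 3 / 2), r * M powr (1 / 2))"
    by (simp add: X kappa23_def M_def)
  ultimately show ?thesis unfolding e e3 by simp
qed

lemma kappa23_vimage: "kappa23 -` C \<inter> dom23 = {X \<in> chart_dom (- 1). chart_map (- 1) X \<in> C}"
proof -
  have "dom23 = chart_dom (- 1)" by (auto simp: dom23_def chart_dom_def)
  then show ?thesis using kappa23_eq by auto
qed

lemma tangent_space_kernel:
  assumes "open U" "x \<in> U" "\<And>y. y \<in> U \<Longrightarrow> y \<in> M \<Longrightarrow> g y = 0"
    and "(g has_derivative g') (at x)" "v \<in> tangent_space M x"
  shows "g' v = (0 :: 'b::real_normed_vector)"
proof -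
  obtain c where c: "c 0 = x" "\<forall>\<^sub>F t in nhds 0. c t \<in> M" "(c has_vector_derivative v) (at 0)"
    using assms(5) unfolding tangent_space_def by auto
  have "isCont c 0" by (rule has_vector_derivative_continuous[OF c(3)])
  then have "(c \<longlongrightarrow> x) (nhds 0)" using c(1) tendsto_at_iff_tendsto_nhds[of c 0] by (simp add: isCont_def)
  then have "\<forall>\<^sub>F t in nhds 0. c t \<in> U" using assms(1,2) by (auto simp: tendsto_def)
  with c(2) have ev: "\<forall>\<^sub>F t in nhds 0. t \<in> UNIV \<longrightarrow> (g \<circ> c) t = 0"
    by eventually_elim (simp add: assms(3))
  have g0: "(g \<circ> c) 0 = 0"
    using eventually_nhds_x_imp_x[OF c(2)] c(1) assms(2,3) by simp
  have "((g \<circ> c) has_vector_derivative g' v) (at 0)"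
    by (rule vector_derivative_diff_chain_within[OF c(3)]) (use assms(4) c(1) in \<open>auto intro: has_derivative_at_withinI\<close>)
  moreover have "((g \<circ> c) has_vector_derivative 0) (at 0)"
    by (rule iffD2[OF has_vector_derivative_cong_ev[where g = "\<lambda>_. 0", OF ev g0] has_vector_derivative_const])
  ultimately show ?thesis by (rule vector_derivative_unique_at)
qed

text \<open>\<open>l x\<close> below is the slope \<open>dv / du\<close> of the section \<open>{de = dr = 0}\<close> of the tangent space at \<open>x\<close>.\<close>

lemma adapted_chart:
  fixes W U0 :: "state set"
  assumes W: "C1_submanifold 3 W" "p \<in> W" "open U0" "W \<subseteq> U0"
    and t: "(1, \<theta>, 0, 0) \<in> tangent_space W p" "(0, c, 1, 0) \<in> tangent_space W p" "(0, 0, 0, 1) \<in> tangent_space W p"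
  obtains B and g :: "state \<Rightarrow> real" and g' where "open B" "p \<in> B" "B \<subseteq> U0"
    "\<And>x. x \<in> B \<Longrightarrow> (g has_derivative blinfun_apply (g' x)) (at x)" "continuous_on B g'"
    "\<And>x. x \<in> B \<Longrightarrow> x \<in> W \<longleftrightarrow> g x = 0"
    "\<And>x. x \<in> B \<Longrightarrow> blinfun_apply (g' x) (0, 1, 0, 0) \<noteq> 0"
    "\<And>x. x \<in> B \<Longrightarrow> \<exists>l. \<bar>l - \<theta>\<bar> \<le> 2/5 \<and>
      blinfun_apply (g' x) (1, 0, 0, 0) = - l * blinfun_apply (g' x) (0, 1, 0, 0)"
proof -
  obtain U and g :: "state \<Rightarrow> real" and g' where U: "open U" "p \<in> U"
    "\<And>x. x \<in> U \<Longrightarrow> (g has_derivative blinfun_apply (g' x)) (at x)" "continuous_on U g'"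
    "\<And>x. x \<in> U \<Longrightarrow> x \<in> W \<longleftrightarrow> g x = 0" "\<And>x. x \<in> U \<Longrightarrow> g' x \<noteq> 0"
    by (rule C1_submanifold_hyperplane_chart[OF W(1) _ W(2)]) auto
  define \<alpha> where "\<alpha> x = blinfun_apply (g' x) (1, 0, 0, 0)" for x
  define \<beta> where "\<beta> x = blinfun_apply (g' x) (0, 1, 0, 0)" for x
  \<comment> \<open>Positivity of \<open>h\<close> is an open condition that expresses both
    \<open>\<beta> x \<noteq> 0\<close> and a slope \<open>- \<alpha> x / \<beta> x\<close> within
    2/5 of \<open>\<theta>\<close>.\<close>
  define h where "h x = 2/5 * \<bar>\<beta> x\<bar> - \<bar>\<alpha> x + \<theta> * \<beta> x\<bar>" for x
  have k: "blinfun_apply (g' p) v = 0" if "v \<in> tangent_space W p" for v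
    by (rule tangent_space_kernel[OF U(1,2) _ U(3)[OF U(2)] that]) (use U(5) in blast)
  have lin: "blinfun_apply (g' p) (a, b, d, r) = a * \<alpha> p + b * \<beta> p + d * blinfun_apply (g' p) (0, 0, 1, 0) + r * blinfun_apply (g' p) (0, 0, 0, 1)" for a b d r
  proof -
    have "(a, b, d, r) = a *\<^sub>R (1, 0, 0, 0) + b *\<^sub>R (0, 1, 0, 0) + d *\<^sub>R (0, 0, 1, 0) + r *\<^sub>R (0, 0, 0, 1 :: real)" by simp
    then show ?thesis by (simp only: blinfun.add_right blinfun.scaleR_right real_scaleR_def \<alpha>_def \<beta>_def)
  qed
  have a0: "\<alpha> p + \<theta> * \<beta> p = 0" using k[OF t(1)] lin[of 1 \<theta> 0 0] by simp
  \<comment> \<open>If \<open>\<beta> p\<close> vanished, the three tangent vectors would force the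
    differential to vanish in the other coordinate directions as well.\<close>
  have "\<beta> p \<noteq> 0"
  proof
    assume b: "\<beta> p = 0"
    have z: "blinfun_apply (g' p) (0, 0, 0, 1) = 0" "blinfun_apply (g' p) (0, 0, 1, 0) = 0"
      using k[OF t(3)] k[OF t(2)] lin[of 0 c 1 0] b by simp_all
    have "\<alpha> p = 0" using a0 b by simp
    then have "blinfun_apply (g' p) (a, b, d, r) = 0" for a b d r by (subst lin) (simp add: z b)
    then have "g' p = 0" by (intro blinfun_eqI) (auto simp: zero_blinfun.rep_eq)
    then show False using U(6)[OF U(2)] by simp
  qed
  then have hp: "0 < h p" using a0 by (simp add: h_def)
  have "continuous_on U \<alpha>" "continuous_on U \<beta>" unfolding \<alpha>_def[abs_def] \<beta>_def[abs_def]
    by (intro bounded_bilinear.continuous_on[OF bounded_bilinear_blinfun_apply] U(4) continuous_intros)+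
  then have hc: "continuous_on U h" unfolding h_def[abs_def] by (intro continuous_intros)
  define B where "B = U \<inter> h -` {0<..} \<inter> U0"
  have B: "open B" unfolding B_def
    by (rule open_Int[OF continuous_open_preimage[OF hc U(1) open_greaterThan] W(3)])
  show thesis
  proof (rule that[OF B, of g g'])
    show "p \<in> B" using U(2) hp W by (auto simp: B_def)
    show "B \<subseteq> U0" by (auto simp: B_def)
    show "continuous_on B g'" by (rule continuous_on_subset[OF U(4)]) (auto simp: B_def)
    fix x assume x: "x \<in> B"
    then have xU: "x \<in> U" and hx: "0 < h x" by (auto simp: B_def)
    show "(g has_derivative blinfun_apply (g' x)) (at x)" by (rule U(3)[OF xU])
    show "x \<in> W \<longleftrightarrow> g x = 0" by (rule U(5)[OF xU])
    have b0: "\<beta> x \<noteq> 0" using hx by (auto simp: h_def)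
    then show "blinfun_apply (g' x) (0, 1, 0, 0) \<noteq> 0" by (simp add: \<beta>_def)
    show "\<exists>l. \<bar>l - \<theta>\<bar> \<le> 2/5 \<and> blinfun_apply (g' x) (1, 0, 0, 0) = - l * blinfun_apply (g' x) (0, 1, 0, 0)"
    proof (intro exI[of _ "- \<alpha> x / \<beta> x"] conjI)
      have "- \<alpha> x / \<beta> x - \<theta> = - ((\<alpha> x + \<theta> * \<beta> x) / \<beta> x)" using b0 by (simp add: field_simps)
      then have "\<bar>- \<alpha> x / \<beta> x - \<theta>\<bar> = \<bar>\<alpha> x + \<theta> * \<beta> x\<bar> / \<bar>\<beta> x\<bar>" by (simp add: abs_divide)
      also have "\<dots> \<le> 2/5" using hx b0 by (simp add: h_def pos_divide_le_eq)
      finally show "\<bar>- \<alpha> x / \<beta> x - \<theta>\<bar> \<le> 2/5" .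
      show "blinfun_apply (g' x) (1, 0, 0, 0) = - (- \<alpha> x / \<beta> x) * blinfun_apply (g' x) (0, 1, 0, 0)"
        using b0 by (simp add: \<alpha>_def \<beta>_def)
    qed
  qed
qed

section \<open>Spectral data at the equilibria\<close>

lemma eigenvector_in_spectral_subspace:
  assumes "A (A v) - (2 * \<alpha>) *\<^sub>R A v + (\<alpha>\<^sup>2) *\<^sub>R v = 0" "\<alpha> \<in> R"
  shows "v \<in> spectral_subspace A R"
  unfolding spectral_subspace_def
  by (rule span_base, rule CollectI, rule bexI[OF _ assms(2)], rule exI[of _ 0], rule exI[of _ "Suc 0"])
    (use assms(1) in simp)

lemma K1_frechet: "frechet_derivative K1_field (at p_plus) = (\<lambda>(a, b, c, d). (b + c / 2, 2 * a, 0, 0))"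
proof -
  have "(K1_field has_derivative (\<lambda>(a, b, c, d). (b + c / 2, 2 * a, 0, 0))) (at p_plus)"
    unfolding K1_field_def split_beta p_plus_def
    by (auto intro!: derivative_eq_intros simp: fun_eq_iff)
  then show ?thesis by (rule frechet_derivative_at[symmetric])
qed

lemma K3_frechet: "frechet_derivative K3_field (at p_zero) = (\<lambda>(a, b, c, d). (b, a, 0, 0))"
proof -
  have "(K3_field has_derivative (\<lambda>(a, b, c, d). (b, a, 0, 0))) (at p_zero)"
    unfolding K3_field_def split_beta p_zero_def
    by (auto intro!: derivative_eq_intros simp: fun_eq_iff)
  then show ?thesis by (rule frechet_derivative_at[symmetric])
qed

text \<open>The (u, v)-block at \<open>p_plus\<close> has eigenvalues sqrt 2 and - sqrt 2; the first
  vector is the unstable direction. The other two span the kernel, the entry -1/2 compensating the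
  term \<open>c / 2\<close>.\<close>

lemma center_unstable_tangent:
  "(1, sqrt 2, 0, 0) \<in> spectral_subspace (frechet_derivative K1_field (at p_plus)) {0..}"
  "(0, - 1 / 2, 1, 0) \<in> spectral_subspace (frechet_derivative K1_field (at p_plus)) {0..}"
  "(0, 0, 0, 1) \<in> spectral_subspace (frechet_derivative K1_field (at p_plus)) {0..}"
  unfolding K1_frechet
  by (rule eigenvector_in_spectral_subspace[of _ _ "sqrt 2"], simp_all add: zero_prod_def)
    (rule eigenvector_in_spectral_subspace[of _ _ 0], simp_all add: zero_prod_def)+

text \<open>The (u, v)-block at \<open>p_zero\<close> has eigenvalues 1 and -1; the first vector is
  the stable direction, the other two span the kernel.\<close>

lemma center_stable_tangent:
  "(1, - 1, 0, 0) \<in> spectral_subspace (frechet_derivative K3_field (at p_zero)) {..0}"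
  "(0, 0, 1, 0) \<in> spectral_subspace (frechet_derivative K3_field (at p_zero)) {..0}"
  "(0, 0, 0, 1) \<in> spectral_subspace (frechet_derivative K3_field (at p_zero)) {..0}"
  unfolding K3_frechet
  by (rule eigenvector_in_spectral_subspace[of _ _ "- 1"], simp_all add: zero_prod_def)
    (rule eigenvector_in_spectral_subspace[of _ _ 0], simp_all add: zero_prod_def)+

section \<open>Convergence of the orbit to the equilibria, and tubes around it\<close>

context hastings_mcleod_solution
begin

text \<open>The first coordinate is the prescribed asymptotics after normalization; the second tends
  to 0 by \<open>w'_sublinear\<close>.\<close>

lemma orbit_tendsto_p_plus: "((\<lambda>s. chart_map 1 (hm_orbit w s)) \<longlongrightarrow> p_plus) at_bot"
proof -
  have top: "filterlim (\<lambda>s::real. sqrt (- s)) at_top at_bot"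
    by (rule filterlim_compose[OF sqrt_at_top filterlim_uminus_at_top_at_bot])
  have 1: "((\<lambda>s. sqrt 2 * w s / sqrt (- s)) \<longlongrightarrow> 1) at_bot"
  proof (rule Lim_transform_eventually[OF w_ratio])
    show "\<forall>\<^sub>F s in at_bot. w s / sqrt (- s / 2) = sqrt 2 * w s / sqrt (- s)"
      using eventually_le_at_bot[of "-1"] by eventually_elim (simp only: real_sqrt_divide divide_divide_eq_right mult.commute)
  qed
  have 2: "((\<lambda>s. sqrt 2 * deriv w s / sqrt (- s) ^ 2) \<longlongrightarrow> 0) at_bot"
  proof (rule tendstoI)
    fix e :: real assume e: "0 < e"
    have "\<forall>\<^sub>F s in at_bot. \<bar>deriv w s\<bar> \<le> (e / 2 / sqrt 2) * \<bar>s\<bar>" by (rule w'_sublinear) (use e in simp)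
    with eventually_le_at_bot[of "-1"] show "\<forall>\<^sub>F s in at_bot. dist (sqrt 2 * deriv w s / sqrt (- s) ^ 2) 0 < e"
    proof eventually_elim
      case (elim s)
      have "dist (sqrt 2 * deriv w s / sqrt (- s) ^ 2) 0 = sqrt 2 * \<bar>deriv w s\<bar> / \<bar>s\<bar>"
        using elim(1) by (simp add: abs_mult)
      also have "\<dots> \<le> sqrt 2 * ((e / 2 / sqrt 2) * \<bar>s\<bar>) / \<bar>s\<bar>"
        using elim by (intro divide_right_mono mult_left_mono) auto
      also have "\<dots> = e / 2" using elim(1) by simp
      finally have "dist (sqrt 2 * deriv w s / sqrt (- s) ^ 2) 0 \<le> e / 2" .
      then show ?case using e by linarith
    qed
  qed
  have "((\<lambda>s. (1 / sqrt (- s)) ^ 3) \<longlongrightarrow> 0 ^ 3) at_bot"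
    by (intro tendsto_power tendsto_divide_0[OF tendsto_const filterlim_at_top_imp_at_infinity[OF top]])
  then have 3: "((\<lambda>s. 1 / sqrt (- s) ^ 3) \<longlongrightarrow> 0) at_bot" by (simp add: power_divide)
  have "((\<lambda>s. (sqrt 2 * w s / sqrt (- s), sqrt 2 * deriv w s / sqrt (- s) ^ 2, 1 / sqrt (- s) ^ 3, 0)) \<longlongrightarrow> (1, 0, 0, 0 :: real)) at_bot"
    by (intro tendsto_Pair 1 2 3 tendsto_const)
  then show ?thesis by (simp add: chart_map_def hm_orbit_def p_plus_def)
qed

text \<open>Monotonicity of w and of w' on the positive half-line bounds both by their values at 0,
  and the negative powers of sqrt s do the rest.\<close>

lemma orbit_tendsto_p_zero: "((\<lambda>s. chart_map (- 1) (hm_orbit w s)) \<longlongrightarrow> p_zero) at_top"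
proof -
  have inv: "((\<lambda>s. 1 / sqrt s) \<longlongrightarrow> 0) at_top"
    by (intro tendsto_divide_0[OF tendsto_const filterlim_at_top_imp_at_infinity[OF sqrt_at_top]])
  have p: "((\<lambda>s. C * (1 / sqrt s) ^ Suc n) \<longlongrightarrow> 0) at_top" for C :: real and n
    using tendsto_mult[OF tendsto_const[of C] tendsto_power[OF inv, of "Suc n"]] by simp
  have 1: "((\<lambda>s. sqrt 2 * w s / sqrt s) \<longlongrightarrow> 0) at_top"
  proof (rule Lim_null_comparison[OF _ p[of "sqrt 2 * w 0" 0]])
    show "\<forall>\<^sub>F s in at_top. norm (sqrt 2 * w s / sqrt s) \<le> sqrt 2 * w 0 * (1 / sqrt s) ^ Suc 0"
      using eventually_ge_at_top[of 1]
    proof eventually_elim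
      case (elim s)
      then show ?case using w_antimono[of 0 s] w_pos[of s] by (simp add: abs_mult divide_right_mono)
    qed
  qed
  have 2: "((\<lambda>s. sqrt 2 * deriv w s / sqrt s ^ 2) \<longlongrightarrow> 0) at_top"
  proof (rule Lim_null_comparison[OF _ p[of "sqrt 2 * \<bar>deriv w 0\<bar>" 1]])
    show "\<forall>\<^sub>F s in at_top. norm (sqrt 2 * deriv w s / sqrt s ^ 2) \<le> sqrt 2 * \<bar>deriv w 0\<bar> * (1 / sqrt s) ^ Suc 1"
      using eventually_ge_at_top[of 1]
    proof eventually_elim
      case (elim s)
      have "\<bar>deriv w s\<bar> \<le> \<bar>deriv w 0\<bar>" using w'_bounded[of s] w'_nonpos[of s] elim by simp
      then have "sqrt 2 * \<bar>deriv w s\<bar> / s \<le> sqrt 2 * \<bar>deriv w 0\<bar> / s"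
        using elim by (intro divide_right_mono mult_left_mono) auto
      then show ?case using elim by (simp add: abs_mult power_divide power2_eq_square[symmetric] flip: numeral_2_eq_2)
    qed
  qed
  have 3: "((\<lambda>s. 1 / sqrt s ^ 3) \<longlongrightarrow> 0) at_top" using p[of 1 2] by (simp add: power_divide numeral_3_eq_3)
  have "((\<lambda>s. (sqrt 2 * w s / sqrt s, sqrt 2 * deriv w s / sqrt s ^ 2, 1 / sqrt s ^ 3, 0)) \<longlongrightarrow> (0, 0, 0, 0 :: real)) at_top"
    by (intro tendsto_Pair 1 2 3 tendsto_const)
  then show ?thesis by (simp add: chart_map_def hm_orbit_def p_zero_def)
qed

lemma hm_orbit_cont: "continuous_on S (hm_orbit w)"
  unfolding hm_orbit_def[abs_def]
  by (intro continuous_intros continuous_on_of_DERIV[OF w_deriv] continuous_on_of_DERIV[OF w_deriv2])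

text \<open>The orbit is a graph over the \<mu>-axis, so the cross section through \<open>X\<close>
  is the one with parameter minus its third coordinate.\<close>

lemma tube_eq: "tube (hm_orbit w) \<delta> =
  {X. norm (X - hm_orbit w (- fst (snd (snd X)))) < \<delta> (- fst (snd (snd X)))}"
proof (intro equalityI subsetI)
  fix X assume "X \<in> tube (hm_orbit w) \<delta>"
  then obtain \<xi> a b c where "X = hm_orbit w \<xi> + (a, b, 0, c)" "norm (a, b, 0::real, c) < \<delta> \<xi>"
    unfolding tube_def by blast
  moreover from this have "fst (snd (snd X)) = - \<xi>" by (simp add: hm_orbit_def)
  ultimately show "X \<in> {X. norm (X - hm_orbit w (- fst (snd (snd X)))) < \<delta> (- fst (snd (snd X)))}" by simp
next
  fix X assume X: "X \<in> {X. norm (X - hm_orbit w (- fst (snd (snd X)))) < \<delta> (- fst (snd (snd X)))}"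
  obtain u v m r where Xeq: "X = (u, v, m, r)" by (cases X)
  have "X - hm_orbit w (- m) = (u - sqrt 2 * w (- m), v - sqrt 2 * deriv w (- m), 0, r)"
    by (simp add: Xeq hm_orbit_def)
  moreover have "X = hm_orbit w (- m) + (X - hm_orbit w (- m))" by simp
  moreover have "norm (X - hm_orbit w (- m)) < \<delta> (- m)" using X by (simp add: Xeq)
  ultimately have "X = hm_orbit w (- m) + (u - sqrt 2 * w (- m), v - sqrt 2 * deriv w (- m), 0, r) \<and>
      norm (u - sqrt 2 * w (- m), v - sqrt 2 * deriv w (- m), 0::real, r) < \<delta> (- m)" by metis
  then show "X \<in> tube (hm_orbit w) \<delta>" unfolding tube_def by blast
qed

lemma exists_tube:
  assumes Y: "open Y" "range (hm_orbit w) \<subseteq> Y"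
  obtains \<delta> where "continuous_on UNIV \<delta>" "\<And>\<xi>. 0 < \<delta> \<xi>" "open (tube (hm_orbit w) \<delta>)"
    "tube (hm_orbit w) \<delta> \<subseteq> Y" "range (hm_orbit w) \<subseteq> tube (hm_orbit w) \<delta>"
proof -
  \<comment> \<open>The extra point keeps \<open>C\<close> nonempty when \<open>Y\<close> is the
    whole space, where \<open>infdist\<close> would be 0; it is off the orbit because its last
    coordinate is not 0.\<close>
  define C where "C = insert (0, 0, 0, 1) (- Y)"
  define \<delta> where "\<delta> \<xi> = infdist (hm_orbit w \<xi>) C" for \<xi>
  have C: "closed C" "C \<noteq> {}" using Y(1) by (auto simp: C_def intro!: closed_insert)
  have c: "continuous_on UNIV \<delta>" unfolding \<delta>_def[abs_def] by (intro continuous_on_infdist hm_orbit_cont)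
  have p: "0 < \<delta> \<xi>" for \<xi>
  proof -
    have "hm_orbit w \<xi> \<notin> C" using Y(2) by (auto simp: C_def hm_orbit_def)
    then show ?thesis using in_closed_iff_infdist_zero[OF C] infdist_nonneg[of "hm_orbit w \<xi>" C]
      by (simp add: \<delta>_def less_le)
  qed
  have c2: "continuous_on UNIV (\<lambda>X::state. f (- fst (snd (snd X))))" if "continuous_on UNIV f" for f :: "real \<Rightarrow> 'b::topological_space"
    by (rule continuous_on_compose2[OF that]) (auto intro!: continuous_intros)
  have o: "open (tube (hm_orbit w) \<delta>)"
    unfolding tube_eq by (intro open_Collect_less continuous_intros c2 hm_orbit_cont c)
  have s: "tube (hm_orbit w) \<delta> \<subseteq> Y"
  proof
    fix X assume X: "X \<in> tube (hm_orbit w) \<delta>"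
    show "X \<in> Y"
    proof (rule ccontr)
      assume "X \<notin> Y"
      then have "X \<in> C" by (simp add: C_def)
      then have "infdist (hm_orbit w (- fst (snd (snd X)))) C \<le> dist (hm_orbit w (- fst (snd (snd X)))) X"
        by (rule infdist_le)
      then show False using X by (simp add: tube_eq \<delta>_def dist_norm norm_minus_commute)
    qed
  qed
  have r: "range (hm_orbit w) \<subseteq> tube (hm_orbit w) \<delta>"
    unfolding tube_eq using p by (auto simp: hm_orbit_def zero_prod_def)
  show thesis by (rule that[OF c p o s r])
qed

end

section \<open>Transversality\<close>

lemma DIM_state: "DIM(state) - DIM(real) = 3" "DIM(state) - DIM(real \<times> real) = 2"
  by simp_all

text \<open>Cramer's rule on the span of \<open>h1\<close> and \<open>h2\<close>.\<close>

lemma surj_of_determinant: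
  fixes a b :: "'a::real_vector \<Rightarrow> real"
  assumes "linear a" "linear b" and d: "a h1 * b h2 - a h2 * b h1 \<noteq> 0"
  shows "surj (\<lambda>v. (a v, b v))"
proof (rule surjI)
  fix y :: "real \<times> real"
  obtain s t where y: "y = (s, t)" by (cases y)
  define D where "D = a h1 * b h2 - a h2 * b h1"
  let ?v = "((s * b h2 - t * a h2) / D) *\<^sub>R h1 + ((t * a h1 - s * b h1) / D) *\<^sub>R h2"
  have lin: "f ?v = (s * b h2 - t * a h2) / D * f h1 + (t * a h1 - s * b h1) / D * f h2" if "linear f" for f :: "'a \<Rightarrow> real"
    by (simp add: linear_add[OF that] linear_scale[OF that])
  have D0: "D \<noteq> 0" using d by (simp add: D_def)
  have "a ?v = s * D / D" unfolding lin[OF assms(1)] by (simp add: D_def diff_divide_distrib algebra_simps flip: add_divide_distrib)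
  moreover have "b ?v = t * D / D" unfolding lin[OF assms(2)] by (simp add: D_def diff_divide_distrib algebra_simps flip: add_divide_distrib)
  ultimately show "(\<lambda>v. (a v, b v)) ((\<lambda>(s, t). ((s * b h2 - t * a h2) / D) *\<^sub>R h1 + ((t * a h1 - s * b h1) / D) *\<^sub>R h2) y) = y"
    using D0 by (simp add: y)
qed

lemma surj_fst: "surj fst" and surj_snd: "surj snd"
  by (rule surjI[of _ "\<lambda>x. (x, undefined)"], simp, rule surjI[of _ "\<lambda>x. (undefined, x)"], simp)

lemma eq_mult_sqrt:
  fixes a b l T :: real
  assumes "0 < T" "a / T - l * (b / sqrt T) = 0"
  shows "a = l * sqrt T * b"
proof -
  define R where "R = sqrt T"
  have R: "0 < R" "T = R * R" using assms(1) by (auto simp: R_def)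
  have "a / (R * R) - l * (b / R) = 0" using assms(2) unfolding R_def[symmetric] R(2)[symmetric] .
  then have "a = l * R * b" using R(1) by (simp add: field_simps)
  then show ?thesis by (simp add: R_def)
qed

text \<open>The left reference time is a point where w'' > w', so that the Wronskian starts out
  positive there; \<open>lim1\<close> and \<open>lim3\<close> put points of the orbit into every
  target.\<close>

locale two_sides =
  c1: chart_side w 1 "sqrt 2" T01 T1 p_plus W1 B1 B1' g1 g1' +
  c3: chart_side w "- 1" "- 1" T03 T3 p_zero W3 B3 B3' g3 g3'
  for w :: "real \<Rightarrow> real" and T01 T1 T03 T3 :: real and W1 B1 B1' W3 B3 B3' :: "state set"
    and g1 g3 :: "state \<Rightarrow> real" and g1' g3' :: "state \<Rightarrow> state \<Rightarrow>\<^sub>L real" +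
  assumes slope_point: "deriv w (- T1) < - T1 * w (- T1) + 2 * w (- T1) ^ 3"
    and lim1: "\<And>\<rho>. 0 < \<rho> \<Longrightarrow> \<exists>s. T01 \<le> - s \<and> chart_map 1 (hm_orbit w s) \<in> ball p_plus \<rho>"
    and lim3: "\<And>\<rho>. 0 < \<rho> \<Longrightarrow> \<exists>s. T03 \<le> s \<and> chart_map (- 1) (hm_orbit w s) \<in> ball p_zero \<rho>"
begin

abbreviation "G1 \<equiv> c1.G (- 1 * T1)"
abbreviation "G3 \<equiv> c3.G (- (- 1) * T3)"

definition X0 :: "(real \<times> real \<times> real) set"
  where "X0 = c1.G_dom (- 1 * T1) \<inter> c3.G_dom (- (- 1) * T3)"

lemma X0_open: "open X0"
  unfolding X0_def using c1.T0 c3.T0 by (intro open_Int c1.G_dom_open c3.G_dom_open) auto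

lemma X0_0: "0 \<in> X0"
  using c1.G_axis[of "- 1 * T1"] c3.G_axis[of "- (- 1) * T3"] c1.T0 c3.T0 by (auto simp: X0_def)

lemma G_derivs:
  obtains D1 D3 where "\<And>x. x \<in> X0 \<Longrightarrow> (G1 has_derivative blinfun_apply (D1 x)) (at x)" "continuous_on X0 D1"
    "\<And>x. x \<in> X0 \<Longrightarrow> (G3 has_derivative blinfun_apply (D3 x)) (at x)" "continuous_on X0 D3"
proof -
  have "C1_on X0 G1" "C1_on X0 G3"
    by (rule C1_on_subset[OF c1.G_C1], use c1.T0 in simp, simp add: X0_def,
        rule C1_on_subset[OF c3.G_C1], use c3.T0 in simp, simp add: X0_def)
  then show thesis using that by (metis C1_onE)
qed

text \<open>A common kernel vector is the initial value of a solution of the linearized equation. On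
  the left its slope is read off at the one time \<open>- T1\<close>; on the right the kernel is
  transported to every time from \<open>T3\<close> on. \<open>no_connecting_solution\<close> then
  makes value and slope vanish at \<open>- T1\<close>.\<close>

lemma derivs_independent:
  assumes L1: "(G1 has_derivative L1) (at 0)" and L3: "(G3 has_derivative L3) (at 0)"
    and z: "L1 (p, q, 0) = 0" "L3 (p, q, 0) = 0"
  shows "p = 0 \<and> q = 0"
proof -
  obtain D where D: "\<And>s. ((\<lambda>x. c1.Psi (s, x)) has_derivative D s) (at 0)"
    "\<And>p q. \<exists>y y'. (\<forall>s. (y has_real_derivative y' s) (at s)) \<and> (\<forall>s. (y' has_real_derivative (s + 6 * (w s)\<^sup>2) * y s) (at s)) \<and>
       y 0 = p \<and> y' 0 = q \<and> (\<forall>s. D s (p, q, 0) = (y s, y' s, 0, 0))"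
    "\<And>s a b. \<exists>p q. D s (p, q, 0) = (a, b, 0, 0)" "\<And>s h. D s h = 0 \<Longrightarrow> h = 0"
    by (rule c1.Psi_partial_axis) blast
  obtain y y' where y: "\<And>s. (y has_real_derivative y' s) (at s)" "\<And>s. (y' has_real_derivative (s + 6 * (w s)\<^sup>2) * y s) (at s)"
    "\<And>s. D s (p, q, 0) = (y s, y' s, 0, 0)" using D(2)[of p q] by blast
  let ?s1 = "- 1 * T1"
  have T1: "1 \<le> T1" "T01 \<le> - 1 * ?s1" using c1.T0 by auto
  obtain \<beta> l where \<beta>: "\<beta> \<noteq> 0" "\<bar>l - sqrt 2\<bar> \<le> 2/5"
    "\<And>L D h a b. (G1 has_derivative L) (at 0) \<Longrightarrow> ((\<lambda>x. c1.Psi (?s1, x)) has_derivative D) (at 0) \<Longrightarrow>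
      D h = (a, b, 0, 0) \<Longrightarrow> L h = \<beta> * (b / (- 1 * ?s1) - l * (a / sqrt (- 1 * ?s1)))"
    by (rule c1.G_deriv_axis[OF T1(2)]) blast
  have sq: "1 \<le> sqrt T1" using T1 by simp
  have "y' (- T1) / T1 - l * (y (- T1) / sqrt T1) = 0"
    using \<beta>(3)[OF L1 D(1) y(3)] z(1) \<beta>(1) by simp
  then have s1: "y' (- T1) = l * sqrt T1 * y (- T1)" by (rule eq_mult_sqrt[rotated]) (use T1(1) in simp)
  \<comment> \<open>\<open>7/5 - 2/5 = 1\<close> is the slope that the Wronskian needs on the left;
    on the right \<open>- 1 + 2/5\<close> is still below \<open>- 1/2\<close>.\<close>
  have "7/5 \<le> sqrt 2" by (rule real_le_rsqrt) (simp add: power2_eq_square)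
  then have "1 \<le> l" using \<beta>(2) by linarith
  then have ls: "1 \<le> l * sqrt T1" using mult_mono[of 1 l 1 "sqrt T1"] sq by simp
  have s3: "\<exists>\<tau>\<ge>1/2. y' s = - \<tau> * sqrt s * y s" if s: "T3 \<le> s" for s
  proof -
    have s': "T3 \<le> - (- 1) * s" "T03 \<le> - (- 1) * s" "1 \<le> s" using s c3.T0 by auto
    have T3: "T03 \<le> - (- 1) * (- (- 1) * T3)" "1 \<le> T3" using c3.T0 by auto
    have "0 \<in> c3.G_dom s" "0 < - (- 1) * s" using c3.G_axis[OF s'(2)] s' by auto
    then obtain L where L: "(c3.G s has_derivative L) (at 0)"
      using c3.G_C1[of s] by (metis C1_onE)
    obtain \<beta>1 l1 where b1: "\<beta>1 \<noteq> 0" "\<And>L D h a b. (G3 has_derivative L) (at 0) \<Longrightarrow>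
        ((\<lambda>x. c1.Psi (- (- 1) * T3, x)) has_derivative D) (at 0) \<Longrightarrow> D h = (a, b, 0, 0) \<Longrightarrow>
        L h = \<beta>1 * (b / (- (- 1) * (- (- 1) * T3)) - l1 * (a / sqrt (- (- 1) * (- (- 1) * T3))))"
      by (rule c3.G_deriv_axis[OF T3(1)]) blast
    obtain p' q' where pq: "D (- (- 1) * T3) (p', q', 0) = (0, 1, 0, 0)" using D(3) by blast
    have "L3 (p', q', 0) \<noteq> 0" using b1(2)[OF L3 D(1) pq] b1(1) T3(2) by simp
    then have L0: "L (p, q, 0) = 0" by (rule c3.G_kernel_transport[OF s'(1) L3 z(2) _ L])
    obtain \<beta>2 l2 where b2: "\<beta>2 \<noteq> 0" "\<bar>l2 - - 1\<bar> \<le> 2/5" "\<And>L D h a b. (c3.G s has_derivative L) (at 0) \<Longrightarrow>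
        ((\<lambda>x. c1.Psi (s, x)) has_derivative D) (at 0) \<Longrightarrow> D h = (a, b, 0, 0) \<Longrightarrow>
        L h = \<beta>2 * (b / (- (- 1) * s) - l2 * (a / sqrt (- (- 1) * s)))"
      by (rule c3.G_deriv_axis[OF s'(2)]) blast
    have "y' s / s - l2 * (y s / sqrt s) = 0" using b2(3)[OF L D(1) y(3)] L0 b2(1) by simp
    then have "y' s = l2 * sqrt s * y s" by (rule eq_mult_sqrt[rotated]) (use s'(3) in simp)
    then have "y' s = - (- l2) * sqrt s * y s" by simp
    moreover have "1/2 \<le> - l2" using b2(2) by linarith
    ultimately show ?thesis by blast
  qed
  have "y (- T1) = 0"
    by (rule c1.no_connecting_solution[OF y(1,2) _ s1 ls s3]) (use slope_point in simp_all)
  then have "D (- T1) (p, q, 0) = 0" using y(3)[of "- T1"] s1 by (simp add: zero_prod_def)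
  then show ?thesis using D(4)[of "- T1" "(p, q, 0)"] by (simp add: zero_prod_def)
qed

text \<open>On the plane of vanishing r-component the two differentials at 0 form an injective,
  hence onto, map between planes. This persists nearby, being witnessed by a determinant on two
  fixed vectors.\<close>

lemma regular_neighbourhood:
  obtains X1 D1 D3 where "open X1" "0 \<in> X1"
    "\<And>x. x \<in> X1 \<Longrightarrow> (G1 has_derivative blinfun_apply (D1 x)) (at x)" "continuous_on X1 D1"
    "\<And>x. x \<in> X1 \<Longrightarrow> (G3 has_derivative blinfun_apply (D3 x)) (at x)" "continuous_on X1 D3"
    "\<And>x. x \<in> X1 \<Longrightarrow> surj (\<lambda>v. (blinfun_apply (D1 x) v, blinfun_apply (D3 x) v))"
proof -
  obtain D1 D3 where D: "\<And>x. x \<in> X0 \<Longrightarrow> (G1 has_derivative blinfun_apply (D1 x)) (at x)" "continuous_on X0 D1"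
    "\<And>x. x \<in> X0 \<Longrightarrow> (G3 has_derivative blinfun_apply (D3 x)) (at x)" "continuous_on X0 D3"
    by (rule G_derivs) (rule that; simp)
  define f where "f = (\<lambda>(p, q). (blinfun_apply (D1 0) (p, q, 0), blinfun_apply (D3 0) (p, q, 0)))"
  have "bounded_linear f" unfolding f_def split_beta
    by (intro bounded_linear_Pair bounded_linear_compose[OF blinfun.bounded_linear_right]
        bounded_linear_fst bounded_linear_snd bounded_linear_zero)
  then have lin: "linear f" by (rule bounded_linear.linear)
  have "inj f" unfolding linear_injective_0[OF lin]
  proof (intro allI impI)
    fix k assume "f k = 0"
    then have "blinfun_apply (D1 0) (fst k, snd k, 0) = 0" "blinfun_apply (D3 0) (fst k, snd k, 0) = 0"
      by (simp_all add: f_def split_beta zero_prod_def)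
    then have "fst k = 0 \<and> snd k = 0"
      by (rule derivs_independent[OF D(1)[OF X0_0] D(3)[OF X0_0]])
    then show "k = 0" by (simp add: prod_eq_iff)
  qed
  then have "surj f" by (rule linear_injective_imp_surjective[OF lin _ refl])
  then obtain k1 k2 where k: "f k1 = (1, 0)" "f k2 = (0, 1)" by (metis surjD)
  define h1 where "h1 = (fst k1, snd k1, 0::real)"
  define h2 where "h2 = (fst k2, snd k2, 0::real)"
  define d where "d x = blinfun_apply (D1 x) h1 * blinfun_apply (D3 x) h2 - blinfun_apply (D1 x) h2 * blinfun_apply (D3 x) h1" for x
  have d0: "d 0 = 1" using k by (simp add: d_def h1_def h2_def f_def split_beta)
  have "continuous_on X0 d" unfolding d_def[abs_def]
    by (intro continuous_intros bounded_bilinear.continuous_on[OF bounded_bilinear_blinfun_apply] D(2,4))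
  then have o: "open (X0 \<inter> d -` (- {0}))" by (rule continuous_open_preimage[OF _ X0_open]) auto
  have sub: "X0 \<inter> d -` (- {0}) \<subseteq> X0" by auto
  have lin: "linear (blinfun_apply (A x))" for A :: "real \<times> real \<times> real \<Rightarrow> (real \<times> real \<times> real) \<Rightarrow>\<^sub>L real" and x
    by (simp add: blinfun.bounded_linear_right bounded_linear.linear)
  show thesis
  proof (rule that[OF o _ _ continuous_on_subset[OF D(2) sub] _ continuous_on_subset[OF D(4) sub]])
    show "0 \<in> X0 \<inter> d -` (- {0})" using X0_0 d0 by simp
    fix x assume x: "x \<in> X0 \<inter> d -` (- {0})"
    show "(G1 has_derivative blinfun_apply (D1 x)) (at x)" "(G3 has_derivative blinfun_apply (D3 x)) (at x)"
      using D x by auto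
    show "surj (\<lambda>v. (blinfun_apply (D1 x) v, blinfun_apply (D3 x) v))"
      by (rule surj_of_determinant[where ?h1.0 = h1 and ?h2.0 = h2, OF lin lin]) (use x in \<open>simp add: d_def\<close>)
  qed
qed

lemma transversal_intersection:
  "\<exists>\<rho>0>0. \<forall>\<rho>1 \<rho>3. 0 < \<rho>1 \<and> \<rho>1 \<le> \<rho>0 \<and> 0 < \<rho>3 \<and> \<rho>3 \<le> \<rho>0 \<longrightarrow>
    (\<exists>\<delta>. continuous_on UNIV \<delta> \<and> (\<forall>\<xi>. \<delta> \<xi> > 0) \<and>
      (let N = tube (hm_orbit w) \<delta>;
           M1 = flow_continuation K2_field N (c1.target \<rho>1);
           M3 = flow_continuation K2_field N (c3.target \<rho>3)
       in C1_submanifold 3 M1 \<and> C1_submanifold 3 M3 \<and>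
          intersect_transversely M1 M3 \<and>
          C1_submanifold 2 (M1 \<inter> M3) \<and>
          range (hm_orbit w) \<subseteq> M1 \<inter> M3))"
proof -
  obtain X1 D1 D3 where X1: "open X1" "0 \<in> X1"
    "\<And>x. x \<in> X1 \<Longrightarrow> (G1 has_derivative blinfun_apply (D1 x)) (at x)" "continuous_on X1 D1"
    "\<And>x. x \<in> X1 \<Longrightarrow> (G3 has_derivative blinfun_apply (D3 x)) (at x)" "continuous_on X1 D3"
    "\<And>x. x \<in> X1 \<Longrightarrow> surj (\<lambda>v. (blinfun_apply (D1 x) v, blinfun_apply (D3 x) v))"
    by (rule regular_neighbourhood) (rule that; simp)
  \<comment> \<open>Imposing the conditions along the whole segment from time 0 makes
    \<open>Om\<close> closed under moving towards time 0; compactness of the segment keeps it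
    open.\<close>
  define Om :: "state set" where "Om = {z. snd z \<in> X1 \<and> (\<forall>\<tau>\<in>{0..1}. (\<lambda>(\<tau>, z). (\<tau> * fst z, snd z)) (\<tau>, z) \<in> c1.nbhd \<inter> c3.nbhd \<inter> c1.good)}"
  have Om_open: "open Om"
    unfolding Om_def
  proof (intro open_Collect_conj open_forall_compact open_Int c1.nbhd_open c3.nbhd_open c1.good_open)
    show "open {z::state. snd z \<in> X1}"
      using open_vimage[OF X1(1) continuous_on_snd[OF continuous_on_id]] by (simp add: vimage_def)
    show "continuous_on UNIV (\<lambda>(\<tau>::real, z::state). (\<tau> * fst z, snd z))"
      unfolding split_beta by (intro continuous_intros)
  qed simp
  have Om_sub: "Om \<subseteq> c1.nbhd \<inter> c1.good" "Om \<subseteq> c3.nbhd \<inter> c1.good" "Om \<subseteq> c1.good"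
    unfolding Om_def by (force dest: bspec[of _ _ 1])+
  have Om_axis: "(s, 0) \<in> Om" for s
    using X1(2) c1.axis_nbhd c3.axis_nbhd c1.axis_good by (simp add: Om_def)
  have Om_seg: "(\<tau>, x) \<in> Om" if sx: "(s, x) \<in> Om" and \<tau>: "\<tau> \<in> closed_segment 0 s" for s x \<tau>
  proof -
    obtain u where u: "u \<in> {0..1}" "\<tau> = u * s" using \<tau> by (auto simp: closed_segment_def)
    have "r * u \<in> {0..1}" if "r \<in> {0..1}" for r using that u(1) by (auto intro: mult_le_one)
    then show ?thesis using sx u(2) by (auto simp: Om_def mult.assoc[symmetric])
  qed
  define Y where "Y = c1.Psi_inv -` Om"
  have Y: "open Y" unfolding Y_def
    by (intro open_vimage Om_open C1_on_imp_continuous_on[OF c1.Psi_inv_C1])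
  have YPsi: "Y = c1.Psi ` Om" unfolding Y_def by (force simp: image_iff intro: c1.Psi_inverse(2)[symmetric])
  have rY: "range (hm_orbit w) \<subseteq> Y"
    unfolding YPsi using Om_axis by (auto simp: c1.Psi_axis[symmetric])
  obtain \<delta> where \<delta>: "continuous_on UNIV \<delta>" "\<And>\<xi>. 0 < \<delta> \<xi>" "open (tube (hm_orbit w) \<delta>)"
    "tube (hm_orbit w) \<delta> \<subseteq> Y" "range (hm_orbit w) \<subseteq> tube (hm_orbit w) \<delta>"
    using c1.exists_tube[OF Y rY] by blast
  define N where "N = tube (hm_orbit w) \<delta>"
  have NO: "open N" "N \<subseteq> c1.Psi ` Om" "range (hm_orbit w) \<subseteq> N" "N \<subseteq> Y"
    using \<delta>(3,4,5) unfolding N_def YPsi by simp_all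
  have Ngood: "N \<subseteq> c1.Psi ` c1.good" using NO(2) image_mono[OF Om_sub(3)] by (rule order_trans)
  obtain P' where P': "\<And>X. (c1.Psi_inv has_derivative blinfun_apply (P' X)) (at X)" "continuous_on UNIV P'"
    using c1.Psi_inv_C1 by (metis C1_onE UNIV_I)
  obtain E where E: "\<And>X. (c1.Psi has_derivative blinfun_apply (E X)) (at X)"
    using c1.Psi_C1 by (metis C1_onE UNIV_I)
  have Psurj: "surj (blinfun_apply (P' X))" for X
  proof (rule surjI)
    have "((c1.Psi_inv \<circ> c1.Psi) has_derivative blinfun_apply (P' X) \<circ> blinfun_apply (E (c1.Psi_inv X))) (at (c1.Psi_inv X))"
      by (rule diff_chain_at[OF E]) (simp add: P')
    moreover have "((c1.Psi_inv \<circ> c1.Psi) has_derivative id) (at (c1.Psi_inv X))"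
      by (simp add: o_def id_def)
    ultimately have "blinfun_apply (P' X) \<circ> blinfun_apply (E (c1.Psi_inv X)) = id" by (rule has_derivative_unique)
    from fun_cong[OF this] show "blinfun_apply (P' X) (blinfun_apply (E (c1.Psi_inv X)) v) = v" for v by simp
  qed
  \<comment> \<open>The label of the orbit through \<open>X\<close>; both continued manifolds are
    cut out by functions of this label.\<close>
  define \<pi> where "\<pi> X = snd (c1.Psi_inv X)" for X
  have \<pi>X1: "\<pi> X \<in> X1" if "X \<in> Y" for X using that by (simp add: \<pi>_def Y_def Om_def)
  have \<pi>c: "continuous_on Y \<pi>" unfolding \<pi>_def[abs_def]
    using continuous_on_subset[OF C1_on_imp_continuous_on[OF c1.Psi_inv_C1]] by (intro continuous_on_snd) blast
  define S :: "state \<Rightarrow>\<^sub>L (real \<times> real \<times> real)" where "S = Blinfun snd"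
  have S: "blinfun_apply S = snd" unfolding S_def by (rule bounded_linear_Blinfun_apply[OF bounded_linear_snd])
  define F where "F D X = D (\<pi> X) o\<^sub>L (S o\<^sub>L P' X)" for D :: "real \<times> real \<times> real \<Rightarrow> (real \<times> real \<times> real) \<Rightarrow>\<^sub>L real" and X
  have F: "blinfun_apply (F D X) v = blinfun_apply (D (\<pi> X)) (snd (blinfun_apply (P' X) v))" for D X v
    by (simp add: F_def S)
  have Fd: "((\<lambda>X. \<gamma> (\<pi> X)) has_derivative blinfun_apply (F D X)) (at X)"
    if "\<And>x. x \<in> X1 \<Longrightarrow> (\<gamma> has_derivative blinfun_apply (D x)) (at x)" "X \<in> Y" for \<gamma> D X
  proof -
    have "(\<pi> has_derivative (\<lambda>v. snd (blinfun_apply (P' X) v))) (at X)"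
      unfolding \<pi>_def[abs_def] by (rule has_derivative_snd[OF P'(1)])
    then have "((\<gamma> \<circ> \<pi>) has_derivative blinfun_apply (D (\<pi> X)) \<circ> (\<lambda>v. snd (blinfun_apply (P' X) v))) (at X)"
      by (rule diff_chain_at) (rule that(1)[OF \<pi>X1[OF that(2)]])
    then show ?thesis by (simp add: o_def F[abs_def])
  qed
  have Fc: "continuous_on Y (F D)" if "continuous_on X1 D" for D
    unfolding F_def[abs_def]
    by (intro bounded_bilinear.continuous_on[OF bounded_bilinear_blinfun_compose] continuous_intros
        continuous_on_compose2[OF that \<pi>c] continuous_on_subset[OF P'(2)]) (use \<pi>X1 in auto)
  have d1: "((\<lambda>X. G1 (\<pi> X)) has_derivative blinfun_apply (F D1 X)) (at X)" if "X \<in> Y" for X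
    by (rule Fd[OF X1(3) that])
  have d3: "((\<lambda>X. G3 (\<pi> X)) has_derivative blinfun_apply (F D3 X)) (at X)" if "X \<in> Y" for X
    by (rule Fd[OF X1(5) that])
  note cc1 = Fc[OF X1(4)] and cc3 = Fc[OF X1(6)]
  have surj13: "surj (\<lambda>v. (blinfun_apply (F D1 X) v, blinfun_apply (F D3 X) v))" if "X \<in> Y" for X
  proof -
    have "surj (\<lambda>v. snd (blinfun_apply (P' X) v))"
      using comp_surj[OF Psurj surj_snd] by (simp add: o_def)
    from comp_surj[OF this X1(7)[OF \<pi>X1[OF that]]] show ?thesis by (simp add: o_def F)
  qed
  have surj1: "surj (blinfun_apply (F D1 X))" "surj (blinfun_apply (F D3 X))" if "X \<in> Y" for X
    using comp_surj[OF surj13[OF that] surj_fst] comp_surj[OF surj13[OF that] surj_snd] by (simp_all add: o_def)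
  \<comment> \<open>Small enough for both targets to lie beyond their reference times.\<close>
  define \<rho>0 where "\<rho>0 = min (1 / sqrt T1 ^ 3) (1 / sqrt T3 ^ 3)"
  show ?thesis
  proof (intro exI[of _ \<rho>0] conjI allI impI)
    show "0 < \<rho>0" using c1.T0 c3.T0 by (simp add: \<rho>0_def)
    fix \<rho>1 \<rho>3 assume "0 < \<rho>1 \<and> \<rho>1 \<le> \<rho>0 \<and> 0 < \<rho>3 \<and> \<rho>3 \<le> \<rho>0"
    then have \<rho>: "0 < \<rho>1" "\<rho>1 \<le> 1 / sqrt T1 ^ 3" "0 < \<rho>3" "\<rho>3 \<le> 1 / sqrt T3 ^ 3" by (auto simp: \<rho>0_def)
    define M1 where "M1 = flow_continuation K2_field N (c1.target \<rho>1)"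
    define M3 where "M3 = flow_continuation K2_field N (c3.target \<rho>3)"
    have z1: "G1 x = 0" if "(s, x) \<in> Om" "c1.Psi (s, x) \<in> c1.target \<rho>1" for s x
      by (rule c1.target_G_zero(1)[OF Om_sub(1) _ \<rho>(2) that]) (rule Om_seg)
    have o1: "\<exists>H. open H \<and> z \<in> H \<and> (\<forall>y\<in>H \<inter> Om. G1 (snd y) = 0 \<longrightarrow> c1.Psi y \<in> c1.target \<rho>1)"
      if "c1.Psi z \<in> c1.target \<rho>1" for z
      by (rule c1.target_relatively_open[OF Om_sub(1) _ \<rho>(2) that]) (rule Om_seg)
    have l1: "X \<in> N" "G1 (\<pi> X) = 0"
      "\<exists>V. open V \<and> X \<in> V \<and> (\<forall>Y\<in>V. G1 (\<pi> Y) = 0 \<longrightarrow> Y \<in> M1)" if X: "X \<in> M1" for X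
    proof -
      note l = c1.flow_continuation_level[where \<gamma> = G1, OF Om_sub(3) NO(1,2) _ _ X[unfolded M1_def]]
      show "X \<in> N" by (rule l(1)) (erule (1) z1, erule o1)
      show "G1 (\<pi> X) = 0" unfolding \<pi>_def by (rule l(2)) (erule (1) z1, erule o1)
      show "\<exists>V. open V \<and> X \<in> V \<and> (\<forall>Y\<in>V. G1 (\<pi> Y) = 0 \<longrightarrow> Y \<in> M1)"
        unfolding \<pi>_def M1_def by (rule l(3)) (erule (1) z1, erule o1)
    qed
    have z3: "G3 x = 0" if "(s, x) \<in> Om" "c1.Psi (s, x) \<in> c3.target \<rho>3" for s x
      by (rule c3.target_G_zero(1)[OF Om_sub(2) _ \<rho>(4) that]) (rule Om_seg)
    have o3: "\<exists>H. open H \<and> z \<in> H \<and> (\<forall>y\<in>H \<inter> Om. G3 (snd y) = 0 \<longrightarrow> c1.Psi y \<in> c3.target \<rho>3)"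
      if "c1.Psi z \<in> c3.target \<rho>3" for z
      by (rule c3.target_relatively_open[OF Om_sub(2) _ \<rho>(4) that]) (rule Om_seg)
    have l3: "X \<in> N" "G3 (\<pi> X) = 0"
      "\<exists>V. open V \<and> X \<in> V \<and> (\<forall>Y\<in>V. G3 (\<pi> Y) = 0 \<longrightarrow> Y \<in> M3)" if X: "X \<in> M3" for X
    proof -
      note l = c1.flow_continuation_level[where \<gamma> = G3, OF Om_sub(3) NO(1,2) _ _ X[unfolded M3_def]]
      show "X \<in> N" by (rule l(1)) (erule (1) z3, erule o3)
      show "G3 (\<pi> X) = 0" unfolding \<pi>_def by (rule l(2)) (erule (1) z3, erule o3)
      show "\<exists>V. open V \<and> X \<in> V \<and> (\<forall>Y\<in>V. G3 (\<pi> Y) = 0 \<longrightarrow> Y \<in> M3)"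
        unfolding \<pi>_def M3_def by (rule l(3)) (erule (1) z3, erule o3)
    qed
    have M1Y: "M1 \<subseteq> Y" and M3Y: "M3 \<subseteq> Y" using l1(1) l3(1) NO(4) by auto
    have r1: "\<exists>V. open V \<and> X \<in> V \<and> (\<forall>y\<in>V \<inter> Y. G1 (\<pi> y) = 0 \<longrightarrow> y \<in> M1)" if "X \<in> M1" for X
      using l1(3)[OF that] by blast
    have r3: "\<exists>V. open V \<and> X \<in> V \<and> (\<forall>y\<in>V \<inter> Y. G3 (\<pi> y) = 0 \<longrightarrow> y \<in> M3)" if "X \<in> M3" for X
      using l3(3)[OF that] by blast
    have s1: "C1_submanifold (DIM(state) - DIM(real)) M1"
      and t1: "\<And>X. X \<in> M1 \<Longrightarrow> tangent_space M1 X = {v. blinfun_apply (F D1 X) v = 0}"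
      using level_set_submanifold[OF Y M1Y d1 cc1 surj1(1) l1(2) r1] M1Y by blast+
    have s3: "C1_submanifold (DIM(state) - DIM(real)) M3"
      and t3: "\<And>X. X \<in> M3 \<Longrightarrow> tangent_space M3 X = {v. blinfun_apply (F D3 X) v = 0}"
      using level_set_submanifold[OF Y M3Y d3 cc3 surj1(2) l3(2) r3] M3Y by blast+
    \<comment> \<open>The intersection is relatively open in the zero set of the pair of functions,
      whose differential is onto, so its codimension is 2.\<close>
    have s13: "C1_submanifold (DIM(state) - DIM(real \<times> real)) (M1 \<inter> M3)"
    proof -
      have C: "C1_on Y (\<lambda>X. (G1 (\<pi> X), G3 (\<pi> X)))"
        by (intro C1_on_Pair C1_onI[OF d1 cc1] C1_onI[OF d3 cc3])
      obtain H where H: "\<And>X. X \<in> Y \<Longrightarrow> ((\<lambda>X. (G1 (\<pi> X), G3 (\<pi> X))) has_derivative blinfun_apply (H X)) (at X)" "continuous_on Y H"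
        by (rule C1_onE[OF C]) (rule that; simp)
      have Hs: "surj (blinfun_apply (H X))" if "X \<in> Y" for X
      proof -
        have "blinfun_apply (H X) = (\<lambda>v. (blinfun_apply (F D1 X) v, blinfun_apply (F D3 X) v))"
          by (rule has_derivative_unique[OF H(1)[OF that] has_derivative_Pair[OF d1[OF that] d3[OF that]]])
        then show ?thesis using surj13[OF that] by simp
      qed
      show ?thesis
      proof (rule level_set_submanifold(1)[OF Y _ H])
        show "M1 \<inter> M3 \<subseteq> Y" using M1Y by blast
        fix X assume X: "X \<in> M1 \<inter> M3"
        show "surj (blinfun_apply (H X))" using Hs M1Y X by blast
        show "(G1 (\<pi> X), G3 (\<pi> X)) = 0" using l1(2) l3(2) X by (simp add: zero_prod_def)
        obtain V1 V3 where "open V1" "X \<in> V1" "\<forall>y\<in>V1 \<inter> Y. G1 (\<pi> y) = 0 \<longrightarrow> y \<in> M1"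
          "open V3" "X \<in> V3" "\<forall>y\<in>V3 \<inter> Y. G3 (\<pi> y) = 0 \<longrightarrow> y \<in> M3" using r1[of X] r3[of X] X by blast
        then show "\<exists>V. open V \<and> X \<in> V \<and> (\<forall>y\<in>V \<inter> Y. (G1 (\<pi> y), G3 (\<pi> y)) = 0 \<longrightarrow> y \<in> M1 \<inter> M3)"
          by (intro exI[of _ "V1 \<inter> V3"]) (auto simp: zero_prod_def)
      qed
    qed
    \<comment> \<open>Surjectivity of the pair of differentials gives \<open>a\<close> in the kernel
      of the first with the same value as \<open>v\<close> under the second; then
      \<open>v - a\<close> is in the kernel of the second.\<close>
    have tr: "intersect_transversely M1 M3"
      unfolding intersect_transversely_def
    proof (intro ballI equalityI subset_UNIV subsetI)
      fix X v assume X: "X \<in> M1 \<inter> M3"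
      have "X \<in> Y" using X M1Y by blast
      then obtain a where a: "(0, blinfun_apply (F D3 X) v) = (blinfun_apply (F D1 X) a, blinfun_apply (F D3 X) a)"
        using surjD[OF surj13] by blast
      have "v = a + (v - a)" by simp
      moreover have "a \<in> tangent_space M1 X" "v - a \<in> tangent_space M3 X"
        using t1[of X] t3[of X] X a by (auto simp: blinfun.diff_right)
      ultimately show "v \<in> {a + b |a b. a \<in> tangent_space M1 X \<and> b \<in> tangent_space M3 X}" by blast
    qed
    have o: "range (hm_orbit w) \<subseteq> M1 \<inter> M3"
    proof -
      obtain u1 where u1: "T01 \<le> - u1" "chart_map 1 (hm_orbit w u1) \<in> ball p_plus \<rho>1" using lim1[OF \<rho>(1)] by blast
      obtain u3 where u3: "T03 \<le> u3" "chart_map (- 1) (hm_orbit w u3) \<in> ball p_zero \<rho>3" using lim3[OF \<rho>(3)] by blast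
      have "hm_orbit w u1 \<in> c1.target \<rho>1"
        using c1.orbit[of u1] u1 c1.T0 by (simp add: c1.target_def chart_dom_def hm_orbit_def)
      moreover have "hm_orbit w u3 \<in> c3.target \<rho>3"
        using c3.orbit[of u3] u3 c3.T0 by (simp add: c3.target_def chart_dom_def hm_orbit_def)
      ultimately show ?thesis
        unfolding M1_def M3_def using c1.orbit_in_flow_continuation[OF Ngood NO(3)] by blast
    qed
    show "\<exists>\<delta>. continuous_on UNIV \<delta> \<and> (\<forall>\<xi>. \<delta> \<xi> > 0) \<and>
      (let N = tube (hm_orbit w) \<delta>;
           M1 = flow_continuation K2_field N (c1.target \<rho>1);
           M3 = flow_continuation K2_field N (c3.target \<rho>3)
       in C1_submanifold 3 M1 \<and> C1_submanifold 3 M3 \<and>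
          intersect_transversely M1 M3 \<and>
          C1_submanifold 2 (M1 \<inter> M3) \<and>
          range (hm_orbit w) \<subseteq> M1 \<inter> M3)"
      unfolding Let_def
      using \<delta>(1,2) s1 s3 tr s13 o unfolding DIM_state M1_def M3_def N_def
      by (intro exI[of _ \<delta>]) simp
  qed
qed

end

text \<open>The manifolds are cut down to small balls because a locally invariant set with the right
  tangent space at the equilibrium may have further parts away from it that are not
  controlled.\<close>

theorem proposition6p3:
  fixes w :: "real \<Rightarrow> real" and W1 W3 :: "state set"
  assumes hm: "hastings_mcleod w"
    and W1: "local_center_unstable_manifold K1_field p_plus 3 W1"
    and W1_orbit: "\<forall>\<^sub>F \<xi> in at_bot. hm_orbit w \<xi> \<in> kappa12 ` (W1 \<inter> dom12)"
    and W3: "local_center_stable_manifold K3_field p_zero 3 W3"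
    and W3_orbit: "\<forall>\<^sub>F \<xi> in at_top. hm_orbit w \<xi> \<in> dom23 \<and> kappa23 (hm_orbit w \<xi>) \<in> W3"
  shows "\<exists>\<rho>0>0. \<forall>\<rho>1 \<rho>3. 0 < \<rho>1 \<and> \<rho>1 \<le> \<rho>0 \<and> 0 < \<rho>3 \<and> \<rho>3 \<le> \<rho>0 \<longrightarrow>
    (\<exists>\<delta>. continuous_on UNIV \<delta> \<and> (\<forall>\<xi>. \<delta> \<xi> > 0) \<and>
      (let N = tube (hm_orbit w) \<delta>;
           M1 = flow_continuation K2_field N (kappa12 ` (W1 \<inter> ball p_plus \<rho>1 \<inter> dom12));
           M3 = flow_continuation K2_field N (kappa23 -` (W3 \<inter> ball p_zero \<rho>3) \<inter> dom23)
       in C1_submanifold 3 M1 \<and> C1_submanifold 3 M3 \<and>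
          intersect_transversely M1 M3 \<and>
          C1_submanifold 2 (M1 \<inter> M3) \<and>
          range (hm_orbit w) \<subseteq> M1 \<inter> M3))"
proof -
  interpret hastings_mcleod_solution w by standard (rule hm)
  obtain B1' where W1': "p_plus \<in> W1" "C1_submanifold 3 W1" "open B1'" "W1 \<subseteq> B1'"
    "tangent_space W1 p_plus = spectral_subspace (frechet_derivative K1_field (at p_plus)) {0..}"
    "locally_invariant (chart_field 1) B1' W1"
    using W1 unfolding local_center_unstable_manifold_def local_manifold_tangent_to_def K1_field_eq by blast
  obtain B3' where W3': "p_zero \<in> W3" "C1_submanifold 3 W3" "open B3'" "W3 \<subseteq> B3'"
    "tangent_space W3 p_zero = spectral_subspace (frechet_derivative K3_field (at p_zero)) {..0}"
    "locally_invariant (chart_field (- 1)) B3' W3"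
    using W3 unfolding local_center_stable_manifold_def local_manifold_tangent_to_def K3_field_eq by blast
  note ch1 = adapted_chart[OF W1'(2,1,3,4) center_unstable_tangent[folded W1'(5)]]
  note ch3 = adapted_chart[OF W3'(2,1,3,4) center_stable_tangent[folded W3'(5)]]
  obtain B1 g1 g1' where c1: "open B1" "p_plus \<in> B1" "B1 \<subseteq> B1'"
    "\<And>x. x \<in> B1 \<Longrightarrow> (g1 has_derivative blinfun_apply (g1' x)) (at x)" "continuous_on B1 g1'"
    "\<And>x. x \<in> B1 \<Longrightarrow> x \<in> W1 \<longleftrightarrow> g1 x = (0::real)"
    "\<And>x. x \<in> B1 \<Longrightarrow> blinfun_apply (g1' x) (0, 1, 0, 0) \<noteq> 0"
    "\<And>x. x \<in> B1 \<Longrightarrow> \<exists>l. \<bar>l - sqrt 2\<bar> \<le> 2/5 \<and>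
      blinfun_apply (g1' x) (1, 0, 0, 0) = - l * blinfun_apply (g1' x) (0, 1, 0, 0)"
    by (rule ch1) blast
  obtain B3 g3 g3' where c3: "open B3" "p_zero \<in> B3" "B3 \<subseteq> B3'"
    "\<And>x. x \<in> B3 \<Longrightarrow> (g3 has_derivative blinfun_apply (g3' x)) (at x)" "continuous_on B3 g3'"
    "\<And>x. x \<in> B3 \<Longrightarrow> x \<in> W3 \<longleftrightarrow> g3 x = (0::real)"
    "\<And>x. x \<in> B3 \<Longrightarrow> blinfun_apply (g3' x) (0, 1, 0, 0) \<noteq> 0"
    "\<And>x. x \<in> B3 \<Longrightarrow> \<exists>l. \<bar>l - - 1\<bar> \<le> 2/5 \<and>
      blinfun_apply (g3' x) (1, 0, 0, 0) = - l * blinfun_apply (g3' x) (0, 1, 0, 0)"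
    by (rule ch3) blast
  have ev1: "\<forall>\<^sub>F s in at_bot. chart_map 1 (hm_orbit w s) \<in> B1 \<inter> W1"
    using topological_tendstoD[OF orbit_tendsto_p_plus c1(1,2)] W1_orbit
    by eventually_elim (simp add: kappa12_image)
  have ev3: "\<forall>\<^sub>F s in at_top. chart_map (- 1) (hm_orbit w s) \<in> B3 \<inter> W3"
    using topological_tendstoD[OF orbit_tendsto_p_zero c3(1,2)] W3_orbit
    by eventually_elim (metis IntI kappa23_eq)
  obtain n1 where n1: "\<And>s. s \<le> n1 \<Longrightarrow> chart_map 1 (hm_orbit w s) \<in> B1 \<inter> W1"
    using ev1 by (auto simp: eventually_at_bot_linorder)
  obtain n3 where n3: "\<And>s. n3 \<le> s \<Longrightarrow> chart_map (- 1) (hm_orbit w s) \<in> B3 \<inter> W3"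
    using ev3 by (auto simp: eventually_at_top_linorder)
  define T01 where "T01 = max 1 (- n1)"
  define T03 where "T03 = max 1 n3"
  \<comment> \<open>The left reference time lies beyond \<open>T01\<close> and at a point with w'' >
    w'; on the right any time after \<open>T03\<close> serves.\<close>
  obtain s1 where s1: "s1 \<le> - T01 - 1" "deriv w s1 < s1 * w s1 + 2 * w s1 ^ 3" using slope_points by blast
  interpret two_sides w T01 "- s1" T03 "T03 + 1" W1 B1 B1' W3 B3 B3' g1 g3 g1' g3'
  proof (unfold_locales)
    show "chart_map 1 (hm_orbit w s) \<in> B1 \<inter> W1" if "T01 \<le> - 1 * s" for s
      by (rule n1) (use that in \<open>simp add: T01_def\<close>)
    show "chart_map (- 1) (hm_orbit w s) \<in> B3 \<inter> W3" if "T03 \<le> - (- 1) * s" for s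
      by (rule n3) (use that in \<open>simp add: T03_def\<close>)
    show "\<exists>s. T01 \<le> - s \<and> chart_map 1 (hm_orbit w s) \<in> ball p_plus \<rho>" if "0 < \<rho>" for \<rho>
    proof -
      have "\<forall>\<^sub>F s in at_bot. s \<le> - T01 \<and> chart_map 1 (hm_orbit w s) \<in> ball p_plus \<rho>"
        by (intro eventually_conj eventually_le_at_bot topological_tendstoD[OF orbit_tendsto_p_plus]) (use that in auto)
      then obtain n where "\<forall>s\<le>n. s \<le> - T01 \<and> chart_map 1 (hm_orbit w s) \<in> ball p_plus \<rho>"
        unfolding eventually_at_bot_linorder by blast
      then have "T01 \<le> - n \<and> chart_map 1 (hm_orbit w n) \<in> ball p_plus \<rho>" by force
      then show ?thesis by blast
    qed
    show "\<exists>s. T03 \<le> s \<and> chart_map (- 1) (hm_orbit w s) \<in> ball p_zero \<rho>" if "0 < \<rho>" for \<rho>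
    proof -
      have "\<forall>\<^sub>F s in at_top. T03 \<le> s \<and> chart_map (- 1) (hm_orbit w s) \<in> ball p_zero \<rho>"
        by (intro eventually_conj eventually_ge_at_top topological_tendstoD[OF orbit_tendsto_p_zero]) (use that in auto)
      then obtain n where "\<forall>s\<ge>n. T03 \<le> s \<and> chart_map (- 1) (hm_orbit w s) \<in> ball p_zero \<rho>"
        unfolding eventually_at_top_linorder by blast
      then show ?thesis by blast
    qed
    show "deriv w (- (- s1)) < - (- s1) * w (- (- s1)) + 2 * w (- (- s1)) ^ 3" using s1(2) by simp
    show "1 \<le> T01" "T01 < - s1" "1 \<le> T03" "T03 < T03 + 1" using s1(1) by (auto simp: T01_def T03_def)
    show "fst (snd (snd p_plus)) = 0" "fst (snd (snd p_zero)) = 0" by (simp_all add: p_plus_def p_zero_def)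
  qed (use c1 c3 W1'(6) W3'(6) in blast)+
  have t1: "kappa12 ` (W1 \<inter> ball p_plus \<rho>1 \<inter> dom12) = c1.target \<rho>1" for \<rho>1
    using kappa12_image[of "W1 \<inter> ball p_plus \<rho>1"] by (simp add: c1.target_def)
  have t3: "kappa23 -` (W3 \<inter> ball p_zero \<rho>3) \<inter> dom23 = c3.target \<rho>3" for \<rho>3
    using kappa23_vimage[of "W3 \<inter> ball p_zero \<rho>3"] by (simp add: c3.target_def)
  show ?thesis unfolding t1 t3 by (rule transversal_intersection)
qed

end
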